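(* Fix integers $d\geq 2$ and $r\geq 1$. For $n\geq 1$, let $A_{d+1,r}(n)$ denote the number of words of length $rn$ over the alphabet $\{1,2,\dots,n\}$ in which each letter $i\in\{1,\dots,n\}$ appears exactly $r$ times, and which have no increasing subsequence of length $d+1$. Then, as $n\to\infty$, $$ A_{d+1,r}(n) \sim C_{d+1,r}\cdot n^{-\frac{(d+1)(d-1)}{2}}\left[d^r\binom{r+d-1}{d-1}\right]^n, $$ where $$ C_{d+1,r}=\frac{\sqrt{d}\cdot \prod_{i=1}^{d-1} i!}{(2\pi)^{\frac{d}{2}-\frac{1}{2}}}\left(\frac{d(d+1)}{r(2d+r+1)}\right)^{\frac{(d-1)(d+1)}{2}}. $$
   Context: An increasing subsequence of length $k$ of a word $w_1w_2\cdots w_m$ is a choice of indices $i_1<i_2<\dots<i_k$ with $w_{i_1}<w_{i_2}<\dots<w_{i_k}$ (strictly increasing). *)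

theory Defs
  imports "HOL-Analysis.Analysis" "HOL-Library.Landau_Symbols"
begin

definition increasing_subsequence :: "'a::linorder list \<Rightarrow> nat \<Rightarrow> (nat \<Rightarrow> nat) \<Rightarrow> bool" where
  "increasing_subsequence w k i \<longleftrightarrow>
     i ` {..<k} \<subseteq> {..<length w} \<and>
     strict_mono_on {..<k} i \<and>
     strict_mono_on {..<k} (\<lambda>j. w ! i j)"

definition uniform_words :: "nat \<Rightarrow> nat \<Rightarrow> nat list set" where
  "uniform_words r n =
     {w. length w = r * n \<and> set w \<subseteq> {1..n} \<and> (\<forall>i\<in>{1..n}. count_list w i = r)}"

text \<open>The first argument is the length of the forbidden increasing subsequence.\<close>

definition avoiding_count :: "nat \<Rightarrow> nat \<Rightarrow> nat \<Rightarrow> nat" where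
  "avoiding_count k r n = card {w \<in> uniform_words r n. \<nexists>i. increasing_subsequence w k i}"

end

theory Submission
  imports Defs
    "HOL-Probability.Probability"
    "HOL-Real_Asymp.Real_Asymp"
    "Jordan_Normal_Form.Determinant"
begin

text \<open>By the Robinson-Schensted-Knuth correspondence the words in question correspond to pairs
  of tableaux with at most \<open>d\<close> columns. Both kinds of tableaux are lattice walks in a Weyl chamber,
  so by a reflection argument their number is a coefficient of
  \<open>a\<^sub>\<delta> p\<^sub>1\<^bsup>rn\<^esup> h\<^sub>r\<^bsup>n\<^esup>\<close> (the second factor in the variables, the third in their inverses, \<open>a\<^sub>\<delta>\<close> the
  Vandermonde alternant). After antisymmetrization this is an integral over the torus of
  \<open>|a\<^sub>\<delta>|\<^sup>2 (p\<^sub>1\<^sup>r h\<^sub>r)\<^sup>n\<close>, up to \<open>d!\<close>. The modulus of the integrand is concentrated where all angles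
  agree; there \<open>p\<^sub>1\<^sup>r h\<^sub>r\<close> is \<open>d\<^sup>r\<close> times the number of monomials of degree \<open>r\<close> times a
  characteristic function of mean zero, and rescaling the angles by \<open>sqrt n\<close> turns the integral
  into Mehta's integral of the squared Vandermonde product against a Gaussian, which orthogonality
  of the Hermite polynomials evaluates.\<close>

section \<open>Row insertion on Gelfand-Tsetlin patterns\<close>

text \<open>Strict rows give each letter at most one cell per row. In terms of column lengths, the
  cells of one letter therefore form a horizontal strip, which is why the second factor is a
  complete symmetric function and a multiset number appears in the limit. The two tableaux share a
  shape, yet no sum over shapes is evaluated: the signed count of walks is extended to an
  alternating function on all integer vectors and pulled back along the pattern, level by level, to
  the empty shape. Both chamber constraints disappear in this way. One angle is redundant, so
  Mehta's integral is needed with the common translation of the variables removed. The scale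
  \<open>c = r (2 d + r + 1) / (d (d + 1))\<close> is a variance: for variables of sum zero, each of
  the \<open>r\<close> power sums contributes \<open>1 / d\<close> and the complete sum contributes
  \<open>r (r + d) / (d (d + 1))\<close> times the sum of squares. The exponent of \<open>n\<close>
  is made up of \<open>- (d - 1) / 2\<close> from the rescaled angles and
  \<open>- d (d - 1) / 2\<close> from the squared Vandermonde product.\<close>

text \<open>A tableau with strictly increasing rows and weakly increasing columns is encoded by the
  list of its levels, top level first: level \<open>i\<close> is the sequence of column lengths of the
  sub-tableau formed by the entries \<open>\<le> i\<close>, indexed from 0. In these terms row insertion of \<open>x\<close>
  adds one cell to every level \<open>\<ge> x\<close>, and the column of that cell moves weakly to the left as the
  level grows. The second component of \<open>insert_letter\<close> is its column in the top level.\<close>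

definition interlaces :: "(nat \<Rightarrow> nat) \<Rightarrow> (nat \<Rightarrow> nat) \<Rightarrow> bool" where
  "interlaces a b \<longleftrightarrow> (\<forall>j. a j \<le> b j \<and> b (Suc j) \<le> a j)"

fun top_level :: "(nat \<Rightarrow> nat) list \<Rightarrow> nat \<Rightarrow> nat" where
  "top_level [] = (\<lambda>_. 0)"
| "top_level (b # p) = b"

fun gt_pattern :: "(nat \<Rightarrow> nat) list \<Rightarrow> bool" where
  "gt_pattern [] \<longleftrightarrow> True"
| "gt_pattern (b # p) \<longleftrightarrow> interlaces (top_level p) b \<and> gt_pattern p"

definition level :: "(nat \<Rightarrow> nat) list \<Rightarrow> nat \<Rightarrow> nat \<Rightarrow> nat" where
  "level p i = top_level (drop (length p - i) p)"

text \<open>The inequality \<open>b j <= a (j - 1)\<close> is the only one that can fail when column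
  \<open>j\<close> of \<open>b\<close> grows over a fixed lower level \<open>a\<close>. Room means
  that the row which receives the cell does not yet contain the letter of this level, so the
  greatest column with room belongs to the topmost such row.\<close>

definition room :: "(nat \<Rightarrow> nat) \<Rightarrow> (nat \<Rightarrow> nat) \<Rightarrow> nat \<Rightarrow> bool" where
  "room a b j \<longleftrightarrow> j = 0 \<or> b j < a (j - 1)"

fun insert_letter :: "nat \<Rightarrow> (nat \<Rightarrow> nat) list \<Rightarrow> (nat \<Rightarrow> nat) list \<times> nat" where
  "insert_letter x [] = ([], 0)"
| "insert_letter x (b # p) =
    (if x = Suc (length p) then
       let j = (GREATEST j. room (top_level p) b j) in (b(j := Suc (b j)) # p, j)
     else
       let (p', l) = insert_letter x p;
           j = (GREATEST j. j \<le> l \<and> room (top_level p) b j)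
       in (b(j := Suc (b j)) # p', j))"

declare insert_letter.simps(2) [simp del]

definition insert_word :: "nat \<Rightarrow> nat list \<Rightarrow> (nat \<Rightarrow> nat) list" where
  "insert_word n w = foldl (\<lambda>p x. fst (insert_letter x p)) (replicate n (\<lambda>_. 0)) w"

text \<open>For antitone \<open>b\<close>, this counts the standard tableaux with column lengths
  \<open>b\<close>, by removal of the last cell. The recording tableau of the correspondence enters
  only through this number.\<close>

fun walks :: "nat \<Rightarrow> (nat \<Rightarrow> nat) \<Rightarrow> nat" where
  "walks 0 b = (if b = (\<lambda>_. 0) then 1 else 0)"
| "walks (Suc m) b = (\<Sum>j | b (Suc j) < b j. walks m (b(j := b j - 1)))"

section \<open>Insertion into a pattern and its inverse\<close>

lemma interlacesD: "interlaces a b \<Longrightarrow> a j \<le> b j" "interlaces a b \<Longrightarrow> b (Suc j) \<le> a j"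
  by (auto simp: interlaces_def)

lemma interlaces_antimono:
  assumes "interlaces a b" shows "antimono b"
  by (intro decseq_SucI) (meson assms interlacesD order_trans)

lemma top_level_antimono: "gt_pattern p \<Longrightarrow> antimono (top_level p)"
  by (cases p) (auto simp: antimono_def intro: interlaces_antimono[THEN antimonoD])

lemma top_level_support: "gt_pattern p \<Longrightarrow> length p \<le> j \<Longrightarrow> top_level p j = 0"
proof (induction p arbitrary: j)
  case (Cons b p)
  then obtain k where "j = Suc k" "length p \<le> k" by (cases j) auto
  then show ?case using Cons interlacesD(2)[of "top_level p" b k] by auto
qed auto

lemma room_bound: "gt_pattern p \<Longrightarrow> room (top_level p) b j \<Longrightarrow> j \<le> length p"
  using top_level_support[of p "j - 1"] by (force simp: room_def)

lemma insert_letter_new: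
  assumes "gt_pattern (b # p)" "insert_letter (Suc (length p)) (b # p) = (p', j)"
  shows "p' = b(j := Suc (b j)) # p" "room (top_level p) b j"
    "\<And>k. j < k \<Longrightarrow> \<not> room (top_level p) b k"
proof -
  let ?P = "room (top_level p) b"
  have j: "j = (GREATEST j. ?P j)" and "p' = b(j := Suc (b j)) # p"
    using assms by (auto simp: Let_def insert_letter.simps(2))
  have bd: "\<forall>y. ?P y \<longrightarrow> y \<le> length p" using assms room_bound by auto
  have "?P 0" by (simp add: room_def)
  show "?P j" unfolding j by (rule GreatestI_nat[where P = ?P, OF \<open>?P 0\<close>]) (use bd in auto)
  show "\<not> ?P k" if "j < k" for k
    using Greatest_le_nat[of ?P k "length p"] bd that j by force
  show "p' = b(j := Suc (b j)) # p" by fact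
qed

lemma insert_letter_bump:
  assumes "insert_letter x (b # p) = (p', j)" "x \<noteq> Suc (length p)"
  obtains p0 l where "insert_letter x p = (p0, l)" "p' = b(j := Suc (b j)) # p0" "j \<le> l"
    "room (top_level p) b j" "\<And>k. j < k \<Longrightarrow> k \<le> l \<Longrightarrow> \<not> room (top_level p) b k"
proof -
  obtain p0 l where ins: "insert_letter x p = (p0, l)" by fastforce
  let ?P = "\<lambda>j. j \<le> l \<and> room (top_level p) b j"
  have j: "j = (GREATEST j. ?P j)" and "p' = b(j := Suc (b j)) # p0"
    using assms ins by (auto simp: Let_def insert_letter.simps(2))
  have "?P 0" by (simp add: room_def)
  have "?P j" unfolding j by (rule GreatestI_nat[where P = ?P, OF \<open>?P 0\<close>]) auto
  moreover have "\<not> room (top_level p) b k" if "j < k" "k \<le> l" for k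
    using Greatest_le_nat[of ?P k l] that j by force
  ultimately show ?thesis using that ins \<open>p' = _\<close> by blast
qed

lemma insert_letter_newI:
  assumes "room (top_level p) b j" "\<And>k. j < k \<Longrightarrow> \<not> room (top_level p) b k"
  shows "insert_letter (Suc (length p)) (b # p) = (b(j := Suc (b j)) # p, j)"
proof -
  have "(GREATEST j. room (top_level p) b j) = j"
    using assms by (intro Greatest_equality) (auto simp: not_less[symmetric])
  then show ?thesis by (simp add: insert_letter.simps(2))
qed

lemma insert_letter_bumpI:
  assumes "insert_letter x p = (p0, l)" "x \<noteq> Suc (length p)" "j \<le> l"
    "room (top_level p) b j" "\<And>k. j < k \<Longrightarrow> k \<le> l \<Longrightarrow> \<not> room (top_level p) b k"
  shows "insert_letter x (b # p) = (b(j := Suc (b j)) # p0, j)"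
proof -
  have "(GREATEST j. j \<le> l \<and> room (top_level p) b j) = j"
    using assms by (intro Greatest_equality) (auto simp: not_less[symmetric])
  then show ?thesis using assms by (simp add: insert_letter.simps(2))
qed

lemma insert_letter_pattern:
  assumes "gt_pattern p" "x \<in> {1..length p}" "insert_letter x p = (p', j)"
  shows "gt_pattern p'" "length p' = length p"
    "top_level p' = (top_level p)(j := Suc (top_level p j))"
proof -
  have "gt_pattern p' \<and> length p' = length p \<and> top_level p' = (top_level p)(j := Suc (top_level p j))"
    using assms
  proof (induction p arbitrary: p' j)
    case (Cons b p)
    have il: "interlaces (top_level p) b" and gt: "gt_pattern p" using Cons.prems by auto
    show ?case
    proof (cases "x = Suc (length p)")
      case True
      note * = insert_letter_new[OF Cons.prems(1), of p' j]
      have "interlaces (top_level p) (b(j := Suc (b j)))"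
        using *(2) True Cons.prems(3) interlacesD[OF il]
        by (auto simp: interlaces_def room_def intro: le_SucI)
      then show ?thesis using * True Cons.prems by auto
    next
      case False
      then obtain p0 l where ins: "insert_letter x p = (p0, l)" "p' = b(j := Suc (b j)) # p0" "j \<le> l"
        "room (top_level p) b j" "\<And>k. j < k \<Longrightarrow> k \<le> l \<Longrightarrow> \<not> room (top_level p) b k"
        using insert_letter_bump[OF Cons.prems(3)] by metis
      have IH: "gt_pattern p0" "length p0 = length p"
        "top_level p0 = (top_level p)(l := Suc (top_level p l))"
        using Cons.IH[OF gt _ ins(1)] False Cons.prems(2) by auto
      have am: "antimono (top_level p0)" using IH top_level_antimono by blast
      \<comment> \<open>This is the inequality endangered by the new cell in column \<open>l\<close>
        one level below. Column \<open>l\<close> was skipped for lack of room, so \<open>b l\<close>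
        is at least \<open>top_level p (l - 1)\<close>, and that exceeds
        \<open>top_level p l\<close> because the lower level is still antitone after its own
        insertion.\<close>
      have "Suc (top_level p l) \<le> b l" if "l \<noteq> j"
      proof -
        have "j < l" using that ins by simp
        then obtain l' where l': "l = Suc l'" by (cases l) auto
        have "top_level p l' \<le> b l" using ins(5)[OF \<open>j < l\<close>] l' by (simp add: room_def)
        moreover have "top_level p0 l \<le> top_level p0 l'" using am l' by (simp add: antimono_def)
        ultimately show ?thesis using l' IH(3) by simp
      qed
      moreover have "Suc (b j) \<le> top_level p (j - 1)" if "j > 0"
        using ins(4) that by (simp add: room_def)
      ultimately have "interlaces (top_level p0) (b(j := Suc (b j)))"
        using interlacesD[OF il] unfolding IH interlaces_def by (auto intro: le_SucI)
      then show ?thesis using IH ins by auto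
    qed
  qed auto
  then show "gt_pattern p'" "length p' = length p"
    "top_level p' = (top_level p)(j := Suc (top_level p j))" by auto
qed

text \<open>Reverse bumping. A corner \<open>j\<close> of the top level determines the cell to be
  undone one level below: its column is the least \<open>k >= j\<close> with
  \<open>b' (Suc k) < a' k\<close>. If there is none, the inserted letter is the one of the top
  level. Existence and uniqueness are proved together because the induction step needs both for the
  lower level.\<close>

lemma insert_letter_inverse:
  assumes "gt_pattern p'" "top_level p' (Suc j) < top_level p' j"
  shows "\<exists>x q. (gt_pattern q \<and> length q = length p' \<and> x \<in> {1..length p'} \<and> insert_letter x q = (p', j)) \<and>
    (\<forall>x' q'. gt_pattern q' \<and> length q' = length p' \<and> x' \<in> {1..length p'} \<and> insert_letter x' q' = (p', j)
       \<longrightarrow> x' = x \<and> q' = q)"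
  using assms
proof (induction p' arbitrary: j)
  case (Cons b' p')
  define a' where "a' = top_level p'"
  have il: "interlaces a' b'" and gt: "gt_pattern p'" using Cons.prems a'_def by auto
  have corner: "b' (Suc j) < b' j" using Cons.prems by simp
  define b where "b = b'(j := b' j - 1)"
  have b': "b' = b(j := Suc (b j))" using corner b_def by auto
  have ilD: "a' k \<le> b' k" "b' (Suc k) \<le> a' k" for k using interlacesD[OF il] by auto
  let ?P = "\<lambda>k. j \<le> k \<and> b' (Suc k) < a' k"
  \<comment> \<open>Any preimage has to look like this. The minimality of \<open>l\<close> expresses
    that the columns strictly right of \<open>j\<close> up to \<open>l\<close> had no room, since
    \<open>b' (Suc k) >= a' k\<close> is lack of room in column \<open>Suc k\<close>.\<close>
  have inv: "q = b # tl q \<and> gt_pattern (tl q) \<and> interlaces (top_level (tl q)) b \<and> (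
      (x = Suc (length p') \<and> tl q = p' \<and> (\<forall>k. \<not> ?P k)) \<or>
      (\<exists>l. x \<in> {1..length p'} \<and> insert_letter x (tl q) = (p', l) \<and> ?P l \<and> (\<forall>k<l. \<not> ?P k)))"
    if q: "gt_pattern q" "length q = Suc (length p')" "x \<in> {1..Suc (length p')}"
      "insert_letter x q = (b' # p', j)" for x q
  proof -
    obtain c p where qc: "q = c # p" "length p = length p'" using q by (cases q) auto
    note gtq = q(1)[unfolded qc]
    have "top_level (b' # p') = (top_level q)(j := Suc (top_level q j))"
      using insert_letter_pattern(3)[OF q(1) _ q(4)] q by simp
    then have "b' = c(j := Suc (c j))" using qc by simp
    then have cb: "c = b" by (auto simp: b_def)
    show ?thesis
    proof (cases "x = Suc (length p')")
      case True
      have ins': "insert_letter (Suc (length p)) (c # p) = (b' # p', j)"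
        using q(4) unfolding qc(1) True qc(2) .
      have *: "p = p'" "\<And>k. j < k \<Longrightarrow> \<not> room (top_level p) c k"
        using insert_letter_new[OF gtq ins'] by blast+
      have "\<not> ?P k" for k
        using *(2)[of "Suc k"] * cb b_def by (auto simp: room_def a'_def)
      then show ?thesis using * True qc cb gtq by auto
    next
      case False
      then have "x \<noteq> Suc (length p)" using qc by simp
      then obtain p0 l where ins: "insert_letter x p = (p0, l)" "b' # p' = c(j := Suc (c j)) # p0" "j \<le> l"
        "room (top_level p) c j" "\<And>k. j < k \<Longrightarrow> k \<le> l \<Longrightarrow> \<not> room (top_level p) c k"
        using insert_letter_bump[OF q(4)[unfolded qc]] by metis
      have x: "x \<in> {1..length p}" using False q(3) qc by auto
      have a': "a' = (top_level p)(l := Suc (top_level p l))"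
        using insert_letter_pattern(3)[OF _ x ins(1)] gtq ins(2) by (simp add: a'_def)
      have il': "interlaces (top_level p) b" using gtq cb by simp
      have "\<not> ?P k" if "k < l" for k
        using ins(5)[of "Suc k"] that cb by (auto simp: room_def a' b_def)
      moreover have "?P l"
        using interlacesD(2)[OF il', of l] ins(3) a' by (simp add: b_def split: if_splits)
      ultimately show ?thesis using ins x qc cb gtq by auto
    qed
  qed
  show ?case
  proof (cases "\<exists>k. ?P k")
    case False
    have aj: "a' k = b' (Suc k)" if "j \<le> k" for k using False ilD(2)[of k] that by (meson le_antisym not_less)
    have il': "interlaces a' b"
      unfolding interlaces_def b_def using ilD aj[of j] corner
      by (auto intro: order_trans[OF diff_le_self])
    have ex: "insert_letter (Suc (length p')) (b # p') = (b' # p', j)"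
      unfolding b'
    proof (rule insert_letter_newI)
      show "room (top_level p') b j"
        using ilD(2)[of "j - 1"] corner by (cases j) (auto simp: room_def b_def a'_def)
      show "\<not> room (top_level p') b k" if "j < k" for k
        using aj[of "k - 1"] that by (auto simp: room_def b_def a'_def)
    qed
    show ?thesis
    proof (intro exI[of _ "Suc (length p')"] exI[of _ "b # p'"] conjI allI impI)
      show "gt_pattern (b # p')" using il' gt a'_def by simp
      show "insert_letter (Suc (length p')) (b # p') = (b' # p', j)" by fact
      fix x q assume "gt_pattern q \<and> length q = length (b' # p') \<and> x \<in> {1..length (b' # p')} \<and> insert_letter x q = (b' # p', j)"
      then have "q = b # tl q" "x = Suc (length p') \<and> tl q = p'" using inv[of q x] False by auto
      then show "x = Suc (length p')" "q = b # p'" by metis+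
    qed auto
  next
    case True
    define l where "l = (LEAST k. ?P k)"
    have l: "?P l" unfolding l_def by (rule LeastI_ex[OF True])
    have lmin: "\<not> ?P k" if "k < l" for k using not_less_Least that l_def by blast
    have aj: "a' k = b' (Suc k)" if "j \<le> k" "k < l" for k
      using lmin[OF that(2)] ilD(2)[of k] that by (meson le_antisym not_less)
    have "a' (Suc l) < a' l" using l ilD(1)[of "Suc l"] by linarith
    from Cons.IH[OF gt this[unfolded a'_def]] obtain x p where xp:
      "gt_pattern p" "length p = length p'" "x \<in> {1..length p'}" "insert_letter x p = (p', l)"
      and uniq: "\<And>x2 p2. gt_pattern p2 \<Longrightarrow> length p2 = length p' \<Longrightarrow> x2 \<in> {1..length p'} \<Longrightarrow>
         insert_letter x2 p2 = (p', l) \<Longrightarrow> x2 = x \<and> p2 = p" by metis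
    have a': "a' = (top_level p)(l := Suc (top_level p l))"
      using insert_letter_pattern(3)[OF xp(1) _ xp(4)] xp by (simp add: a'_def)
    define a where "a = top_level p"
    have al: "a l = a' l - 1" "\<And>k. k \<noteq> l \<Longrightarrow> a k = a' k" using a' a_def by auto
    have il': "interlaces a b"
      unfolding interlaces_def
    proof (intro allI conjI)
      fix k
      show "a k \<le> b k"
      proof (cases "k = j")
        case True
        show ?thesis
        proof (cases "j = l")
          case True
          then show ?thesis using \<open>k = j\<close> al ilD(1)[of l] by (simp add: b_def diff_le_mono)
        next
          case False
          then have "a j = b' (Suc j)" using aj[of j] al(2)[of j] l by auto
          then show ?thesis using corner True by (simp add: b_def)
        qed
      next
        case False
        then show ?thesis using al ilD(1)[of k] by (cases "k = l") (auto simp: b_def)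
      qed
      show "b (Suc k) \<le> a k"
        using al(2)[of k] ilD(2)[of k] l al(1)
        by (cases "k = l") (auto simp: b_def)
    qed
    have ex: "insert_letter x (b # p) = (b' # p', j)"
      unfolding b'
    proof (rule insert_letter_bumpI[OF xp(4)])
      show "x \<noteq> Suc (length p)" "j \<le> l" using xp l by auto
      show "room (top_level p) b j"
      proof (cases j)
        case (Suc i)
        then have "a i = a' i" using al l by auto
        then show ?thesis using ilD(2)[of i] corner Suc by (auto simp: room_def b_def a_def)
      qed (simp add: room_def)
      show "\<not> room (top_level p) b k" if "j < k" "k \<le> l" for k
      proof -
        obtain i where i: "k = Suc i" "j \<le> i" "i < l" using \<open>j < k\<close> \<open>k \<le> l\<close> by (cases k) auto
        then show ?thesis using aj[of i] al(2)[of i] by (simp add: room_def b_def a_def)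
      qed
    qed
    show ?thesis
    proof (intro exI[of _ x] exI[of _ "b # p"] conjI allI impI)
      show "gt_pattern (b # p)" using il' xp a_def by simp
      show "insert_letter x (b # p) = (b' # p', j)" by fact
      show "length (b # p) = length (b' # p')" "x \<in> {1..length (b' # p')}" using xp by auto
      fix x2 q assume q: "gt_pattern q \<and> length q = length (b' # p') \<and> x2 \<in> {1..length (b' # p')} \<and> insert_letter x2 q = (b' # p', j)"
      then have I: "q = b # tl q \<and> gt_pattern (tl q) \<and> interlaces (top_level (tl q)) b \<and> (
      (x2 = Suc (length p') \<and> tl q = p' \<and> (\<forall>k. \<not> ?P k)) \<or>
      (\<exists>l. x2 \<in> {1..length p'} \<and> insert_letter x2 (tl q) = (p', l) \<and> ?P l \<and> (\<forall>k<l. \<not> ?P k)))"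
        by (intro inv) auto
      then obtain l2 where l2: "x2 \<in> {1..length p'}" "insert_letter x2 (tl q) = (p', l2)" "?P l2" "\<forall>k<l2. \<not> ?P k"
        using True by blast
      have "l2 = l" using l2 l lmin by (meson linorder_neqE_nat)
      then have "x2 = x \<and> tl q = p" using uniq[of "tl q" x2] I l2 q by auto
      then show "x2 = x" "q = b # p" using I by metis+
    qed
  qed
qed auto

section \<open>Counting the words with a given insertion pattern\<close>

lemma length_insert_letter: "length (fst (insert_letter x p)) = length p"
  by (induction p) (auto simp: insert_letter.simps(2) Let_def split: prod.split)

lemma gt_pattern_replicate: "gt_pattern (replicate n (\<lambda>_. 0))"
proof (induction n)
  case (Suc n)
  then show ?case by (cases n) (auto simp: interlaces_def)
qed simp

lemma insert_word_Nil [simp]: "insert_word n [] = replicate n (\<lambda>_. 0)"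
  and insert_word_snoc: "insert_word n (w @ [x]) = fst (insert_letter x (insert_word n w))"
  by (auto simp: insert_word_def)

lemma length_insert_word [simp]: "length (insert_word n w) = n"
  by (induction w rule: rev_induct) (auto simp: insert_word_snoc length_insert_letter)

lemma gt_pattern_insert_word: "set w \<subseteq> {1..n} \<Longrightarrow> gt_pattern (insert_word n w)"
proof (induction w rule: rev_induct)
  case (snoc x w)
  then show ?case
    using insert_letter_pattern(1)[of "insert_word n w" x] 
    by (simp add: insert_word_snoc) (metis prod.collapse)
qed (simp add: gt_pattern_replicate)

lemma gt_pattern_top_zero:
  assumes "gt_pattern p" "top_level p = (\<lambda>_. 0)"
  shows "p = replicate (length p) (\<lambda>_. 0)"
  using assms
proof (induction p)
  case (Cons b p)
  then have "top_level p = (\<lambda>_. 0)" using interlacesD(1)[of "top_level p" b] by auto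
  then show ?case using Cons by simp
qed simp

lemma finite_words: "finite {w. length w = m \<and> set w \<subseteq> {1..n::nat} \<and> P w}"
  by (rule finite_subset[OF _ finite_lists_length_eq[of "{1..n}" m]]) auto

text \<open>By reverse bumping, a word is the same as a corner of its final shape together with the
  shorter word obtained by undoing the insertion there. This is the recursion of
  \<open>walks\<close>, so the fibre depends on the shape only.\<close>

lemma card_insert_word_fibre:
  assumes "gt_pattern p" "length p = n"
  shows "card {w. length w = m \<and> set w \<subseteq> {1..n} \<and> insert_word n w = p} = walks m (top_level p)"
  using assms
proof (induction m arbitrary: p)
  case 0
  have "{w. length w = 0 \<and> set w \<subseteq> {1..n} \<and> insert_word n w = p} =
    (if p = replicate n (\<lambda>_. 0) then {[]} else {})" by auto
  moreover have "p = replicate n (\<lambda>_. 0) \<longleftrightarrow> top_level p = (\<lambda>_. 0)"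
    using gt_pattern_top_zero 0 by (metis length_0_conv replicate_Suc replicate_empty top_level.simps list.exhaust length_Cons)
  ultimately show ?case by simp
next
  case (Suc m)
  define J where "J = {j. top_level p (Suc j) < top_level p j}"
  define W where "W m p = {w. length w = m \<and> set w \<subseteq> {1..n} \<and> insert_word n w = p}" for m p
  have finW: "finite (W m q)" for m q unfolding W_def by (rule finite_words)
  have "J \<subseteq> {..<n}"
  proof
    fix j assume "j \<in> J"
    then show "j \<in> {..<n}" using top_level_support[OF Suc.prems(1), of j] Suc.prems by (force simp: J_def)
  qed
  then have finJ: "finite J" using finite_subset by blast
  have "\<forall>j\<in>J. \<exists>x q. (gt_pattern q \<and> length q = n \<and> x \<in> {1..n} \<and> insert_letter x q = (p, j)) \<and>
    (\<forall>x' q'. gt_pattern q' \<and> length q' = n \<and> x' \<in> {1..n} \<and> insert_letter x' q' = (p, j)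
       \<longrightarrow> x' = x \<and> q' = q)"
    using insert_letter_inverse[OF Suc.prems(1)] Suc.prems(2) by (auto simp: J_def)
  then obtain X Q where XQ: "\<And>j. j \<in> J \<Longrightarrow> gt_pattern (Q j) \<and> length (Q j) = n \<and> X j \<in> {1..n} \<and> insert_letter (X j) (Q j) = (p, j)"
    and uniq: "\<And>j x' q'. j \<in> J \<Longrightarrow> gt_pattern q' \<and> length q' = n \<and> x' \<in> {1..n} \<and> insert_letter x' q' = (p, j)
       \<Longrightarrow> x' = X j \<and> q' = Q j" by metis
  have topQ: "top_level (Q j) = (top_level p)(j := top_level p j - 1)" if "j \<in> J" for j
  proof -
    have "top_level p = (top_level (Q j))(j := Suc (top_level (Q j) j))"
      using insert_letter_pattern(3)[of "Q j" "X j" p j] XQ[OF that] by auto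
    then show ?thesis by auto
  qed
  have "W (Suc m) p = (\<Union>j\<in>J. (\<lambda>w. w @ [X j]) ` W m (Q j))"
  proof (intro equalityI subsetI)
    fix w assume w: "w \<in> W (Suc m) p"
    then obtain u x where ux: "w = u @ [x]" by (cases w rule: rev_cases) (auto simp: W_def)
    obtain p' j where ins: "insert_letter x (insert_word n u) = (p', j)" by fastforce
    have u: "length u = m" "set u \<subseteq> {1..n}" "x \<in> {1..n}" "p' = p"
      using w ux ins by (auto simp: W_def insert_word_snoc)
    have gtu: "gt_pattern (insert_word n u)" using u gt_pattern_insert_word by blast
    have "top_level p = (top_level (insert_word n u))(j := Suc (top_level (insert_word n u) j))"
      using insert_letter_pattern(3)[OF gtu _ ins] u by simp
    then have "j \<in> J"
      using top_level_antimono[OF gtu] unfolding J_def by (auto simp: antimono_def less_Suc_eq_le)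
    then have "x = X j \<and> insert_word n u = Q j"
      by (intro uniq) (use gtu u ins in auto)
    then show "w \<in> (\<Union>j\<in>J. (\<lambda>w. w @ [X j]) ` W m (Q j))"
      using \<open>j \<in> J\<close> u ux by (auto simp: W_def)
  next
    fix w assume "w \<in> (\<Union>j\<in>J. (\<lambda>w. w @ [X j]) ` W m (Q j))"
    then show "w \<in> W (Suc m) p" using XQ by (fastforce simp: W_def insert_word_snoc)
  qed
  also have "card \<dots> = (\<Sum>j\<in>J. card ((\<lambda>w. w @ [X j]) ` W m (Q j)))"
  proof (rule card_UN_disjoint[OF finJ])
    show "\<forall>j\<in>J. finite ((\<lambda>w. w @ [X j]) ` W m (Q j))" using finW by blast
    show "\<forall>i\<in>J. \<forall>j\<in>J. i \<noteq> j \<longrightarrow> (\<lambda>w. w @ [X i]) ` W m (Q i) \<inter> (\<lambda>w. w @ [X j]) ` W m (Q j) = {}"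
    proof (intro ballI impI, rule ccontr)
      fix i j assume ij: "i \<in> J" "j \<in> J" "i \<noteq> j" "(\<lambda>w. w @ [X i]) ` W m (Q i) \<inter> (\<lambda>w. w @ [X j]) ` W m (Q j) \<noteq> {}"
      then have "X i = X j" "Q i = Q j" by (auto simp: W_def)
      then have "(p, i) = (p, j)" using XQ[OF ij(1)] XQ[OF ij(2)] by metis
      then show False using ij by simp
    qed
  qed
  also have "\<dots> = (\<Sum>j\<in>J. walks m ((top_level p)(j := top_level p j - 1)))"
  proof (intro sum.cong refl)
    fix j assume j: "j \<in> J"
    have "card ((\<lambda>w. w @ [X j]) ` W m (Q j)) = card (W m (Q j))"
      by (intro card_image) (auto simp: inj_on_def)
    then show "card ((\<lambda>w. w @ [X j]) ` W m (Q j)) = walks m ((top_level p)(j := top_level p j - 1))"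
      using Suc.IH[of "Q j"] XQ[OF j] topQ[OF j] by (simp add: W_def fun_upd_def)
  qed
  finally show ?case by (simp add: W_def J_def)
qed

section \<open>Level sizes and increasing subsequences\<close>

lemma level_0 [simp]: "level p 0 = (\<lambda>_. 0)"
  by (simp add: level_def)

lemma level_length: "level p (length p) = top_level p"
  by (simp add: level_def)

lemma level_Cons: "i \<le> length p \<Longrightarrow> level (b # p) i = level p i"
  by (simp add: level_def Suc_diff_le)

lemma level_Cons_top [simp]: "level (b # p) (Suc (length p)) = b"
  by (simp add: level_def)

lemma level_replicate: "level (replicate n (\<lambda>_. 0)) i = (\<lambda>_. 0)"
proof -
  have "top_level (replicate m (\<lambda>_. 0)) = (\<lambda>_. 0)" for m by (cases m) auto
  then show ?thesis by (simp add: level_def)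
qed

lemma level_insert_letter:
  assumes "gt_pattern p" "x \<in> {1..length p}" "insert_letter x p = (p', j)" "i \<le> length p"
  shows "if x \<le> i then \<exists>k. level p' i = (level p i)(k := Suc (level p i k)) else level p' i = level p i"
  using assms
proof (induction p arbitrary: p' j)
  case (Cons b p)
  show ?case
  proof (cases "i = Suc (length p)")
    case True
    then show ?thesis
      using insert_letter_pattern[OF Cons.prems(1-3)] Cons.prems(2) level_length[of p'] by auto
  next
    case i: False
    show ?thesis
    proof (cases "x = Suc (length p)")
      case True
      then show ?thesis using insert_letter_new(1)[of b p p' j] Cons.prems i by (auto simp: level_Cons)
    next
      case False
      obtain p0 l where ins: "insert_letter x p = (p0, l)" "p' = b(j := Suc (b j)) # p0"
        using insert_letter_bump[OF Cons.prems(3) False] by metis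
      have "length p0 = length p" using length_insert_letter[of x p] ins by simp
      then have "level p' i = level p0 i" "level (b # p) i = level p i"
        using ins(2) i Cons.prems(4) by (simp_all add: level_Cons)
      then show ?thesis using Cons.IH[OF _ _ ins(1)] Cons.prems i False
        by (simp del: fun_upd_apply add: fun_upd_def[symmetric])
    qed
  qed
qed auto

text \<open>Each inserted \<open>x\<close> puts one cell into every level from \<open>x\<close> on.
  The cutoff \<open>N\<close> is left free so that it can later be compared with
  \<open>d\<close>.\<close>

lemma sum_level_insert_word:
  assumes "set w \<subseteq> {1..n}" "i \<le> n" "n \<le> N"
  shows "(\<Sum>j<N. level (insert_word n w) i j) = length (filter (\<lambda>x. x \<le> i) w)"
  using assms(1)
proof (induction w rule: rev_induct)
  case (snoc x w)
  define p where "p = insert_word n w"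
  obtain p' j where ins: "insert_letter x p = (p', j)" by fastforce
  have p: "gt_pattern p" "x \<in> {1..length p}" "i \<le> length p"
    using snoc.prems gt_pattern_insert_word[of w n] assms by (auto simp: p_def)
  have p': "insert_word n (w @ [x]) = p'" by (simp add: insert_word_snoc p_def[symmetric] ins)
  have gtp': "gt_pattern p'" "length p' = n"
    using insert_letter_pattern[OF p(1,2) ins] by (auto simp: p_def)
  have supp: "level p' i k = 0" if "n \<le> k" for k
  proof -
    have "gt_pattern (drop m p')" for m
      using gtp'(1) by (induction p' arbitrary: m) (auto simp: drop_Cons split: nat.split)
    then show ?thesis unfolding level_def by (intro top_level_support) (use that gtp' assms in auto)
  qed
  show ?case
  proof (cases "x \<le> i")
    case True
    then obtain k where k: "level p' i = (level p i)(k := Suc (level p i k))"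
      using level_insert_letter[OF p(1,2) ins p(3)] by auto
    have "k < N" using supp[of k] k assms(3) by (cases "k < n") auto
    have "(\<Sum>j<N. level p' i j) = (\<Sum>j<N. level p i j + (if j = k then 1 else 0))"
      unfolding k by (intro sum.cong) auto
    also have "\<dots> = (\<Sum>j<N. level p i j) + 1"
      using \<open>k < N\<close> by (simp add: sum.distrib)
    finally show ?thesis using True snoc by (simp add: p' p_def)
  next
    case False
    then show ?thesis using level_insert_letter[OF p(1,2) ins p(3)] snoc by (simp add: p' p_def)
  qed
qed (simp add: level_replicate)

text \<open>This is the recursion satisfied by the lengths of increasing subsequences (compare
  \<open>increasing_below_snoc\<close>): the number of nonempty columns of level \<open>i\<close> is the maximal length
  of an increasing subsequence with letters \<open>\<le> i\<close>.\<close>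

lemma level_insert_letter_positive:
  assumes "gt_pattern p" "x \<in> {1..length p}" "insert_letter x p = (p', j)" "i \<le> length p"
  shows "level p' i k > 0 \<longleftrightarrow>
    level p i k > 0 \<or> (x \<le> i \<and> (k = 0 \<or> level p (x - 1) (k - 1) > 0))"
  using assms
proof (induction p arbitrary: p' j i)
  case (Cons b p)
  have il: "interlaces (top_level p) b" and gt: "gt_pattern p" using Cons.prems by auto
  have bmono: "b k \<le> b l" if "l \<le> k" for k l using interlaces_antimono[OF il] that by (simp add: antimono_def)
  show ?case
  proof (cases "x = Suc (length p)")
    case True
    note new = insert_letter_new[OF Cons.prems(1) Cons.prems(3)[unfolded True]]
    show ?thesis
    proof (cases "i = Suc (length p)")
      case False
      then show ?thesis using new True Cons.prems(4) by (simp add: level_Cons)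
    next
      case i: True
      have lx: "level (b # p) (x - 1) = top_level p" using True by (simp add: level_Cons level_length)
      \<comment> \<open>An empty column \<open>k\<close> has room iff \<open>k = 0\<close> or column
        \<open>k - 1\<close> is nonempty one level below. Room further to the right would make
        column \<open>k\<close> nonempty, since \<open>b\<close> is antitone, so such a
        \<open>k\<close> is the greatest column with room.\<close>
      have "b k > 0 \<or> k = j \<longleftrightarrow> b k > 0 \<or> k = 0 \<or> top_level p (k - 1) > 0"
      proof (cases "b k > 0")
        case False
        have "k = j" if "k = 0 \<or> top_level p (k - 1) > 0"
        proof -
          have "room (top_level p) b k" using that False by (auto simp: room_def)
          then have "k \<le> j" using new(3) not_less by blast
          moreover have False if "k < j"
          proof -
            have "b j < top_level p (j - 1)" using new(2) that by (auto simp: room_def)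
            also have "\<dots> \<le> b (j - 1)" by (rule interlacesD(1)[OF il])
            also have "\<dots> \<le> b k" using that by (intro bmono) auto
            finally show False using False by simp
          qed
          ultimately show ?thesis by force
        qed
        then show ?thesis using new(2) False by (auto simp: room_def)
      qed simp
      then show ?thesis using new(1) i True lx by auto
    qed
  next
    case False
    obtain p0 l where ins: "insert_letter x p = (p0, l)" "p' = b(j := Suc (b j)) # p0" "j \<le> l"
        "room (top_level p) b j" "\<And>k. j < k \<Longrightarrow> k \<le> l \<Longrightarrow> \<not> room (top_level p) b k"
      using insert_letter_bump[OF Cons.prems(3) False] by metis
    have x: "x \<in> {1..length p}" using Cons.prems(2) False by auto
    note p0 = insert_letter_pattern[OF gt x ins(1)]
    note IH = Cons.IH[OF gt x ins(1)]
    have lx: "level (b # p) (x - 1) = level p (x - 1)" using x by (intro level_Cons) auto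
    show ?thesis
    proof (cases "i = Suc (length p)")
      case False
      then have "i \<le> length p" using Cons.prems(4) by simp
      then show ?thesis using IH[of i] lx ins(2) p0(2) by (simp add: level_Cons)
    next
      case i: True
      have il': "interlaces (top_level p0) (b(j := Suc (b j)))"
        using insert_letter_pattern(1)[OF Cons.prems(1-3)] ins(2) by simp
      have IHt: "top_level p0 k > 0 \<longleftrightarrow> top_level p k > 0 \<or> k = 0 \<or> level p (x - 1) (k - 1) > 0"
        using IH[of "length p"] x p0(2) by (simp add: level_length) (metis level_length)
      \<comment> \<open>An empty column of \<open>b\<close> becomes occupied exactly when the same
        happens one level below, so the equivalence is inherited from there.\<close>
      have "b k > 0 \<or> k = j \<longleftrightarrow> b k > 0 \<or> top_level p0 k > 0"
      proof (cases "b k > 0")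
        case bk: False
        have "top_level p0 k > 0" if "k = j"
        proof (cases "j = l")
          case True
          then show ?thesis using p0(3) that by simp
        next
          case False
          then have "j < l" using ins(3) by simp
          then have "top_level p (l - 1) \<le> b l" using ins(5)[of l] by (simp add: room_def)
          also have "\<dots> \<le> b k" using that \<open>j < l\<close> by (intro bmono) auto
          finally have "top_level p (l - 1) = 0" using bk by simp
          moreover have "top_level p0 l \<le> top_level p0 (l - 1)"
            using top_level_antimono[OF p0(1)] by (simp add: antimono_def)
          moreover have "top_level p0 (l - 1) = top_level p (l - 1)" "top_level p0 l > 0"
            using p0(3) \<open>j < l\<close> by auto
          ultimately show ?thesis by linarith
        qed
        moreover have "k = j" if "top_level p0 k > 0"
          using interlacesD(1)[OF il', of k] that bk by (auto split: if_splits)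
        ultimately show ?thesis using bk by auto
      qed simp
      moreover have "top_level p k > 0 \<Longrightarrow> b k > 0" using interlacesD(1)[OF il, of k] by simp
      ultimately show ?thesis using i ins(2) IHt x lx p0(2) level_Cons_top[of "b(j := Suc (b j))" p0] by auto
    qed
  qed
qed auto

definition increasing_below :: "nat list \<Rightarrow> nat \<Rightarrow> nat \<Rightarrow> bool" where
  "increasing_below w k i \<longleftrightarrow> (\<exists>s. increasing_subsequence w k s \<and> (\<forall>j<k. w ! s j \<le> i))"

lemma increasing_below_mono:
  assumes "increasing_below w l i" "k \<le> l" "i \<le> j"
  shows "increasing_below w k j"
proof -
  obtain s where s: "s ` {..<l} \<subseteq> {..<length w}" "strict_mono_on {..<l} s"
    "strict_mono_on {..<l} (\<lambda>j. w ! s j)" "\<forall>j<l. w ! s j \<le> i"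
    using assms(1) by (auto simp: increasing_below_def increasing_subsequence_def)
  have sub: "{..<k} \<subseteq> {..<l}" using assms(2) by auto
  show ?thesis
    unfolding increasing_below_def increasing_subsequence_def
  proof (intro exI[of _ s] conjI allI impI)
    show "s ` {..<k} \<subseteq> {..<length w}" using image_mono[OF sub, of s] s(1) by (rule order_trans)
    show "w ! s h \<le> j" if "h < k" for h using s(4) that assms by (metis order_trans order_less_le_trans)
    show "strict_mono_on {..<k} s" by (rule monotone_on_subset[OF s(2) sub])
    show "strict_mono_on {..<k} (\<lambda>j. w ! s j)" by (rule monotone_on_subset[OF s(3) sub])
  qed
qed

text \<open>An increasing subsequence either avoids the last position or ends in it, and then its
  other letters are below \<open>x\<close>. The disjunct \<open>k = 0\<close> takes care of
  \<open>x = 0\<close>, where letters below \<open>x\<close> cannot be described by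
  \<open>x - 1\<close>.\<close>

lemma increasing_below_snoc:
  "increasing_below (w @ [x]) (Suc k) i \<longleftrightarrow>
    increasing_below w (Suc k) i \<or> (x \<le> i \<and> 0 < x \<and> increasing_below w k (x - 1)) \<or> (x \<le> i \<and> k = 0)"
proof
  assume "increasing_below (w @ [x]) (Suc k) i"
  then obtain s where s: "s ` {..<Suc k} \<subseteq> {..<Suc (length w)}" "strict_mono_on {..<Suc k} s"
    "strict_mono_on {..<Suc k} (\<lambda>j. (w @ [x]) ! s j)" "\<forall>j<Suc k. (w @ [x]) ! s j \<le> i"
    by (auto simp: increasing_below_def increasing_subsequence_def)
  have lt: "s j < length w" if "j < k" for j
    using s(1) strict_mono_onD[OF s(2), of j k] that by fastforce
  show "increasing_below w (Suc k) i \<or> (x \<le> i \<and> 0 < x \<and> increasing_below w k (x - 1)) \<or> (x \<le> i \<and> k = 0)"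
  proof (cases "s k < length w")
    case True
    then have lt': "s j < length w" if "j < Suc k" for j using lt[of j] that by (cases "j = k") auto
    then have "increasing_below w (Suc k) i"
      unfolding increasing_below_def increasing_subsequence_def
      by (intro exI[of _ s]) (use s in \<open>auto simp: strict_mono_on_def nth_append\<close>)
    then show ?thesis by simp
  next
    case False
    then have sk: "s k = length w" using s(1) by fastforce
    then have xi: "x \<le> i" using s(4) by (metis lessI nth_append_length)
    have wx: "w ! s j < x" if "j < k" for j
      using strict_mono_onD[OF s(3), of j k] that sk lt[OF that] by (simp add: nth_append)
    have "increasing_below w k (x - 1)"
      unfolding increasing_below_def increasing_subsequence_def
    proof (intro exI[of _ s] conjI allI impI)
      show "strict_mono_on {..<k} (\<lambda>j. w ! s j)"
      proof (rule strict_mono_onI)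
        fix i j assume "i \<in> {..<k}" "j \<in> {..<k}" "i < j"
        then show "w ! s i < w ! s j"
          using strict_mono_onD[OF s(3), of i j] lt[of i] lt[of j] by (simp add: nth_append)
      qed
      show "strict_mono_on {..<k} s" using s(2) by (auto simp: strict_mono_on_def)
    qed (use wx lt in fastforce)+
    moreover have "0 < x" if "k \<noteq> 0" using wx[of 0] that by simp
    ultimately show ?thesis using xi by blast
  qed
next
  assume "increasing_below w (Suc k) i \<or> (x \<le> i \<and> 0 < x \<and> increasing_below w k (x - 1)) \<or> (x \<le> i \<and> k = 0)"
  then consider "increasing_below w (Suc k) i" | "x \<le> i" "0 < x" "increasing_below w k (x - 1)" | "x \<le> i" "k = 0"
    by blast
  then show "increasing_below (w @ [x]) (Suc k) i"
  proof cases
    case 1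
    then obtain s where s: "s ` {..<Suc k} \<subseteq> {..<length w}" "strict_mono_on {..<Suc k} s"
    "strict_mono_on {..<Suc k} (\<lambda>j. w ! s j)" "\<forall>j<Suc k. w ! s j \<le> i"
    by (auto simp: increasing_below_def increasing_subsequence_def)
    have "s j < length w" if "j < Suc k" for j using s(1) that by auto
    then show ?thesis
      unfolding increasing_below_def increasing_subsequence_def
      by (intro exI[of _ s]) (use s in \<open>auto simp: strict_mono_on_def nth_append less_Suc_eq\<close>)
  next
    case 2
    then obtain s where s: "s ` {..<k} \<subseteq> {..<length w}" "strict_mono_on {..<k} s"
    "strict_mono_on {..<k} (\<lambda>j. w ! s j)" "\<forall>j<k. w ! s j \<le> x - 1"
    by (auto simp: increasing_below_def increasing_subsequence_def)
    have lt: "s j < length w" if "j < k" for j using s(1) that by auto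
    have le: "w ! s j < x" if "j < k" for j using s(4) that \<open>0 < x\<close> by fastforce
    show ?thesis
      unfolding increasing_below_def increasing_subsequence_def
    proof (intro exI[of _ "s(k := length w)"] conjI allI impI)
      show "strict_mono_on {..<Suc k} (s(k := length w))"
        using s(2) lt by (auto simp: strict_mono_on_def less_Suc_eq)
      show "strict_mono_on {..<Suc k} (\<lambda>j. (w @ [x]) ! (s(k := length w)) j)"
        using s(3) lt le by (auto simp: strict_mono_on_def nth_append less_Suc_eq)
      show "(w @ [x]) ! (s(k := length w)) j \<le> i" if "j < Suc k" for j
        using that lt le[of j] \<open>x \<le> i\<close> by (auto simp: nth_append less_Suc_eq)
    qed (use lt in \<open>force simp: less_Suc_eq\<close>)
  next
    case 3
    then show ?thesis
      unfolding increasing_below_def increasing_subsequence_def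
      by (intro exI[of _ "\<lambda>_. length w"]) (auto simp: strict_mono_on_def)
  qed
qed

text \<open>Schensted's theorem for all levels at once: both sides obey the same recursion when a
  letter is appended. That recursion passes from level \<open>i\<close> to level
  \<open>x - 1\<close>, so the top level alone would not carry the induction.\<close>

lemma level_insert_word_positive:
  assumes "set w \<subseteq> {1..n}" "i \<le> n"
  shows "level (insert_word n w) i k > 0 \<longleftrightarrow> increasing_below w (Suc k) i"
  using assms
proof (induction w arbitrary: i k rule: rev_induct)
  case Nil
  then show ?case by (auto simp: level_replicate increasing_below_def increasing_subsequence_def)
next
  case (snoc x w)
  define p where "p = insert_word n w"
  obtain p' j where ins: "insert_letter x p = (p', j)" by fastforce
  have p: "gt_pattern p" "x \<in> {1..length p}" "i \<le> length p"
    using snoc.prems gt_pattern_insert_word[of w n] by (auto simp: p_def)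
  have p': "insert_word n (w @ [x]) = p'" by (simp add: insert_word_snoc p_def[symmetric] ins)
  have x: "0 < x" "x - 1 \<le> n" using snoc.prems by auto
  have "level p (x - 1) (k - 1) > 0 \<longleftrightarrow> increasing_below w k (x - 1)" if "k \<noteq> 0"
    using snoc.IH[of "x - 1" "k - 1"] snoc.prems(1) x that by (simp add: p_def)
  then show ?case
    using level_insert_letter_positive[OF p(1,2) ins p(3), of k] snoc.IH[of i k] snoc.prems x
    by (auto simp: p' increasing_below_snoc p_def)
qed

text \<open>These are the insertion tableaux of the words to be counted. Levels are antitone, so
  \<open>b d = 0\<close> leaves at most \<open>d\<close> columns, and the cumulative sizes
  \<open>r * i\<close> say that every letter occurs \<open>r\<close> times.\<close>

fun bounded_pattern :: "nat \<Rightarrow> nat \<Rightarrow> (nat \<Rightarrow> nat) list \<Rightarrow> bool" where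
  "bounded_pattern d r [] \<longleftrightarrow> True"
| "bounded_pattern d r (b # p) \<longleftrightarrow> bounded_pattern d r p \<and> interlaces (top_level p) b \<and> b d = 0 \<and>
     (\<Sum>j<d. b j) = r * Suc (length p)"

lemma bounded_pattern_gt: "bounded_pattern d r p \<Longrightarrow> gt_pattern p"
  by (induction p) auto

lemma bounded_pattern_iff:
  "bounded_pattern d r p \<longleftrightarrow> gt_pattern p \<and> top_level p d = 0 \<and>
    (\<forall>i\<in>{1..length p}. (\<Sum>j<d. level p i j) = r * i)"
proof (induction p)
  case (Cons b p)
  have "(\<forall>i\<in>{1..length (b # p)}. (\<Sum>j<d. level (b # p) i j) = r * i) \<longleftrightarrow>
    (\<forall>i\<in>{1..length p}. (\<Sum>j<d. level p i j) = r * i) \<and> (\<Sum>j<d. b j) = r * Suc (length p)"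
    by (auto simp: level_Cons atLeastAtMostSuc_conv)
  moreover have "top_level p d = 0" if "interlaces (top_level p) b" "b d = 0"
    using interlacesD(1)[OF that(1), of d] that by simp
  ultimately show ?case using Cons.IH by auto
qed simp

lemma length_filter_le_Suc:
  "length (filter (\<lambda>x. x \<le> Suc i) w) = length (filter (\<lambda>x. x \<le> i) w) + count_list w (Suc i)"
  by (induction w) auto

lemma uniform_words_iff:
  "w \<in> uniform_words r n \<longleftrightarrow> length w = r * n \<and> set w \<subseteq> {1..n} \<and>
    (\<forall>i\<in>{1..n}. length (filter (\<lambda>x. x \<le> i) w) = r * i)"
proof -
  have "(\<forall>i\<in>{1..n}. count_list w i = r) \<longleftrightarrow> (\<forall>i\<in>{1..n}. length (filter (\<lambda>x. x \<le> i) w) = r * i)"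
    if "set w \<subseteq> {1..n}"
  proof
    assume *: "\<forall>i\<in>{1..n}. count_list w i = r"
    have "i \<le> n \<Longrightarrow> length (filter (\<lambda>x. x \<le> i) w) = r * i" for i
    proof (induction i)
      case 0
      then show ?case using that by (force simp: filter_empty_conv)
    qed (use * in \<open>auto simp: length_filter_le_Suc\<close>)
    then show "\<forall>i\<in>{1..n}. length (filter (\<lambda>x. x \<le> i) w) = r * i" by auto
  next
    assume *: "\<forall>i\<in>{1..n}. length (filter (\<lambda>x. x \<le> i) w) = r * i"
    have 0: "length (filter (\<lambda>x. x \<le> 0) w) = 0" using that by (force simp: filter_empty_conv)
    show "\<forall>i\<in>{1..n}. count_list w i = r"
    proof
      fix i assume i: "i \<in> {1..n}"
      then obtain k where k: "i = Suc k" by (cases i) auto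
      have "length (filter (\<lambda>x. x \<le> k) w) = r * k" using * 0 i k by (cases "k = 0") auto
      then show "count_list w i = r" using length_filter_le_Suc[of k w] * i k by simp
    qed
  qed
  then show ?thesis by (auto simp: uniform_words_def)
qed

lemma avoiding_iff_bounded_pattern:
  assumes "length w = r * n" "set w \<subseteq> {1..n}"
  shows "w \<in> uniform_words r n \<and> (\<nexists>s. increasing_subsequence w (Suc d) s) \<longleftrightarrow>
    bounded_pattern d r (insert_word n w)"
proof -
  let ?p = "insert_word n w"
  have gt: "gt_pattern ?p" using assms gt_pattern_insert_word by blast
  have le_n: "w ! s j \<le> n" if "increasing_subsequence w (Suc d) s" "j < Suc d" for s j
    using assms(2) that by (force simp: increasing_subsequence_def dest!: nth_mem)
  have "(\<exists>s. increasing_subsequence w (Suc d) s) \<longleftrightarrow> increasing_below w (Suc d) n"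
    using le_n by (auto simp: increasing_below_def)
  then have inc: "(\<nexists>s. increasing_subsequence w (Suc d) s) \<longleftrightarrow> top_level ?p d = 0"
    using level_insert_word_positive[OF assms(2) order_refl, of d] level_length[of ?p]
    by (simp flip: neq0_conv) blast
  have "length (filter (\<lambda>x. x \<le> i) w) = (\<Sum>j<d. level ?p i j)" if "top_level ?p d = 0" "i \<in> {1..n}" for i
  proof -
    have "level ?p i j = 0" if "j \<ge> d" for j
    proof (rule ccontr)
      assume "level ?p i j \<noteq> 0"
      then have "increasing_below w (Suc j) i"
        using level_insert_word_positive[OF assms(2), of i j] \<open>i \<in> {1..n}\<close> by simp
      then have "increasing_below w (Suc d) n"
        by (rule increasing_below_mono) (use that \<open>i \<in> {1..n}\<close> in auto)
      then show False
        using level_insert_word_positive[OF assms(2) order_refl, of d] level_length[of ?p] \<open>top_level ?p d = 0\<close> by simp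
    qed
    \<comment> \<open>No order between \<open>n\<close> and \<open>d\<close> is assumed, so the two
      cutoffs are compared through \<open>n + d\<close>.\<close>
    then have "(\<Sum>j<n+d. level ?p i j) = (\<Sum>j<d. level ?p i j)"
      by (intro sum.mono_neutral_right) auto
    then show ?thesis using sum_level_insert_word[OF assms(2), of i "n+d"] that(2) by simp
  qed
  then show ?thesis
    unfolding bounded_pattern_iff uniform_words_iff inc using assms gt by auto
qed

lemma bounded_pattern_finite: "finite {p. bounded_pattern d r p \<and> length p = n}"
proof (induction n)
  case (Suc n)
  let ?B = "{b. \<forall>j. (j \<in> {..<d} \<longrightarrow> b j \<in> {..r * Suc n}) \<and> (j \<notin> {..<d} \<longrightarrow> b j = 0)}"
  have "{p. bounded_pattern d r p \<and> length p = Suc n} \<subseteq>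
    (\<lambda>(b, p). b # p) ` (?B \<times> {p. bounded_pattern d r p \<and> length p = n})"
  proof
    fix q assume "q \<in> {p. bounded_pattern d r p \<and> length p = Suc n}"
    then obtain b p where q: "q = b # p" "bounded_pattern d r q" "length p = n" by (cases q) auto
    have "b j = 0" if "d \<le> j" for j
      using interlaces_antimono[of "top_level p" b] q that
        antimonoD[OF interlaces_antimono[of "top_level p" b], of d j] by simp
    moreover have "b j \<le> r * Suc n" if "j < d" for j
      using q member_le_sum[of j "{..<d}" b] that by auto
    ultimately show "q \<in> (\<lambda>(b, p). b # p) ` (?B \<times> {p. bounded_pattern d r p \<and> length p = n})"
      using q by auto
  qed
  moreover have "finite ?B"
    by (rule finite_set_of_finite_funs) auto
  then have "finite ((\<lambda>(b, p). b # p) ` (?B \<times> {p. bounded_pattern d r p \<and> length p = n}))"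
    using Suc by (intro finite_imageI finite_cartesian_product)
  ultimately show ?case by (rule finite_subset)
qed (auto simp: rev_finite_subset[of "{[]}"])

text \<open>The words are sorted by insertion pattern; avoidance and letter counts are properties of
  the pattern, and each fibre is counted by walks to its shape.\<close>

theorem avoiding_count_eq_sum_walks:
  "avoiding_count (Suc d) r n =
    (\<Sum>p | bounded_pattern d r p \<and> length p = n. walks (r * n) (top_level p))"
proof -
  let ?P = "{p. bounded_pattern d r p \<and> length p = n}"
  let ?W = "\<lambda>p. {w. length w = r * n \<and> set w \<subseteq> {1..n} \<and> insert_word n w = p}"
  have "{w \<in> uniform_words r n. \<nexists>i. increasing_subsequence w (Suc d) i} = (\<Union>p\<in>?P. ?W p)"
  proof (rule Set.set_eqI)
    fix w
    show "w \<in> {w \<in> uniform_words r n. \<nexists>i. increasing_subsequence w (Suc d) i} \<longleftrightarrow> w \<in> (\<Union>p\<in>?P. ?W p)"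
    proof (cases "length w = r * n \<and> set w \<subseteq> {1..n}")
      case True
      then show ?thesis using avoiding_iff_bounded_pattern[of w r n d] by simp
    next
      case False
      then show ?thesis by (auto simp: uniform_words_def)
    qed
  qed
  then have "avoiding_count (Suc d) r n = card (\<Union>p\<in>?P. ?W p)"
    unfolding avoiding_count_def by simp
  also have "\<dots> = (\<Sum>p\<in>?P. card (?W p))"
    by (intro card_UN_disjoint ballI finite_words bounded_pattern_finite) auto
  also have "\<dots> = (\<Sum>p\<in>?P. walks (r * n) (top_level p))"
    using card_insert_word_fibre bounded_pattern_gt by (intro sum.cong) auto
  finally show ?thesis .
qed

section \<open>Signed lattice walks\<close>

text \<open>The vector usually called delta. Adding it makes antitone vectors strictly decreasing,
  so that the walls of the chamber become the places where two coordinates coincide.\<close>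

definition staircase :: "nat \<Rightarrow> nat \<Rightarrow> int" where
  "staircase d j = int d - 1 - int j"

text \<open>The coefficient function of the Vandermonde alternant: the signed starting points of the
  reflected walks.\<close>

definition alternating_delta :: "nat \<Rightarrow> (nat \<Rightarrow> int) \<Rightarrow> int" where
  "alternating_delta d l =
    (\<Sum>\<sigma> | \<sigma> permutes {..<d}. if \<forall>j<d. l j = staircase d (\<sigma> j) then sign \<sigma> else 0)"

definition compositions :: "nat \<Rightarrow> nat \<Rightarrow> (nat \<Rightarrow> nat) set" where
  "compositions d r = {\<alpha>. (\<forall>j. j \<notin> {..<d} \<longrightarrow> \<alpha> j = 0) \<and> (\<Sum>j<d. \<alpha> j) = r}"

text \<open>On coefficient functions, \<open>up\<close> is multiplication by the first power sum and
  \<open>down\<close> is multiplication by the complete symmetric function of degree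
  \<open>r\<close> in the inverse variables.\<close>

definition up :: "nat \<Rightarrow> ((nat \<Rightarrow> int) \<Rightarrow> int) \<Rightarrow> (nat \<Rightarrow> int) \<Rightarrow> int" where
  "up d \<Phi> l = (\<Sum>j<d. \<Phi> (l(j := l j - 1)))"

definition down :: "nat \<Rightarrow> nat \<Rightarrow> ((nat \<Rightarrow> int) \<Rightarrow> int) \<Rightarrow> (nat \<Rightarrow> int) \<Rightarrow> int" where
  "down d r \<Phi> l = (\<Sum>\<alpha>\<in>compositions d r. \<Phi> (\<lambda>j. l j + int (\<alpha> j)))"

definition alternating :: "nat \<Rightarrow> ((nat \<Rightarrow> int) \<Rightarrow> int) \<Rightarrow> bool" where
  "alternating d \<Phi> \<longleftrightarrow> (\<forall>\<sigma> l. \<sigma> permutes {..<d} \<longrightarrow> \<Phi> (l \<circ> \<sigma>) = sign \<sigma> * \<Phi> l)"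

definition shifted :: "nat \<Rightarrow> (nat \<Rightarrow> nat) \<Rightarrow> nat \<Rightarrow> int" where
  "shifted d b j = int (b j) + staircase d j"

lemma finite_compositions: "finite (compositions d r)"
proof -
  have "compositions d r \<subseteq> {\<alpha>. \<forall>j. (j \<in> {..<d} \<longrightarrow> \<alpha> j \<in> {..r}) \<and> (j \<notin> {..<d} \<longrightarrow> \<alpha> j = 0)}"
    by (auto simp: compositions_def intro: member_le_sum)
  moreover have "finite \<dots>" by (rule finite_set_of_finite_funs) auto
  ultimately show ?thesis by (rule finite_subset)
qed

lemma card_compositions: "card (compositions d r) = (r + d - 1) choose r"
proof -
  have "bij_betw (\<lambda>\<alpha>. map \<alpha> [0..<d]) (compositions d r) {l. length l = d \<and> sum_list l = r}"
  proof (rule bij_betw_byWitness[of _ "\<lambda>l j. if j < d then l ! j else 0"])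
    show "\<forall>l\<in>{l. length l = d \<and> sum_list l = r}. map (\<lambda>j. if j < d then l ! j else 0) [0..<d] = l"
      by (auto intro!: nth_equalityI)
    show "(\<lambda>\<alpha>. map \<alpha> [0..<d]) ` compositions d r \<subseteq> {l. length l = d \<and> sum_list l = r}"
      by (auto simp: compositions_def interv_sum_list_conv_sum_set_nat lessThan_atLeast0)
    show "(\<lambda>l j. if j < d then l ! j else 0) ` {l. length l = d \<and> sum_list l = r} \<subseteq> compositions d r"
      by (auto simp: compositions_def sum_list_sum_nth lessThan_atLeast0)
  qed (auto simp: compositions_def fun_eq_iff)
  from bij_betw_same_card[OF this] show ?thesis by (simp add: card_length_sum_list)
qed

lemma permutes_less_iff: "\<sigma> permutes {..<d} \<Longrightarrow> \<sigma> j < d \<longleftrightarrow> j < (d::nat)"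
  using permutes_in_image[of \<sigma> "{..<d}" j] by simp

lemma alternating_alternating_delta: "alternating d (alternating_delta d)"
  unfolding alternating_def
proof (intro allI impI)
  fix \<tau> l assume \<tau>: "\<tau> permutes {..<d}"
  let ?P = "\<lambda>l \<sigma>. \<forall>j<d. l j = staircase d (\<sigma> j)"
  have eq: "?P (l \<circ> \<tau>) (\<sigma> \<circ> \<tau>) \<longleftrightarrow> ?P l \<sigma>" for \<sigma>
  proof -
    have "?P (l \<circ> \<tau>) (\<sigma> \<circ> \<tau>) \<longleftrightarrow> (\<forall>j\<in>\<tau> ` {..<d}. l j = staircase d (\<sigma> j))" by auto
    then show ?thesis unfolding permutes_image[OF \<tau>] by auto
  qed
  have "alternating_delta d (l \<circ> \<tau>) =
    (\<Sum>\<sigma> | \<sigma> permutes {..<d}. if ?P (l \<circ> \<tau>) (\<sigma> \<circ> \<tau>) then sign (\<sigma> \<circ> \<tau>) else 0)"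
    unfolding alternating_delta_def by (rule sum_permutations_compose_right[OF \<tau>])
  also have "\<dots> = (\<Sum>\<sigma> | \<sigma> permutes {..<d}. sign \<tau> * (if ?P l \<sigma> then sign \<sigma> else 0))"
    unfolding eq
    using \<tau> by (intro sum.cong refl) (auto simp: sign_compose permutes_imp_permutation[of "{..<d}"])
  finally show "alternating_delta d (l \<circ> \<tau>) = sign \<tau> * alternating_delta d l"
    unfolding alternating_delta_def by (simp add: sum_distrib_left)
qed

lemma alternating_up: assumes "alternating d \<Phi>" shows "alternating d (up d \<Phi>)"
  unfolding alternating_def
proof (intro allI impI)
  fix \<tau> and l :: "nat \<Rightarrow> int" assume \<tau>: "\<tau> permutes {..<d}"
  have "(l \<circ> \<tau>)(j := (l \<circ> \<tau>) j - 1) = l(\<tau> j := l (\<tau> j) - 1) \<circ> \<tau>" for j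
    using permutes_inj[OF \<tau>] by (auto simp: fun_eq_iff inj_eq)
  then have "up d \<Phi> (l \<circ> \<tau>) = sign \<tau> * (\<Sum>j<d. \<Phi> (l(\<tau> j := l (\<tau> j) - 1)))"
    using assms \<tau> by (simp add: up_def alternating_def sum_distrib_left)
  also have "(\<Sum>j<d. \<Phi> (l(\<tau> j := l (\<tau> j) - 1))) = up d \<Phi> l"
    unfolding up_def by (rule sum.permute[OF \<tau>, symmetric, unfolded comp_def])
  finally show "up d \<Phi> (l \<circ> \<tau>) = sign \<tau> * up d \<Phi> l" .
qed

lemma compositions_permute:
  assumes "\<tau> permutes {..<d}" "\<alpha> \<in> compositions d r" shows "\<alpha> \<circ> \<tau> \<in> compositions d r"
  using assms permutes_less_iff[OF assms(1)] sum.permute[OF assms(1), of \<alpha>]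
  by (auto simp: compositions_def comp_def)

lemma alternating_down: assumes "alternating d \<Phi>" shows "alternating d (down d r \<Phi>)"
  unfolding alternating_def
proof (intro allI impI)
  fix \<tau> l assume \<tau>: "\<tau> permutes {..<d}"
  have "down d r \<Phi> (l \<circ> \<tau>) = (\<Sum>\<alpha>\<in>compositions d r. \<Phi> ((\<lambda>j. l j + int (\<alpha> j)) \<circ> \<tau>))"
    unfolding down_def
    by (rule sum.reindex_bij_witness[where i = "\<lambda>\<alpha>. \<alpha> \<circ> \<tau>" and j = "\<lambda>\<alpha>. \<alpha> \<circ> inv_into UNIV \<tau>"])
      (use \<tau> in \<open>auto intro!: compositions_permute permutes_inv simp: comp_assoc permutes_inv_o,
        simp add: comp_def permutes_inverses\<close>)
  then show "down d r \<Phi> (l \<circ> \<tau>) = sign \<tau> * down d r \<Phi> l"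
    using assms \<tau> by (simp add: alternating_def sum_distrib_left down_def)
qed

section \<open>Reflection principle and Pieri rule\<close>

lemma alternating_swap:
  assumes "alternating d \<Phi>" "i < d" "j < d" "i \<noteq> j"
  shows "\<Phi> (l \<circ> Transposition.transpose i j) = - \<Phi> l"
  using assms by (simp add: alternating_def permutes_swap_id sign_swap_id)

lemma alternating_eq_0:
  assumes "alternating d \<Phi>" "i < d" "j < d" "i \<noteq> j" "l i = l j"
  shows "\<Phi> l = 0"
proof -
  have "l \<circ> Transposition.transpose i j = l" using assms(5) by (auto simp: fun_eq_iff Transposition.transpose_def)
  then show ?thesis using alternating_swap[OF assms(1-4), of l] by simp
qed

text \<open>The starting points are nonnegative and steps only raise coordinates. This disposes of
  the removal of a cell from an empty last column, where no neighbour is available for a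
  cancellation.\<close>

lemma up_power_negative:
  assumes "j < d" "l j < 0" shows "(up d ^^ m) (alternating_delta d) l = 0"
  using assms(2)
proof (induction m arbitrary: l)
  case 0
  have "\<not> (\<forall>j<d. l j = staircase d (\<sigma> j))" if "\<sigma> permutes {..<d}" for \<sigma>
    using permutes_less_iff[OF that, of j] assms(1) 0 by (force simp: staircase_def)
  then show ?case by (auto simp: alternating_delta_def intro!: sum.neutral)
next
  case (Suc m)
  have "(up d ^^ m) (alternating_delta d) (l(k := l k - 1)) = 0" for k
    by (rule Suc.IH) (use Suc.prems in auto)
  then show ?case by (simp add: up_def[of _ "(up d ^^ m) _"])
qed

lemma alternating_up_power: "alternating d ((up d ^^ m) (alternating_delta d))"
  by (induction m) (auto intro: alternating_alternating_delta alternating_up)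

lemma alternating_down_power: "alternating d \<Phi> \<Longrightarrow> alternating d ((down d r ^^ m) \<Phi>)"
  by (induction m) (auto intro: alternating_down)

lemma antimono_zeroD: "antimono b \<Longrightarrow> b d = 0 \<Longrightarrow> d \<le> j \<Longrightarrow> b j = (0::nat)"
  by (metis antimonoD le_zero_eq)

text \<open>The reflection principle. Undoing a step outside the chamber leads to a vector with two
  equal coordinates, where an alternating function vanishes, or to a negative last coordinate. Only
  the terms of the recursion of \<open>walks\<close> survive.\<close>

lemma up_power_eq_walks:
  assumes "antimono b" "b d = 0"
  shows "(up d ^^ m) (alternating_delta d) (shifted d b) = int (walks m b)"
  using assms
proof (induction m arbitrary: b)
  case 0
  \<comment> \<open>The equations read \<open>b j = j - \<sigma> j\<close>, hence
    \<open>\<sigma> j <= j\<close> for all \<open>j\<close>, and only the identity does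
    this.\<close>
  have id: "\<sigma> = id" if "\<sigma> permutes {..<d}" "\<forall>j<d. shifted d b j = staircase d (\<sigma> j)" for \<sigma>
    by (rule permutes_natset_le[OF that(1)]) (use that in \<open>force simp: shifted_def staircase_def\<close>)
  have "b = (\<lambda>_. 0) \<longleftrightarrow> (\<forall>j<d. b j = 0)"
    using antimono_zeroD[OF 0] by (metis not_less)
  then have b: "(\<forall>j<d. shifted d b j = staircase d j) \<longleftrightarrow> b = (\<lambda>_. 0)"
    by (auto simp: shifted_def)
  have "alternating_delta d (shifted d b) =
    (\<Sum>\<sigma>\<in>{id}. if \<forall>j<d. shifted d b j = staircase d (\<sigma> j) then sign \<sigma> else 0)"
    unfolding alternating_delta_def
    by (rule sum.mono_neutral_right) (use id in \<open>auto simp: finite_permutations permutes_id\<close>)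
  also have "\<dots> = (if b = (\<lambda>_. 0) then 1 else 0)" using b by simp
  finally show ?case by simp
next
  case (Suc m)
  let ?\<Phi> = "(up d ^^ m) (alternating_delta d)"
  let ?l = "shifted d b"
  let ?J = "{j. b (Suc j) < b j}"
  have J: "?J \<subseteq> {..<d}"
    using antimono_zeroD[OF Suc.prems] by (auto simp: not_less[symmetric]) (metis not_less less_nat_zero_code)
  have "(up d ^^ Suc m) (alternating_delta d) ?l = (\<Sum>j<d. ?\<Phi> (?l(j := ?l j - 1)))"
    by (simp add: up_def)
  also have "\<dots> = (\<Sum>j\<in>?J. ?\<Phi> (?l(j := ?l j - 1)))"
  proof (rule sum.mono_neutral_right)
    show "\<forall>j\<in>{..<d} - ?J. ?\<Phi> (?l(j := ?l j - 1)) = 0"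
    proof
      fix j assume j: "j \<in> {..<d} - ?J"
      then have bj: "b (Suc j) = b j" using antimonoD[OF Suc.prems(1), of j "Suc j"] by auto
      show "?\<Phi> (?l(j := ?l j - 1)) = 0"
      proof (cases "Suc j < d")
        case True
        show ?thesis
          by (rule alternating_eq_0[OF alternating_up_power, of j d "Suc j"])
            (use True bj in \<open>auto simp: shifted_def staircase_def\<close>)
      next
        case False
        then have "Suc j = d" using j by auto
        then show ?thesis using bj Suc.prems
          by (intro up_power_negative[of j]) (auto simp: shifted_def staircase_def)
      qed
    qed
  qed (use J in auto)
  also have "\<dots> = (\<Sum>j\<in>?J. int (walks m (b(j := b j - 1))))"
  proof (intro sum.cong refl)
    fix j assume j: "j \<in> ?J"
    have "?l(j := ?l j - 1) = shifted d (b(j := b j - 1))"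
      using j by (auto simp: shifted_def fun_eq_iff)
    moreover have "antimono (b(j := b j - 1))"
    proof (intro decseq_SucI)
      fix k show "(b(j := b j - 1)) (Suc k) \<le> (b(j := b j - 1)) k"
        using j antimonoD[OF Suc.prems(1), of k "Suc k"] by auto
    qed
    moreover have "(b(j := b j - 1)) d = 0" using Suc.prems(2) by auto
    ultimately show "?\<Phi> (?l(j := ?l j - 1)) = int (walks m (b(j := b j - 1)))"
      using Suc.IH[of "b(j := b j - 1)"] by metis
  qed
  finally show ?case by simp
qed

text \<open>A Pieri rule. The terms violating the interlacing condition cancel: if \<open>i\<close> is the last
  violated position, exchanging the entries \<open>i\<close> and \<open>i + 1\<close> of the shifted vector keeps \<open>i\<close>
  the last violated position and reverses the sign.\<close>

lemma down_eq_sum_interlacing: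
  assumes \<Phi>: "alternating d \<Phi>" and a: "antimono a" "a d = 0"
  shows "down d r \<Phi> (shifted d a) =
    (\<Sum>b | interlaces a b \<and> b d = 0 \<and> (\<Sum>j<d. b j) = (\<Sum>j<d. a j) + r. \<Phi> (shifted d b))"
proof -
  define bad where "bad \<alpha> i \<longleftrightarrow> Suc i < d \<and> a i < a (Suc i) + \<alpha> (Suc i)" for \<alpha> i
  define g where "g \<alpha> = (GREATEST i. bad \<alpha> i)" for \<alpha>
  define T where "T \<alpha> = \<alpha>(g \<alpha> := \<alpha> (Suc (g \<alpha>)) + a (Suc (g \<alpha>)) - a (g \<alpha>) - 1,
     Suc (g \<alpha>) := \<alpha> (g \<alpha>) + a (g \<alpha>) + 1 - a (Suc (g \<alpha>)))" for \<alpha>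
  let ?B = "{\<alpha> \<in> compositions d r. \<exists>i. bad \<alpha> i}"
  let ?f = "\<lambda>\<alpha>. \<Phi> (\<lambda>j. shifted d a j + int (\<alpha> j))"
  have g: "bad \<alpha> (g \<alpha>)" "\<And>i. bad \<alpha> i \<Longrightarrow> i \<le> g \<alpha>" if "\<exists>i. bad \<alpha> i" for \<alpha>
  proof -
    have bd: "\<forall>y. bad \<alpha> y \<longrightarrow> y \<le> d" by (auto simp: bad_def)
    show "bad \<alpha> (g \<alpha>)" using GreatestI_ex_nat[OF that] bd unfolding g_def by blast
    show "i \<le> g \<alpha>" if "bad \<alpha> i" for i using Greatest_le_nat[of "bad \<alpha>", OF that] bd unfolding g_def by blast
  qed
  have mono: "a (Suc i) \<le> a i" for i using antimonoD[OF a(1), of i "Suc i"] by simp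
  have T: "T \<alpha> \<in> ?B \<and> T (T \<alpha>) = \<alpha> \<and> ?f (T \<alpha>) = - ?f \<alpha>" if \<alpha>: "\<alpha> \<in> ?B" for \<alpha>
  proof -
    define i where "i = g \<alpha>"
    have i: "bad \<alpha> i" "\<And>k. bad \<alpha> k \<Longrightarrow> k \<le> i" using g \<alpha> unfolding i_def by auto
    then have id: "Suc i < d" "a i < a (Suc i) + \<alpha> (Suc i)" by (auto simp: bad_def)
    \<comment> \<open>The parts after exchanging the two shifted entries. The 1 is the difference of
      neighbouring staircase entries; the violation at \<open>i\<close> keeps the natural
      subtraction in \<open>u\<close> from truncating, and antitonicity of \<open>a\<close> does so
      in \<open>v\<close>.\<close>
    define u where "u = \<alpha> (Suc i) + a (Suc i) - a i - 1"
    define v where "v = \<alpha> i + a i + 1 - a (Suc i)"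
    have u: "u + a i + 1 = \<alpha> (Suc i) + a (Suc i)" using id u_def by simp
    have v: "v + a (Suc i) = \<alpha> i + a i + 1" using mono[of i] v_def by simp
    have T: "T \<alpha> = \<alpha>(i := u, Suc i := v)" by (simp add: T_def i_def u_def v_def)
    have badT: "bad (T \<alpha>) i" using v id by (simp add: bad_def T)
    have "k \<le> i" if "bad (T \<alpha>) k" for k
      using i(2)[of k] that by (auto simp: bad_def T split: if_splits)
    then have gT: "g (T \<alpha>) = i" unfolding g_def using badT by (intro Greatest_equality)
    have "T (T \<alpha>) = (T \<alpha>)(i := v + a (Suc i) - a i - 1, Suc i := u + a i + 1 - a (Suc i))"
      unfolding T_def[of "T \<alpha>"] gT by (simp add: T)
    also have "\<dots> = \<alpha>" unfolding u v by (auto simp: T)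
    finally have TT: "T (T \<alpha>) = \<alpha>" .
    have split: "(\<Sum>j<d. f j) = f i + (f (Suc i) + (\<Sum>j\<in>{..<d} - {i} - {Suc i}. f j))" for f :: "nat \<Rightarrow> nat"
      using id by (simp add: sum.remove[of "{..<d}" i] sum.remove[of "{..<d} - {i}" "Suc i"])
    have "(\<Sum>j\<in>{..<d} - {i} - {Suc i}. T \<alpha> j) = (\<Sum>j\<in>{..<d} - {i} - {Suc i}. \<alpha> j)"
      by (intro sum.cong) (auto simp: T)
    then have "(\<Sum>j<d. T \<alpha> j) = (\<Sum>j<d. \<alpha> j)"
      unfolding split using u v by (simp add: T)
    then have "T \<alpha> \<in> compositions d r" using \<alpha> id by (auto simp: compositions_def T)
    moreover have "?f (T \<alpha>) = \<Phi> ((\<lambda>j. shifted d a j + int (\<alpha> j)) \<circ> Transposition.transpose i (Suc i))"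
      by (rule arg_cong[of _ _ \<Phi>]) (use u v in \<open>auto simp: fun_eq_iff T Transposition.transpose_def shifted_def staircase_def\<close>)
    then have "?f (T \<alpha>) = - ?f \<alpha>" using alternating_swap[OF \<Phi>, of i "Suc i"] id by simp
    ultimately show ?thesis using badT TT by blast
  qed
  have "sum ?f ?B = (\<Sum>\<alpha>\<in>?B. - ?f \<alpha>)"
    by (rule sum.reindex_bij_witness[of _ T T]) (use T in force)+
  then have B0: "sum ?f ?B = 0" by (simp add: sum_negf)
  have "down d r \<Phi> (shifted d a) = sum ?f ({\<alpha> \<in> compositions d r. \<not> (\<exists>i. bad \<alpha> i)} \<union> ?B)"
    unfolding down_def by (intro sum.cong) auto
  also have "\<dots> = sum ?f {\<alpha> \<in> compositions d r. \<not> (\<exists>i. bad \<alpha> i)} + sum ?f ?B"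
    by (intro sum.union_disjoint) (auto simp: finite_compositions)
  also have "\<dots> = sum ?f {\<alpha> \<in> compositions d r. \<not> (\<exists>i. bad \<alpha> i)}" unfolding B0 by simp
  also have "\<dots> = (\<Sum>b | interlaces a b \<and> b d = 0 \<and> (\<Sum>j<d. b j) = (\<Sum>j<d. a j) + r. \<Phi> (shifted d b))"
  proof (rule sum.reindex_bij_witness[where i = "\<lambda>b j. b j - a j" and j = "\<lambda>\<alpha> j. a j + \<alpha> j"])
    fix \<alpha> assume \<alpha>: "\<alpha> \<in> {\<alpha> \<in> compositions d r. \<not> (\<exists>i. bad \<alpha> i)}"
    have "a (Suc j) + \<alpha> (Suc j) \<le> a j" for j
    proof (cases "Suc j < d")
      case False
      then show ?thesis using \<alpha> mono[of j] by (auto simp: compositions_def)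
    qed (use \<alpha> in \<open>auto simp: bad_def not_less not_le[symmetric]\<close>)
    then show "(\<lambda>j. a j + \<alpha> j) \<in> {b. interlaces a b \<and> b d = 0 \<and> (\<Sum>j<d. b j) = (\<Sum>j<d. a j) + r}"
      using \<alpha> a(2) by (auto simp: interlaces_def compositions_def sum.distrib)
    show "\<Phi> (shifted d (\<lambda>j. a j + \<alpha> j)) = ?f \<alpha>"
      by (rule arg_cong[of _ _ \<Phi>]) (auto simp: fun_eq_iff shifted_def)
  next
    fix b assume b: "b \<in> {b. interlaces a b \<and> b d = 0 \<and> (\<Sum>j<d. b j) = (\<Sum>j<d. a j) + r}"
    then have il: "a j \<le> b j" "b (Suc j) \<le> a j" for j by (auto simp: interlaces_def)
    have bz: "b j = 0" if "d \<le> j" for j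
      using antimono_zeroD[OF interlaces_antimono[of a b], of d j] b that by auto
    show "(\<lambda>j. a j + (b j - a j)) = b" using il by auto
    have "(\<Sum>j<d. b j - a j) = (\<Sum>j<d. b j) - (\<Sum>j<d. a j)"
      by (rule sum_subtractf_nat) (use il in auto)
    then show "(\<lambda>j. b j - a j) \<in> {\<alpha> \<in> compositions d r. \<not> (\<exists>i. bad \<alpha> i)}"
      using b bz il by (auto simp: compositions_def bad_def not_less)
  qed auto
  finally show ?thesis .
qed

lemma bounded_pattern_top:
  assumes "bounded_pattern d r p"
  shows "antimono (top_level p)" "top_level p d = 0" "(\<Sum>j<d. top_level p j) = r * length p"
  using assms top_level_antimono[OF bounded_pattern_gt[OF assms]] by (cases p; simp)+

text \<open>Summing over the top level alone is the Pieri rule and replaces \<open>\<Phi>\<close> by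
  \<open>down d r \<Phi>\<close> one level lower; hence the induction over arbitrary alternating
  \<open>\<Phi>\<close>. At the empty pattern the shifted shape is the staircase itself.\<close>

lemma sum_bounded_pattern:
  assumes "alternating d \<Phi>"
  shows "(\<Sum>p | bounded_pattern d r p \<and> length p = n. \<Phi> (shifted d (top_level p))) =
    (down d r ^^ n) \<Phi> (staircase d)"
  using assms
proof (induction n arbitrary: \<Phi>)
  case 0
  have "{p. bounded_pattern d r p \<and> length p = 0} = {[]}" by auto
  then show ?case by (simp add: shifted_def[abs_def] staircase_def[abs_def])
next
  case (Suc n)
  let ?P = "{p. bounded_pattern d r p \<and> length p = n}"
  let ?B = "\<lambda>p. {b. interlaces (top_level p) b \<and> b d = 0 \<and> (\<Sum>j<d. b j) = (\<Sum>j<d. top_level p j) + r}"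
  have bij: "bij_betw (\<lambda>(p, b). b # p) (SIGMA p:?P. ?B p) {p. bounded_pattern d r p \<and> length p = Suc n}"
  proof (rule bij_betw_byWitness[of _ "\<lambda>q. (tl q, hd q)"])
    show "(\<lambda>(p, b). b # p) ` (SIGMA p:?P. ?B p) \<subseteq> {p. bounded_pattern d r p \<and> length p = Suc n}"
      using bounded_pattern_top(3) by auto
    show "(\<lambda>q. (tl q, hd q)) ` {p. bounded_pattern d r p \<and> length p = Suc n} \<subseteq> (SIGMA p:?P. ?B p)"
    proof
      fix z assume "z \<in> (\<lambda>q. (tl q, hd q)) ` {p. bounded_pattern d r p \<and> length p = Suc n}"
      then obtain q where "z = (tl q, hd q)" "bounded_pattern d r q" "length q = Suc n" by auto
      then show "z \<in> (SIGMA p:?P. ?B p)"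
        using bounded_pattern_top(3)[of d r "tl q"] by (cases q) auto
    qed
  qed (auto simp: length_Suc_conv)
  have fin: "finite (?B p)" if "p \<in> ?P" for p
  proof -
    have "(\<lambda>b. b # p) ` ?B p \<subseteq> {p. bounded_pattern d r p \<and> length p = Suc n}"
      using that bounded_pattern_top(3) by auto
    then have "finite ((\<lambda>b. b # p) ` ?B p)" using bounded_pattern_finite finite_subset by blast
    then show ?thesis by (rule finite_imageD) (auto simp: inj_on_def)
  qed
  have "(\<Sum>p | bounded_pattern d r p \<and> length p = Suc n. \<Phi> (shifted d (top_level p))) =
    (\<Sum>(p, b)\<in>(SIGMA p:?P. ?B p). \<Phi> (shifted d b))"
    by (subst sum.reindex_bij_betw[OF bij, symmetric]) (simp add: case_prod_unfold)
  also have "\<dots> = (\<Sum>p\<in>?P. \<Sum>b\<in>?B p. \<Phi> (shifted d b))"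
    by (rule sum.Sigma[symmetric]) (use fin bounded_pattern_finite in auto)
  also have "\<dots> = (\<Sum>p\<in>?P. down d r \<Phi> (shifted d (top_level p)))"
    by (intro sum.cong refl down_eq_sum_interlacing[symmetric] Suc.prems) (auto simp: bounded_pattern_top)
  also have "\<dots> = (down d r ^^ n) (down d r \<Phi>) (staircase d)"
    by (rule Suc.IH[OF alternating_down[OF Suc.prems]])
  finally show ?case by (simp add: funpow_swap1)
qed

text \<open>The sum over patterns is applied to the signed walk count, which is alternating and
  agrees with \<open>walks\<close> on the shapes that occur.\<close>

theorem avoiding_count_eq_down_up:
  "int (avoiding_count (Suc d) r n) =
    (down d r ^^ n) ((up d ^^ (r * n)) (alternating_delta d)) (staircase d)"
proof -
  have "int (avoiding_count (Suc d) r n) =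
    (\<Sum>p | bounded_pattern d r p \<and> length p = n. (up d ^^ (r * n)) (alternating_delta d) (shifted d (top_level p)))"
    unfolding avoiding_count_eq_sum_walks of_nat_sum
    by (intro sum.cong refl up_power_eq_walks[symmetric]) (auto simp: bounded_pattern_top)
  also have "\<dots> = (down d r ^^ n) ((up d ^^ (r * n)) (alternating_delta d)) (staircase d)"
    by (rule sum_bounded_pattern[OF alternating_up_power])
  finally show ?thesis .
qed

text \<open>Applied at the staircase, this turns the extraction of one coefficient into the pairing
  with a second, conjugated alternant.\<close>

lemma alternating_symmetrize:
  assumes "alternating d \<Phi>"
  shows "fact d * \<Phi> l = (\<Sum>\<sigma> | \<sigma> permutes {..<d}. sign \<sigma> * \<Phi> (l \<circ> \<sigma>))"
proof -
  have "sign \<sigma> * \<Phi> (l \<circ> \<sigma>) = \<Phi> l" if "\<sigma> permutes {..<d}" for \<sigma>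
    using assms that by (simp add: alternating_def sign_def)
  then have "(\<Sum>\<sigma> | \<sigma> permutes {..<d}. sign \<sigma> * \<Phi> (l \<circ> \<sigma>)) = (\<Sum>\<sigma> | \<sigma> permutes {..<d}. \<Phi> l)"
    by (intro sum.cong) auto
  then show ?thesis by (simp add: card_permutations)
qed

section \<open>The Vandermonde determinant and Mehta's integral\<close>

definition vandermonde_prod :: "nat \<Rightarrow> (nat \<Rightarrow> 'a) \<Rightarrow> 'a :: comm_ring_1" where
  "vandermonde_prod d x = (\<Prod>j<d. \<Prod>i<j. x j - x i)"

text \<open>The matrix of values is the matrix of powers times the unitriangular matrix of
  coefficients.\<close>

lemma det_poly_matrix:
  fixes x :: "nat \<Rightarrow> 'a :: idom"
  assumes "\<And>k. k < d \<Longrightarrow> degree (P k) = k \<and> coeff (P k) k = 1"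
  shows "Determinant.det (Matrix.mat d d (\<lambda>(i, k). poly (P k) (x i))) =
    Determinant.det (Matrix.mat d d (\<lambda>(i, k). x i ^ k))"
proof -
  let ?A = "Matrix.mat d d (\<lambda>(i, k). x i ^ k)"
  let ?U = "Matrix.mat d d (\<lambda>(i, k). coeff (P k) i)"
  have "Matrix.mat d d (\<lambda>(i, k). poly (P k) (x i)) = ?A * ?U"
  proof (rule eq_matI)
    fix i k assume "i < dim_row (?A * ?U)" "k < dim_col (?A * ?U)"
    then have ik: "i < d" "k < d" by auto
    have "poly (P k) (x i) = (\<Sum>j\<le>k. coeff (P k) j * x i ^ j)"
      using assms[OF ik(2)] by (simp add: poly_altdef)
    also have "\<dots> = (\<Sum>j<d. x i ^ j * coeff (P k) j)"
      using ik assms[OF ik(2)]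
      by (intro sum.mono_neutral_cong_left) (auto simp: coeff_eq_0)
    finally show "Matrix.mat d d (\<lambda>(i, k). poly (P k) (x i)) $$ (i, k) = (?A * ?U) $$ (i, k)"
      using ik by (simp add: scalar_prod_def lessThan_atLeast0)
  qed auto
  moreover have "Determinant.det ?U = 1"
  proof -
    have "upper_triangular ?U" using assms by (auto intro!: upper_triangularI coeff_eq_0)
    then have "Determinant.det ?U = prod_list (diag_mat ?U)"
      by (rule det_upper_triangular) auto
    also have "diag_mat ?U = map (\<lambda>_. 1) [0..<d]" using assms by (auto simp: diag_mat_def)
    finally show ?thesis by (simp add: map_replicate_const)
  qed
  ultimately show ?thesis by (simp add: det_mult[of _ d])
qed

text \<open>The monic family is left open because two are needed: powers for the alternant and
  Hermite polynomials for Mehta's integral.\<close>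

theorem sum_permutations_monic:
  fixes x :: "nat \<Rightarrow> 'a :: idom"
  assumes "\<And>k. k < d \<Longrightarrow> degree (P k) = k \<and> coeff (P k) k = 1"
  shows "(\<Sum>\<sigma> | \<sigma> permutes {..<d}. of_int (sign \<sigma>) * (\<Prod>i<d. poly (P (\<sigma> i)) (x i))) = vandermonde_prod d x"
proof -
  \<comment> \<open>The Newton basis at the points \<open>x\<close>: \<open>Q k\<close> vanishes at
    \<open>x i\<close> for \<open>i < k\<close>, so the matrix of its values is triangular and its
    diagonal multiplies to the Vandermonde product.\<close>
  define Q where "Q k = (\<Prod>i<k. [:- x i, 1:])" for k
  have Q: "degree (Q k) = k \<and> coeff (Q k) k = 1" for k
  proof -
    have "degree (Q k) = k" by (simp add: Q_def degree_prod_eq_sum_degree)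
    moreover have "lead_coeff (Q k) = 1" unfolding Q_def lead_coeff_prod by simp
    ultimately show ?thesis by simp
  qed
  have "(\<Sum>\<sigma> | \<sigma> permutes {..<d}. of_int (sign \<sigma>) * (\<Prod>i<d. poly (P (\<sigma> i)) (x i))) =
    Determinant.det (Matrix.mat d d (\<lambda>(i, k). poly (P k) (x i)))"
  proof (subst det_def'[of _ d])
    have "\<sigma> i < d" if "\<sigma> permutes {0..<d}" "i < d" for \<sigma> i
      using permutes_in_image[OF that(1), of i] that(2) by simp
    then show "(\<Sum>\<sigma> | \<sigma> permutes {..<d}. of_int (sign \<sigma>) * (\<Prod>i<d. poly (P (\<sigma> i)) (x i))) =
      (\<Sum>p | p permutes {0..<d}. signof p * (\<Prod>i = 0..<d. Matrix.mat d d (\<lambda>(i, k). poly (P k) (x i)) $$ (i, p i)))"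
      unfolding lessThan_atLeast0 by (intro sum.cong refl arg_cong2[of _ _ _ _ "(*)"] prod.cong) auto
  qed simp
  also have "\<dots> = Determinant.det (Matrix.mat d d (\<lambda>(i, k). poly (Q k) (x i)))"
    using det_poly_matrix[of d P x] det_poly_matrix[of d Q x] assms Q by simp
  also have "\<dots> = prod_list (diag_mat (Matrix.mat d d (\<lambda>(i, k). poly (Q k) (x i))))"
    by (rule det_lower_triangular[of d]) (auto simp: Q_def poly_prod)
  also have "\<dots> = vandermonde_prod d x"
    by (simp add: diag_mat_def prod.distinct_set_conv_list[symmetric] vandermonde_prod_def Q_def poly_prod
        atLeast_upt lessThan_atLeast0 cong: map_cong)
  finally show ?thesis .
qed

corollary sum_permutations_power:
  fixes x :: "nat \<Rightarrow> 'a :: idom"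
  shows "(\<Sum>\<sigma> | \<sigma> permutes {..<d}. of_int (sign \<sigma>) * (\<Prod>i<d. x i ^ \<sigma> i)) = vandermonde_prod d x"
  using sum_permutations_monic[of d "\<lambda>k. monom 1 k" x] by (simp add: degree_monom_eq poly_monom)

section \<open>Gaussian moments, Hermite polynomials and Mehta's integral\<close>

definition gauss_mean :: "real poly \<Rightarrow> real" where
  "gauss_mean p = (\<integral>x. std_normal_density x * poly p x \<partial>lborel)"

lemma integrable_gauss_poly: "integrable lborel (\<lambda>x. std_normal_density x * poly p x)"
  unfolding poly_altdef sum_distrib_left
proof (intro Bochner_Integration.integrable_sum)
  fix i
  have "integrable lborel (\<lambda>x. coeff p i * (std_normal_density x * x ^ i))"
    using integrable_std_normal_moment by (rule integrable_mult_right)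
  then show "integrable lborel (\<lambda>x. std_normal_density x * (coeff p i * x ^ i))"
    by (simp add: mult_ac)
qed

lemma gauss_mean_sum:
  assumes "degree p < N"
  shows "gauss_mean p = (\<Sum>i<N. coeff p i * gauss_mean (monom 1 i))"
proof -
  have "poly p x = (\<Sum>i<N. coeff p i * x ^ i)" for x
    unfolding poly_altdef using assms
    by (intro sum.mono_neutral_left) (auto simp: coeff_eq_0)
  then have "gauss_mean p = (\<integral>x. (\<Sum>i<N. coeff p i * (std_normal_density x * poly (monom 1 i) x)) \<partial>lborel)"
    unfolding gauss_mean_def by (simp add: sum_distrib_left mult_ac poly_monom)
  also have "\<dots> = (\<Sum>i<N. \<integral>x. coeff p i * (std_normal_density x * poly (monom 1 i) x) \<partial>lborel)"
    by (intro Bochner_Integration.integral_sum integrable_mult_right integrable_gauss_poly)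
  also have "\<dots> = (\<Sum>i<N. coeff p i * gauss_mean (monom 1 i))"
    by (simp add: gauss_mean_def)
  finally show ?thesis .
qed

lemma gauss_mean_add: "gauss_mean (p + q) = gauss_mean p + gauss_mean q"
  unfolding gauss_mean_def
  by (simp add: distrib_left Bochner_Integration.integral_add[OF integrable_gauss_poly integrable_gauss_poly, symmetric])

lemma gauss_mean_diff: "gauss_mean (p - q) = gauss_mean p - gauss_mean q"
  unfolding gauss_mean_def
  by (simp add: right_diff_distrib Bochner_Integration.integral_diff[OF integrable_gauss_poly integrable_gauss_poly, symmetric])

lemma gauss_mean_monom_even: "gauss_mean (monom 1 (2 * k)) = fact (2 * k) / (2 ^ k * fact k)"
  and gauss_mean_monom_odd: "gauss_mean (monom 1 (Suc (2 * k))) = 0"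
  using integral_std_normal_moment_even[of k] integral_std_normal_moment_odd[of k]
  by (simp_all add: gauss_mean_def poly_monom)

lemma gauss_mean_monom_Suc_Suc:
  "gauss_mean (monom 1 (Suc (Suc n))) = real (Suc n) * gauss_mean (monom 1 n)"
proof (cases "even n")
  case True
  then obtain k where n: "n = 2 * k" by (elim evenE)
  have e: "Suc (Suc n) = 2 * Suc k" using n by simp
  have "gauss_mean (monom 1 (Suc (Suc n))) = fact (2 * Suc k) / (2 ^ Suc k * fact (Suc k))"
    unfolding e by (rule gauss_mean_monom_even)
  also have "\<dots> = (2 * (real k + 1) * (real (Suc n) * fact (2 * k))) / (2 * (real k + 1) * (2 ^ k * fact k))"
    unfolding n by (simp add: algebra_simps)
  also have "\<dots> = real (Suc n) * fact (2 * k) / (2 ^ k * fact k)"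
    by (rule mult_divide_mult_cancel_left) simp
  also have "\<dots> = real (Suc n) * (fact (2 * k) / (2 ^ k * fact k))" by simp
  finally show ?thesis unfolding n gauss_mean_monom_even .
next
  case False
  then obtain k where n: "n = Suc (2 * k)" by (elim oddE) simp
  have e: "Suc (Suc n) = Suc (2 * Suc k)" using n by simp
  show ?thesis unfolding e unfolding n by (simp only: gauss_mean_monom_odd mult_zero_right)
qed

text \<open>Integration by parts against the Gaussian, obtained by linearity from the moment
  recursion instead of from boundary terms.\<close>

lemma gauss_mean_by_parts: "gauss_mean (pCons 0 p) = gauss_mean (pderiv p)"
proof -
  define N where "N = Suc (degree p)"
  have "gauss_mean (pCons 0 p) = (\<Sum>i<Suc (Suc N). coeff (pCons 0 p) i * gauss_mean (monom 1 i))"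
    by (rule gauss_mean_sum) (simp add: N_def degree_pCons_eq_if)
  also have "\<dots> = (\<Sum>i<N. coeff p (Suc i) * gauss_mean (monom 1 (Suc (Suc i))))"
    using gauss_mean_monom_odd[of 0] by (simp add: sum.lessThan_Suc_shift del: sum.lessThan_Suc)
  also have "\<dots> = (\<Sum>i<N. coeff (pderiv p) i * gauss_mean (monom 1 i))"
    by (intro sum.cong refl) (simp add: gauss_mean_monom_Suc_Suc coeff_pderiv)
  also have "\<dots> = gauss_mean (pderiv p)"
    by (rule gauss_mean_sum[symmetric]) (use degree_pderiv[of p] in \<open>simp add: N_def\<close>)
  finally show ?thesis .
qed

text \<open>The probabilists' normalisation, monic and orthogonal for the standard normal density.
  The operator applied in each step is the adjoint of \<open>pderiv\<close> for
  \<open>gauss_mean\<close>.\<close>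

fun hermite :: "nat \<Rightarrow> real poly" where
  "hermite 0 = 1"
| "hermite (Suc k) = pCons 0 (hermite k) - pderiv (hermite k)"

lemma degree_hermite: "degree (hermite k) = k" and lead_coeff_hermite: "lead_coeff (hermite k) = 1"
proof -
  have "degree (hermite k) = k \<and> lead_coeff (hermite k) = 1"
  proof (induction k)
    case (Suc k)
    have "coeff (hermite k) k = 1" using Suc by metis
    then have c: "coeff (hermite (Suc k)) (Suc k) = 1"
      using Suc by (simp add: coeff_eq_0 degree_pderiv)
    have "degree (hermite (Suc k)) \<le> Suc k"
      unfolding hermite.simps using Suc
      by (intro degree_diff_le) (auto simp: degree_pderiv intro: order_trans[OF degree_pCons_le])
    then have "degree (hermite (Suc k)) = Suc k"
      using le_degree[of "hermite (Suc k)" "Suc k"] c by (simp del: hermite.simps)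
    then show ?case using c by simp
  qed simp
  then show "degree (hermite k) = k" "lead_coeff (hermite k) = 1" by auto
qed

text \<open>Each raising step can be moved to the other factor as a derivative, by parts applied to
  \<open>hermite k * q\<close>. Orthogonality follows by comparing degrees.\<close>

lemma gauss_mean_hermite_mult: "gauss_mean (hermite k * q) = gauss_mean ((pderiv ^^ k) q)"
proof (induction k arbitrary: q)
  case (Suc k)
  have "hermite (Suc k) * q = pCons 0 (hermite k * q) - pderiv (hermite k) * q"
    by (simp add: algebra_simps)
  then have "gauss_mean (hermite (Suc k) * q) = gauss_mean (hermite k * pderiv q)"
    by (simp add: gauss_mean_diff gauss_mean_by_parts pderiv_mult gauss_mean_add mult.commute)
  then show ?case using Suc by (simp add: funpow_swap1)
qed simp

lemma gauss_mean_1: "gauss_mean 1 = 1"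
  using gauss_mean_monom_even[of 0] by (simp add: monom_0 one_pCons)

lemma gauss_mean_hermite_less: "j < k \<Longrightarrow> gauss_mean (hermite k * hermite j) = 0"
proof -
  assume "j < k"
  then have "(pderiv ^^ k) (hermite j) = 0"
    by (intro poly_eqI) (simp add: coeff_higher_pderiv coeff_eq_0 degree_hermite)
  then show ?thesis unfolding gauss_mean_hermite_mult by (simp add: gauss_mean_def)
qed

lemma gauss_mean_hermite: "gauss_mean (hermite k * hermite j) = (if j = k then fact k else 0)"
proof (cases "j = k")
  case True
  have "(pderiv ^^ k) (hermite k) = [:fact k:]"
  proof (intro poly_eqI)
    fix n show "coeff ((pderiv ^^ k) (hermite k)) n = coeff [:fact k:] n"
      using lead_coeff_hermite[of k]
      by (cases n) (simp_all add: coeff_higher_pderiv coeff_eq_0 degree_hermite pochhammer_fact)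
  qed
  moreover have "gauss_mean [:fact k:] = fact k"
    using gauss_mean_1 by (simp add: gauss_mean_def)
  ultimately show ?thesis using True by (simp add: gauss_mean_hermite_mult)
next
  case False
  then show ?thesis using gauss_mean_hermite_less[of j k] gauss_mean_hermite_less[of k j]
    by (cases "j < k") (auto simp: mult.commute)
qed

interpretation lborel_prod: product_sigma_finite "\<lambda>_::nat. lborel :: real measure"
  by standard

text \<open>Both Vandermonde factors are expanded in Hermite polynomials, giving a sum over pairs of
  permutations of products of one-dimensional integrals. Only the \<open>d!\<close> diagonal pairs
  survive, and each contributes the product of the squared norms \<open>k!\<close>.\<close>

theorem mehta_integral:
  "has_bochner_integral (Pi\<^sub>M {..<d} (\<lambda>_. lborel))
    (\<lambda>x. (\<Prod>j<d. std_normal_density (x j)) * (vandermonde_prod d x)\<^sup>2) (fact d * (\<Prod>k<d. fact k))"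
proof -
  let ?S = "{\<sigma>. \<sigma> permutes {..<d}}"
  let ?h = "\<lambda>\<sigma> \<tau> j. \<lambda>t. std_normal_density t * poly (hermite (\<sigma> j) * hermite (\<tau> j)) t"
  have V: "vandermonde_prod d x = (\<Sum>\<sigma>\<in>?S. real_of_int (sign \<sigma>) * (\<Prod>j<d. poly (hermite (\<sigma> j)) (x j)))" for x
    by (rule sum_permutations_monic[symmetric]) (use lead_coeff_hermite in \<open>simp add: degree_hermite\<close>)
  have eq: "(\<Prod>j<d. std_normal_density (x j)) * (vandermonde_prod d x)\<^sup>2 =
    (\<Sum>\<sigma>\<in>?S. \<Sum>\<tau>\<in>?S. real_of_int (sign \<sigma> * sign \<tau>) * (\<Prod>j<d. ?h \<sigma> \<tau> j (x j)))" for x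
    unfolding V power2_eq_square sum_product
    by (simp add: sum_distrib_left prod.distrib mult_ac)
  have int: "has_bochner_integral (Pi\<^sub>M {..<d} (\<lambda>_. lborel)) (\<lambda>x. \<Prod>j<d. ?h \<sigma> \<tau> j (x j))
     (\<Prod>j<d. if \<sigma> j = \<tau> j then fact (\<sigma> j) else 0)" for \<sigma> \<tau> :: "nat \<Rightarrow> nat"
    unfolding has_bochner_integral_iff
  proof
    show "integrable (Pi\<^sub>M {..<d} (\<lambda>_. lborel)) (\<lambda>x. \<Prod>j<d. ?h \<sigma> \<tau> j (x j))"
      by (intro lborel_prod.product_integrable_prod integrable_gauss_poly) auto
    show "(\<integral>x. (\<Prod>j<d. ?h \<sigma> \<tau> j (x j)) \<partial>Pi\<^sub>M {..<d} (\<lambda>_. lborel)) =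
      (\<Prod>j<d. if \<sigma> j = \<tau> j then fact (\<sigma> j) else 0)"
      by (subst lborel_prod.product_integral_prod)
        (auto intro!: integrable_gauss_poly prod.cong
          simp: gauss_mean_def[symmetric] gauss_mean_hermite simp del: poly_mult)
  qed
  have "has_bochner_integral (Pi\<^sub>M {..<d} (\<lambda>_. lborel))
    (\<lambda>x. (\<Prod>j<d. std_normal_density (x j)) * (vandermonde_prod d x)\<^sup>2)
    (\<Sum>\<sigma>\<in>?S. \<Sum>\<tau>\<in>?S. real_of_int (sign \<sigma> * sign \<tau>) * (\<Prod>j<d. if \<sigma> j = \<tau> j then fact (\<sigma> j) else 0))"
    unfolding eq by (intro has_bochner_integral_sum has_bochner_integral_mult_right int)
  also have "(\<Sum>\<sigma>\<in>?S. \<Sum>\<tau>\<in>?S. real_of_int (sign \<sigma> * sign \<tau>) * (\<Prod>j<d. if \<sigma> j = \<tau> j then fact (\<sigma> j) else 0)) =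
    (\<Sum>\<sigma>\<in>?S. \<Prod>k<d. fact k)"
  proof (intro sum.cong refl)
    fix \<sigma> assume \<sigma>: "\<sigma> \<in> ?S"
    have ne: "\<exists>j<d. \<sigma> j \<noteq> \<tau> j" if "\<tau> \<in> ?S" "\<tau> \<noteq> \<sigma>" for \<tau>
    proof (rule ccontr)
      assume "\<not> (\<exists>j<d. \<sigma> j \<noteq> \<tau> j)"
      then have "\<sigma> j = \<tau> j" for j using that \<sigma> by (cases "j < d") (auto simp: permutes_def)
      then show False using that by auto
    qed
    have "(\<Sum>\<tau>\<in>?S. real_of_int (sign \<sigma> * sign \<tau>) * (\<Prod>j<d. if \<sigma> j = \<tau> j then fact (\<sigma> j) else 0)) =
      (\<Sum>\<tau>\<in>{\<sigma>}. real_of_int (sign \<sigma> * sign \<tau>) * (\<Prod>j<d. if \<sigma> j = \<tau> j then fact (\<sigma> j) else 0))"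
      using \<sigma> ne by (intro sum.mono_neutral_right) (auto simp: finite_permutations prod_zero_iff)
    also have "\<dots> = (\<Prod>j<d. fact (\<sigma> j))" by (simp add: sign_def)
    also have "\<dots> = (\<Prod>k<d. fact k)" using prod.permute[of \<sigma> "{..<d}" "fact :: nat \<Rightarrow> real"] \<sigma> by (simp add: comp_def)
    finally show "(\<Sum>\<tau>\<in>?S. real_of_int (sign \<sigma> * sign \<tau>) * (\<Prod>j<d. if \<sigma> j = \<tau> j then fact (\<sigma> j) else 0)) = (\<Prod>k<d. fact k)" .
  qed
  also have "\<dots> = fact d * (\<Prod>k<d. fact k)" by (simp add: card_permutations)
  finally show ?thesis .
qed

section \<open>Splitting off the common translation\<close>

lemma PiM_lborel_translate:
  assumes [simp]: "finite I"
  shows "distr (Pi\<^sub>M I (\<lambda>_. lborel)) (Pi\<^sub>M I (\<lambda>_. lborel)) (\<lambda>x. \<lambda>i\<in>I. x i + t) = Pi\<^sub>M (I :: nat set) (\<lambda>_. lborel :: real measure)"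
proof (rule lborel_prod.PiM_eqI)
  fix A :: "nat \<Rightarrow> real set" assume A: "\<And>i. i \<in> I \<Longrightarrow> A i \<in> sets lborel"
  have meas: "(\<lambda>x. \<lambda>i\<in>I. x i + t) \<in> Pi\<^sub>M I (\<lambda>_. lborel) \<rightarrow>\<^sub>M Pi\<^sub>M I (\<lambda>_. lborel)"
    by (intro measurable_restrict) simp
  have pre: "(\<lambda>x. x + t) -` A i \<in> sets lborel" if "i \<in> I" for i
    using measurable_sets[of "\<lambda>x. x + t" borel borel "A i"] A[OF that] by simp
  have "(\<lambda>x. \<lambda>i\<in>I. x i + t) -` Pi\<^sub>E I A \<inter> space (Pi\<^sub>M I (\<lambda>_. lborel)) = Pi\<^sub>E I (\<lambda>i. (\<lambda>x. x + t) -` A i)"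
    by (auto simp: space_PiM PiE_iff)
  moreover have "emeasure lborel ((\<lambda>x. x + t) -` A i) = emeasure lborel (A i)" if "i \<in> I" for i
  proof -
    have "emeasure (distr lborel borel ((+) t)) (A i) = emeasure lborel ((+) t -` A i)"
      using A[OF that] by (subst emeasure_distr) auto
    moreover have "(\<lambda>x. x + t) = (+) t" by (auto simp: add.commute)
    ultimately show ?thesis by (simp add: lborel_distr_plus)
  qed
  ultimately show "emeasure (distr (Pi\<^sub>M I (\<lambda>_. lborel)) (Pi\<^sub>M I (\<lambda>_. lborel)) (\<lambda>x. \<lambda>i\<in>I. x i + t)) (Pi\<^sub>E I A) =
    (\<Prod>i\<in>I. emeasure lborel (A i))"
    using A pre by (subst emeasure_distr[OF meas]) (auto simp: lborel_prod.emeasure_PiM)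
qed auto

text \<open>This is \<open>d\<close> times the squared length of \<open>x\<close> after its mean has
  been subtracted, as the next identity shows; it sees differences only and hence survives a common
  translation.\<close>

definition gap_energy :: "nat \<Rightarrow> (nat \<Rightarrow> real) \<Rightarrow> real" where
  "gap_energy d x = (\<Sum>j<d. \<Sum>i<j. (x j - x i)\<^sup>2)"

lemma gap_energy_identity: "real d * (\<Sum>j<d. (x j)\<^sup>2) = gap_energy d x + (\<Sum>j<d. x j)\<^sup>2"
proof (induction d)
  case (Suc d)
  have "(\<Sum>i<d. (x d - x i)\<^sup>2) = real d * (x d)\<^sup>2 - 2 * x d * (\<Sum>i<d. x i) + (\<Sum>i<d. (x i)\<^sup>2)"
    by (simp add: power2_diff sum.distrib sum_subtractf sum_distrib_left algebra_simps)
  then show ?case using Suc by (simp add: gap_energy_def power2_eq_square algebra_simps)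
qed (simp add: gap_energy_def)

lemma vandermonde_prod_cong: "(\<And>i j. j < d \<Longrightarrow> i < j \<Longrightarrow> x j - x i = y j - y i) \<Longrightarrow> vandermonde_prod d x = vandermonde_prod d y"
  by (auto simp: vandermonde_prod_def intro!: prod.cong)

lemma gap_energy_cong: "(\<And>i j. j < d \<Longrightarrow> i < j \<Longrightarrow> x j - x i = y j - y i) \<Longrightarrow> gap_energy d x = gap_energy d y"
  by (auto simp: gap_energy_def intro!: sum.cong)

lemma measurable_vandermonde_prod [measurable]:
  assumes "\<And>j. j < d \<Longrightarrow> (\<lambda>x. f x j) \<in> borel_measurable M"
  shows "(\<lambda>x. vandermonde_prod d (f x) :: real) \<in> borel_measurable M"
  unfolding vandermonde_prod_def using assms by (intro borel_measurable_prod borel_measurable_diff) auto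

lemma measurable_gap_energy [measurable]:
  assumes "\<And>j. j < d \<Longrightarrow> (\<lambda>x. f x j) \<in> borel_measurable M"
  shows "(\<lambda>x. gap_energy d (f x)) \<in> borel_measurable M"
  unfolding gap_energy_def using assms
  by (intro borel_measurable_sum borel_measurable_power borel_measurable_diff) auto

lemma measurable_upd_coordinate:
  assumes "j < Suc e"
  shows "(\<lambda>y. (y(e := c)) j) \<in> borel_measurable (Pi\<^sub>M {..<e} (\<lambda>_. lborel :: real measure))"
  using assms by (cases "j = e") auto

text \<open>Translating all coordinates by the last one splits Mehta's integral over \<open>e + 1\<close> variables
  into the integral below and a one-dimensional Gaussian integral.\<close>

theorem reduced_mehta_integral:
  fixes e :: nat
  defines "d \<equiv> Suc e"
  shows "has_bochner_integral (Pi\<^sub>M {..<e} (\<lambda>_. lborel))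
    (\<lambda>y. (vandermonde_prod d (y(e := 0)))\<^sup>2 * exp (- gap_energy d (y(e := 0)) / (2 * real d)))
    (fact d * (\<Prod>k<d. fact k) * (2 * pi) powr (real d / 2) * sqrt (real d / (2 * pi)))"
proof -
  let ?M = "Pi\<^sub>M {..<e} (\<lambda>_. lborel :: real measure)"
  let ?g = "\<lambda>y. (vandermonde_prod d (y(e := 0)))\<^sup>2 * exp (- gap_energy d (y(e := 0)) / (2 * real d))"
  have d0: "real d > 0" by (simp add: d_def)
  define c where "c = (1 / sqrt (2 * pi)) ^ d"
  define F where "F x = (\<Prod>j<d. std_normal_density (x j)) * (vandermonde_prod d x)\<^sup>2" for x :: "nat \<Rightarrow> real"
  have F: "F x = c * (vandermonde_prod d x)\<^sup>2 * exp (- (gap_energy d x + (\<Sum>j<d. x j)\<^sup>2) / (2 * real d))" for x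
  proof -
    have "(\<Prod>j<d. std_normal_density (x j)) = c * (\<Prod>j<d. exp (- (x j)\<^sup>2 / 2))"
      by (simp add: std_normal_density_def prod.distrib prod_constant c_def prod_dividef power_divide)
    also have "(\<Prod>j<d. exp (- (x j)\<^sup>2 / 2)) = exp (- (\<Sum>j<d. (x j)\<^sup>2) / 2)"
      by (simp add: exp_sum[symmetric] sum_divide_distrib sum_negf)
    also have "- (\<Sum>j<d. (x j)\<^sup>2) / 2 = - (real d * (\<Sum>j<d. (x j)\<^sup>2)) / (2 * real d)"
      using d0 by (simp add: field_simps)
    finally show ?thesis unfolding F_def gap_energy_identity by simp
  qed
  have [measurable]: "F \<in> borel_measurable (Pi\<^sub>M {..<d} (\<lambda>_. lborel))"
    unfolding F_def[abs_def] by (intro borel_measurable_times borel_measurable_prod borel_measurable_power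
      measurable_vandermonde_prod) auto
  have gm [measurable]: "?g \<in> borel_measurable ?M"
    using measurable_vandermonde_prod[where d = "Suc e" and f = "\<lambda>y. y(e := 0)" and M = ?M, OF measurable_upd_coordinate]
      measurable_gap_energy[where d = "Suc e" and f = "\<lambda>y. y(e := 0)" and M = ?M, OF measurable_upd_coordinate]
    unfolding d_def
    by (intro borel_measurable_times borel_measurable_power measurable_compose[OF _ borel_measurable_exp]
        borel_measurable_divide borel_measurable_uminus) auto
  \<comment> \<open>As a function of \<open>t\<close> this is an unnormalised Gaussian with mean
    \<open>- s / d\<close> and deviation \<open>1 / sqrt d\<close>, so its integral does not depend
    on \<open>s\<close>.\<close>
  have gauss: "(\<integral>\<^sup>+t. ennreal (exp (- (s + real d * t)\<^sup>2 / (2 * real d))) \<partial>lborel) = ennreal (sqrt (2 * pi / d))" for s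
  proof -
    have "exp (- (s + real d * t)\<^sup>2 / (2 * real d)) = sqrt (2 * pi / d) * normal_density (- s / d) (1 / sqrt d) t" for t
    proof -
      have "(s + real d * t)\<^sup>2 / (2 * real d) = (t - (- s / d))\<^sup>2 / (2 * (1 / sqrt d)\<^sup>2)"
        using d0 by (simp add: field_simps power2_eq_square)
      moreover have "sqrt (2 * pi / d) \<noteq> 0" using d0 by simp
      ultimately show ?thesis using d0 by (simp add: normal_density_def power_divide)
    qed
    moreover have "(\<integral>\<^sup>+t. ennreal (sqrt (2 * pi / d) * normal_density (- s / d) (1 / sqrt d) t) \<partial>lborel) =
      ennreal (\<integral>t. sqrt (2 * pi / d) * normal_density (- s / d) (1 / sqrt d) t \<partial>lborel)"
      using d0 by (intro nn_integral_eq_integral) (auto simp: integrable_normal_density)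
    ultimately show ?thesis using d0 by (simp add: integral_normal_density)
  qed
  have dI: "{..<d} = insert e {..<e}" by (auto simp: d_def)
  \<comment> \<open>Working with nonnegative integrals allows the order to be exchanged before
    anything is known about integrability in the remaining variables; that follows at the end from
    the finite value.\<close>
  have "ennreal (fact d * (\<Prod>k<d. fact k)) = (\<integral>\<^sup>+x. ennreal (F x) \<partial>Pi\<^sub>M {..<d} (\<lambda>_. lborel))"
    using mehta_integral[of d] unfolding has_bochner_integral_iff F_def
    by (subst nn_integral_eq_integral) (auto intro!: mult_nonneg_nonneg prod_nonneg)
  also have "\<dots> =
    (\<integral>\<^sup>+t. (\<integral>\<^sup>+y. ennreal (F (y(e := t))) \<partial>?M) \<partial>lborel)"
    unfolding dI
  proof (intro lborel_prod.product_nn_integral_insert_rev)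
    have "(\<lambda>x. ennreal (F x)) \<in> borel_measurable (Pi\<^sub>M {..<d} (\<lambda>_. lborel))" by measurable
    then show "(\<lambda>x. ennreal (F x)) \<in> borel_measurable (Pi\<^sub>M (insert e {..<e}) (\<lambda>_. lborel))"
      unfolding dI .
  qed auto
  also have "\<dots> = (\<integral>\<^sup>+t. (\<integral>\<^sup>+y. ennreal (c * ?g y) * ennreal (exp (- ((\<Sum>j<e. y j) + real d * t)\<^sup>2 / (2 * real d))) \<partial>?M) \<partial>lborel)"
  proof (rule nn_integral_cong)
    fix t :: real
    have coord: "(\<lambda>y. (y(e := t)) j) \<in> borel_measurable ?M" if "j < d" for j
      using measurable_upd_coordinate[of j e t] that by (simp add: d_def)
    have "(\<lambda>y. F (y(e := t))) \<in> borel_measurable ?M"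
      unfolding F_def
      by (intro borel_measurable_times borel_measurable_prod borel_measurable_power measurable_vandermonde_prod
          measurable_compose[OF coord borel_measurable_normal_density] coord) auto
    then have Fm: "(\<lambda>y. ennreal (F (y(e := t)))) \<in> borel_measurable ?M" by simp
    have "(\<integral>\<^sup>+y. ennreal (F (y(e := t))) \<partial>?M) =
      (\<integral>\<^sup>+y. ennreal (F (y(e := t))) \<partial>distr ?M ?M (\<lambda>x. \<lambda>i\<in>{..<e}. x i + t))"
      by (simp add: PiM_lborel_translate)
    also have "\<dots> = (\<integral>\<^sup>+y. ennreal (F ((\<lambda>i\<in>{..<e}. y i + t)(e := t))) \<partial>?M)"
      using Fm by (subst nn_integral_distr) (auto intro!: measurable_restrict)
    also have "\<dots> = (\<integral>\<^sup>+y. ennreal (c * ?g y) * ennreal (exp (- ((\<Sum>j<e. y j) + real d * t)\<^sup>2 / (2 * real d))) \<partial>?M)"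
    proof (intro nn_integral_cong)
      fix y
      let ?z = "(\<lambda>i\<in>{..<e}. y i + t)(e := t)"
      have "vandermonde_prod d ?z = vandermonde_prod d (y(e := 0))"
        by (rule vandermonde_prod_cong) (auto simp: d_def)
      moreover have "gap_energy d ?z = gap_energy d (y(e := 0))"
        by (rule gap_energy_cong) (auto simp: d_def)
      moreover have "(\<Sum>j<d. ?z j) = (\<Sum>j<e. y j) + real d * t"
        by (simp add: d_def sum.distrib algebra_simps)
      ultimately have "F ?z = (c * ?g y) * exp (- ((\<Sum>j<e. y j) + real d * t)\<^sup>2 / (2 * real d))"
        unfolding F by (simp add: diff_divide_distrib add_divide_distrib exp_diff exp_minus field_simps)
      then show "ennreal (F ?z) = ennreal (c * ?g y) * ennreal (exp (- ((\<Sum>j<e. y j) + real d * t)\<^sup>2 / (2 * real d)))"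
        by (simp only: ennreal_mult'' exp_ge_zero)
    qed
    finally show "(\<integral>\<^sup>+y. ennreal (F (y(e := t))) \<partial>?M) =
      (\<integral>\<^sup>+y. ennreal (c * ?g y) * ennreal (exp (- ((\<Sum>j<e. y j) + real d * t)\<^sup>2 / (2 * real d))) \<partial>?M)" .
  qed
  also have "\<dots> = (\<integral>\<^sup>+y. (\<integral>\<^sup>+t. ennreal (c * ?g y) * ennreal (exp (- ((\<Sum>j<e. y j) + real d * t)\<^sup>2 / (2 * real d))) \<partial>lborel) \<partial>?M)"
  proof (rule pair_sigma_finite.Fubini')
    have sm: "(\<lambda>y. \<Sum>j<e. y j) \<in> borel_measurable ?M"
      by (intro borel_measurable_sum) auto
    have "(\<lambda>z. ennreal (c * g (fst z)) * ennreal (exp (- (h (fst z) + real d * snd z)\<^sup>2 / (2 * real d))))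
      \<in> borel_measurable (?M \<Otimes>\<^sub>M lborel)" if [measurable]: "g \<in> borel_measurable ?M" "h \<in> borel_measurable ?M" for g h
      by measurable
    from this[OF gm sm] show "(\<lambda>(y, t). ennreal (c * ?g y) * ennreal (exp (- ((\<Sum>j<e. y j) + real d * t)\<^sup>2 / (2 * real d))))
      \<in> borel_measurable (?M \<Otimes>\<^sub>M lborel)" by (simp add: case_prod_unfold)
  qed (auto intro!: pair_sigma_finite.intro lborel_prod.sigma_finite lborel.sigma_finite_measure_axioms)
  also have "\<dots> = (\<integral>\<^sup>+y. ennreal (c * sqrt (2 * pi / d)) * ennreal (?g y) \<partial>?M)"
  proof (intro nn_integral_cong)
    fix y :: "nat \<Rightarrow> real"
    have "(\<integral>\<^sup>+t. ennreal (c * ?g y) * ennreal (exp (- ((\<Sum>j<e. y j) + real d * t)\<^sup>2 / (2 * real d))) \<partial>lborel) =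
       ennreal (c * ?g y) * ennreal (sqrt (2 * pi / d))"
      using gauss[of "\<Sum>j<e. y j"] by (simp add: nn_integral_cmult)
    then show "(\<integral>\<^sup>+t. ennreal (c * ?g y) * ennreal (exp (- ((\<Sum>j<e. y j) + real d * t)\<^sup>2 / (2 * real d))) \<partial>lborel) =
       ennreal (c * sqrt (2 * pi / d)) * ennreal (?g y)"
      by (simp add: ennreal_mult'[symmetric] c_def mult_ac)
  qed
  also have "\<dots> = ennreal (c * sqrt (2 * pi / d)) * (\<integral>\<^sup>+y. ennreal (?g y) \<partial>?M)"
    by (rule nn_integral_cmult) measurable
  finally have eq: "ennreal (c * sqrt (2 * pi / d)) * (\<integral>\<^sup>+y. ennreal (?g y) \<partial>?M) = ennreal (fact d * (\<Prod>k<d. fact k))" ..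
  define k where "k = c * sqrt (2 * pi / d)"
  have k0: "k > 0" by (simp add: k_def c_def d_def)
  have "(\<integral>\<^sup>+y. ennreal (?g y) \<partial>?M) = ennreal (1 / k) * (ennreal k * (\<integral>\<^sup>+y. ennreal (?g y) \<partial>?M))"
    using k0 by (simp add: mult.assoc[symmetric] ennreal_mult'[symmetric])
  also have "\<dots> = ennreal (1 / k * (fact d * (\<Prod>k<d. fact k)))"
    using eq k0 by (simp add: k_def[symmetric] ennreal_mult'[symmetric])
  finally have nn: "(\<integral>\<^sup>+y. ennreal (?g y) \<partial>?M) = ennreal (1 / k * (fact d * (\<Prod>k<d. fact k)))" .
  have "1 / k = (2 * pi) powr (real d / 2) * sqrt (real d / (2 * pi))"
  proof -
    have "sqrt (2 * pi) ^ d = (2 * pi) powr (real d / 2)"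
      by (simp add: powr_half_sqrt[symmetric] powr_power)
    moreover have "1 / k = sqrt (2 * pi) ^ d * (1 / sqrt (2 * pi / d))"
      by (simp add: k_def c_def power_divide)
    moreover have "1 / sqrt (2 * pi / d) = sqrt (real d / (2 * pi))" by (simp add: real_sqrt_divide)
    ultimately show ?thesis by simp
  qed
  then have "1 / k * (fact d * (\<Prod>k<d. fact k)) =
    fact d * (\<Prod>k<d. fact k) * (2 * pi) powr (real d / 2) * sqrt (real d / (2 * pi))"
    by (simp only: mult_ac)
  then show ?thesis
    using has_bochner_integral_nn_integral[OF gm _ _ nn] k0 by (simp add: prod_nonneg)
qed

section \<open>An integral formula for the number of words\<close>

text \<open>The generating functions involved are homogeneous, so one angle is redundant and the last of
  the \<open>e + 1\<close> angles is set to 0. The integration variables are the other angles multiplied by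
  \<open>s\<close>; taking \<open>s\<close> proportional to \<open>sqrt n\<close> later makes a change of variables unnecessary.\<close>

definition torus_angle :: "nat \<Rightarrow> real \<Rightarrow> (nat \<Rightarrow> real) \<Rightarrow> nat \<Rightarrow> real" where
  "torus_angle e s y j = (y(e := 0)) j / s"

definition torus_box :: "nat \<Rightarrow> real \<Rightarrow> (nat \<Rightarrow> real) \<Rightarrow> real" where
  "torus_box e s y = (\<Prod>j<e. indicator {- pi * s..pi * s} (y j))"

definition torus_mean :: "nat \<Rightarrow> real \<Rightarrow> ((nat \<Rightarrow> real) \<Rightarrow> complex) \<Rightarrow> complex" where
  "torus_mean e s F =
    (\<integral>y. torus_box e s y *\<^sub>R F (torus_angle e s y) \<partial>Pi\<^sub>M {..<e} (\<lambda>_. lborel)) / of_real ((2 * pi * s) ^ e)"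

text \<open>Boundedness at all angles, not only inside the box, makes this class visibly closed
  under sums and products, while still giving integrability over the box.\<close>

definition tame :: "nat \<Rightarrow> real \<Rightarrow> ((nat \<Rightarrow> real) \<Rightarrow> complex) \<Rightarrow> bool" where
  "tame e s F \<longleftrightarrow> (\<lambda>y. F (torus_angle e s y)) \<in> borel_measurable (Pi\<^sub>M {..<e} (\<lambda>_. lborel)) \<and>
    (\<exists>B. \<forall>\<theta>. norm (F \<theta>) \<le> B)"

definition pairing :: "nat \<Rightarrow> (nat \<Rightarrow> int) \<Rightarrow> (nat \<Rightarrow> real) \<Rightarrow> real" where
  "pairing d l \<theta> = (\<Sum>j<d. of_int (l j) * \<theta> j)"

section \<open>Bounded functions and characters on the torus\<close>

lemma tame_mult: "tame e s F \<Longrightarrow> tame e s G \<Longrightarrow> tame e s (\<lambda>\<theta>. F \<theta> * G \<theta>)"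
proof -
  assume FG: "tame e s F" "tame e s G"
  obtain A B where AB: "\<And>\<theta>. norm (F \<theta>) \<le> A" "\<And>\<theta>. norm (G \<theta>) \<le> B" using FG unfolding tame_def by blast
  have "norm (F \<theta> * G \<theta>) \<le> A * B" for \<theta>
    unfolding norm_mult by (rule mult_mono[OF AB]) (use AB norm_ge_zero order_trans in blast)+
  then show ?thesis using FG unfolding tame_def by (auto intro: borel_measurable_times)
qed

lemma tame_sum:
  assumes "\<And>i. i \<in> A \<Longrightarrow> tame e s (F i)"
  shows "tame e s (\<lambda>\<theta>. \<Sum>i\<in>A. F i \<theta>)"
proof -
  have "\<forall>i\<in>A. \<exists>B. \<forall>\<theta>. norm (F i \<theta>) \<le> B" using assms by (auto simp: tame_def)
  then obtain B where B: "\<And>i \<theta>. i \<in> A \<Longrightarrow> norm (F i \<theta>) \<le> B i" by metis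
  have "norm (\<Sum>i\<in>A. F i \<theta>) \<le> (\<Sum>i\<in>A. B i)" for \<theta>
    by (rule sum_norm_le) (rule B)
  then show ?thesis using assms unfolding tame_def by (auto intro: borel_measurable_sum)
qed

lemma tame_const: "tame e s (\<lambda>_. c)"
  by (auto simp: tame_def)

lemma tame_power: "tame e s F \<Longrightarrow> tame e s (\<lambda>\<theta>. F \<theta> ^ n)"
  by (induction n) (auto intro: tame_mult tame_const)

lemma measurable_torus_angle:
  "j < Suc e \<Longrightarrow> (\<lambda>y. torus_angle e s y j) \<in> borel_measurable (Pi\<^sub>M {..<e} (\<lambda>_. lborel))"
  unfolding torus_angle_def by (intro borel_measurable_divide measurable_upd_coordinate) auto

lemma tame_cis: "tame e s (\<lambda>\<theta>. cis (\<Sum>j<Suc e. a j * \<theta> j))"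
proof -
  have "(\<lambda>y. \<Sum>j<Suc e. a j * torus_angle e s y j) \<in> borel_measurable (Pi\<^sub>M {..<e} (\<lambda>_. lborel))"
    by (intro borel_measurable_sum borel_measurable_times borel_measurable_const measurable_torus_angle) auto
  moreover have "cis \<in> borel_measurable borel"
    by (intro borel_measurable_continuous_onI continuous_on_cis continuous_on_id)
  ultimately show ?thesis
    unfolding tame_def by (auto intro: measurable_compose exI[of _ 1])
qed

lemma torus_box_integrable:
  "s > 0 \<Longrightarrow> integrable (Pi\<^sub>M {..<e} (\<lambda>_. lborel)) (torus_box e s)"
  unfolding torus_box_def[abs_def]
  by (intro lborel_prod.product_integrable_prod) (auto simp: integrable_indicator_iff)

lemma tame_integrable:
  assumes "tame e s F" "s > 0"
  shows "integrable (Pi\<^sub>M {..<e} (\<lambda>_. lborel)) (\<lambda>y. torus_box e s y *\<^sub>R F (torus_angle e s y))"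
proof -
  obtain B where B: "\<And>\<theta>. norm (F \<theta>) \<le> B" using assms by (auto simp: tame_def)
  have meas: "(\<lambda>y. F (torus_angle e s y)) \<in> borel_measurable (Pi\<^sub>M {..<e} (\<lambda>_. lborel))"
    using assms by (simp add: tame_def)
  have bm: "torus_box e s \<in> borel_measurable (Pi\<^sub>M {..<e} (\<lambda>_. lborel))"
    using torus_box_integrable[OF assms(2)] by auto
  have box: "torus_box e s y \<ge> 0" for y by (auto simp: torus_box_def intro!: prod_nonneg)
  have int: "integrable (Pi\<^sub>M {..<e} (\<lambda>_. lborel)) (\<lambda>y. B * torus_box e s y)"
    by (intro integrable_mult_right torus_box_integrable assms)
  have "norm (torus_box e s y *\<^sub>R F (torus_angle e s y)) \<le> norm (B * torus_box e s y)" for y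
  proof -
    have "0 \<le> B" using B norm_ge_zero order_trans by blast
    then have "norm (B * torus_box e s y) = torus_box e s y * B" using box[of y] by (simp add: abs_mult)
    then show ?thesis
      using mult_left_mono[OF B[of "torus_angle e s y"] box[of y]] box[of y] by simp
  qed
  then show ?thesis
    using Bochner_Integration.integrable_bound[OF int borel_measurable_scaleR[OF bm meas]] by auto
qed

lemma torus_mean_sum:
  assumes "\<And>i. i \<in> A \<Longrightarrow> tame e s (F i)" "s > 0"
  shows "torus_mean e s (\<lambda>\<theta>. \<Sum>i\<in>A. F i \<theta>) = (\<Sum>i\<in>A. torus_mean e s (F i))"
  unfolding torus_mean_def scaleR_sum_right
  by (subst Bochner_Integration.integral_sum) (auto intro: tame_integrable assms simp: sum_divide_distrib)

lemma torus_mean_cmult: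
  "torus_mean e s (\<lambda>\<theta>. c * F \<theta>) = c * torus_mean e s F"
  unfolding torus_mean_def
  by (simp only: mult_scaleR_right[symmetric] integral_mult_right_zero times_divide_eq_right)

lemma interval_character_integral:
  assumes "s > 0"
  shows "integrable lborel (\<lambda>t. indicator {- pi * s..pi * s} t *\<^sub>R cis (of_int k * (t / s)))"
    "(\<integral>t. indicator {- pi * s..pi * s} t *\<^sub>R cis (of_int k * (t / s)) \<partial>lborel) = (if k = 0 then of_real (2 * pi * s) else 0)"
proof -
  have cont: "continuous_on A (\<lambda>t. cis (of_int k * (t / s)))" for A
    using assms by (intro continuous_intros) auto
  show "integrable lborel (\<lambda>t. indicator {- pi * s..pi * s} t *\<^sub>R cis (of_int k * (t / s)))"
    using borel_integrable_atLeastAtMost'[OF cont] by (simp add: set_integrable_def)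
  show "(\<integral>t. indicator {- pi * s..pi * s} t *\<^sub>R cis (of_int k * (t / s)) \<partial>lborel) = (if k = 0 then of_real (2 * pi * s) else 0)"
  proof (cases "k = 0")
    case True
    have "(\<integral>t. indicator {- pi * s..pi * s} t *\<^sub>R (1 :: complex) \<partial>lborel) = of_real (2 * pi * s)"
      using assms by (simp add: scaleR_conv_of_real)
    then show ?thesis using True by simp
  next
    case False
    define G where "G t = of_real s / (\<i> * of_int k) * cis (of_int k * (t / s))" for t
    have "(\<integral>t. indicator {- pi * s..pi * s} t *\<^sub>R cis (of_int k * (t / s)) \<partial>lborel) = G (pi * s) - G (- pi * s)"
    proof (rule integral_FTC_Icc)
      show "- pi * s \<le> pi * s" using assms by (simp add: mult_right_mono)
      show "(G has_vector_derivative cis (of_int k * (t / s))) (at t within {- pi * s..pi * s})" for t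
      proof -
        have "((\<lambda>z. of_real s / (\<i> * of_int k) * exp (\<i> * of_int k * z / of_real s)) has_field_derivative
          exp (\<i> * of_int k * of_real t / of_real s)) (at (of_real t))"
          using False assms by (auto intro!: derivative_eq_intros)
        from has_vector_derivative_real_field[OF this] show ?thesis
          unfolding G_def cis_conv_exp by (simp add: mult.assoc)
      qed
    qed (rule cont)
    also have "\<dots> = 0"
    proof -
      have "cis (of_int k * pi) = cis (- (of_int k * pi))"
        using sin_npi_int[of k] by (simp add: complex_eq_iff mult.commute)
      then show ?thesis using assms by (simp add: G_def)
    qed
    finally show ?thesis using False by simp
  qed
qed

lemma torus_mean_character:
  assumes "s > 0"
  shows "torus_mean e s (\<lambda>\<theta>. cis (pairing (Suc e) l \<theta>)) = (if \<forall>j<e. l j = 0 then 1 else 0)"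
proof -
  let ?M = "Pi\<^sub>M {..<e} (\<lambda>_. lborel :: real measure)"
  have "torus_box e s y *\<^sub>R cis (pairing (Suc e) l (torus_angle e s y)) =
    (\<Prod>j<e. indicator {- pi * s..pi * s} (y j) *\<^sub>R cis (of_int (l j) * (y j / s)))" for y
  proof -
    have "pairing (Suc e) l (torus_angle e s y) = (\<Sum>j<e. of_int (l j) * (y j / s))"
      by (simp add: pairing_def torus_angle_def)
    then show ?thesis
      by (simp add: torus_box_def scaleR_conv_of_real prod.distrib cis_conv_exp exp_sum sum_distrib_left of_real_prod)
  qed
  then have "(\<integral>y. torus_box e s y *\<^sub>R cis (pairing (Suc e) l (torus_angle e s y)) \<partial>?M) =
    (\<Prod>j<e. if l j = 0 then of_real (2 * pi * s) else 0)"
    using interval_character_integral[OF assms]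
      lborel_prod.product_integral_prod[of "{..<e}" "\<lambda>j t. indicator {- pi * s..pi * s} t *\<^sub>R cis (of_int (l j) * (t / s))"]
    by simp
  also have "\<dots> = (if \<forall>j<e. l j = 0 then of_real ((2 * pi * s) ^ e) else 0)"
    by (auto simp: prod_zero_iff)
  finally show ?thesis using assms unfolding torus_mean_def by auto
qed

text \<open>The total degree \<open>k\<close> recovers the last exponent, which the integral does not see.\<close>

definition represents :: "nat \<Rightarrow> real \<Rightarrow> ((nat \<Rightarrow> real) \<Rightarrow> complex) \<Rightarrow> ((nat \<Rightarrow> int) \<Rightarrow> int) \<Rightarrow> int \<Rightarrow> bool" where
  "represents e s F \<Phi> k \<longleftrightarrow> tame e s F \<and>
    (\<forall>l. (\<Sum>j<Suc e. l j) = k \<longrightarrow>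
      of_int (\<Phi> l) = torus_mean e s (\<lambda>\<theta>. F \<theta> * cis (- pairing (Suc e) l \<theta>)))"

definition alternant :: "nat \<Rightarrow> (nat \<Rightarrow> real) \<Rightarrow> complex" where
  "alternant d \<theta> = (\<Sum>\<sigma> | \<sigma> permutes {..<d}. of_int (sign \<sigma>) * cis (pairing d (staircase d \<circ> \<sigma>) \<theta>))"

definition power_sum :: "nat \<Rightarrow> (nat \<Rightarrow> real) \<Rightarrow> complex" where
  "power_sum d \<theta> = (\<Sum>j<d. cis (\<theta> j))"

text \<open>The complete symmetric function in the variables \<open>cis (- \<theta> j)\<close>; the
  inverse variables match \<open>down\<close>, which raises the argument.\<close>

definition complete_sum :: "nat \<Rightarrow> nat \<Rightarrow> (nat \<Rightarrow> real) \<Rightarrow> complex" where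
  "complete_sum d r \<theta> = (\<Sum>\<alpha>\<in>compositions d r. cis (- pairing d (\<lambda>j. int (\<alpha> j)) \<theta>))"

lemma tame_cis_pairing: "tame e s (\<lambda>\<theta>. cis (pairing (Suc e) l \<theta>))"
  and tame_cis_minus_pairing: "tame e s (\<lambda>\<theta>. cis (- pairing (Suc e) l \<theta>))"
  using tame_cis[of e s "\<lambda>j. of_int (l j)"] tame_cis[of e s "\<lambda>j. - of_int (l j)"]
  by (simp_all add: pairing_def sum_negf del: sum.lessThan_Suc)

lemma cis_coordinate: "j < d \<Longrightarrow> cis (\<theta> j) = cis (pairing d (\<lambda>i. if i = j then 1 else 0) \<theta>)"
proof -
  assume "j < d"
  have "pairing d (\<lambda>i. if i = j then 1 else 0) \<theta> = (\<Sum>i<d. if i = j then \<theta> i else 0)"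
    unfolding pairing_def by (intro sum.cong) auto
  then show ?thesis using \<open>j < d\<close> by simp
qed

lemma tame_alternant: "tame e s (alternant (Suc e))"
  unfolding alternant_def[abs_def] by (intro tame_sum tame_mult tame_const tame_cis_pairing)

lemma tame_power_sum: "tame e s (power_sum (Suc e))"
  unfolding power_sum_def[abs_def]
proof (rule tame_sum)
  fix j assume "j \<in> {..<Suc e}"
  then have "(\<lambda>\<theta>. cis (\<theta> j)) = (\<lambda>\<theta>. cis (pairing (Suc e) (\<lambda>i. if i = j then 1 else 0) \<theta>))"
    using cis_coordinate by blast
  then show "tame e s (\<lambda>\<theta>. cis (\<theta> j))" using tame_cis_pairing by simp
qed

lemma tame_complete_sum: "tame e s (complete_sum (Suc e) r)"
  unfolding complete_sum_def[abs_def] by (intro tame_sum tame_cis_minus_pairing)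

lemma represents_alternating_delta:
  assumes "s > 0"
  shows "represents e s (alternant (Suc e)) (alternating_delta (Suc e)) (\<Sum>j<Suc e. staircase (Suc e) j)"
  unfolding represents_def
proof (intro conjI tame_alternant allI impI)
  let ?d = "Suc e"
  fix l assume l: "(\<Sum>j<?d. l j) = (\<Sum>j<?d. staircase ?d j)"
  have "torus_mean e s (\<lambda>\<theta>. alternant ?d \<theta> * cis (- pairing ?d l \<theta>)) =
    torus_mean e s (\<lambda>\<theta>. \<Sum>\<sigma> | \<sigma> permutes {..<?d}. of_int (sign \<sigma>) * cis (pairing ?d (\<lambda>j. staircase ?d (\<sigma> j) - l j) \<theta>))"
    unfolding alternant_def sum_distrib_right mult.assoc cis_mult
    by (simp add: pairing_def sum_negf left_diff_distrib sum_subtractf del: sum.lessThan_Suc)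
  also have "\<dots> = (\<Sum>\<sigma> | \<sigma> permutes {..<?d}. of_int (sign \<sigma>) *
      torus_mean e s (\<lambda>\<theta>. cis (pairing ?d (\<lambda>j. staircase ?d (\<sigma> j) - l j) \<theta>)))"
    by (subst torus_mean_sum) (auto intro!: tame_mult tame_const tame_cis_pairing assms simp: torus_mean_cmult)
  also have "\<dots> = of_int (alternating_delta ?d l)"
    unfolding alternating_delta_def of_int_sum
  proof (intro sum.cong refl)
    fix \<sigma> assume "\<sigma> \<in> {\<sigma>. \<sigma> permutes {..<?d}}"
    then have "(\<Sum>j<?d. staircase ?d (\<sigma> j)) = (\<Sum>j<?d. l j)"
      using sum.permute[of \<sigma> "{..<?d}" "staircase ?d"] l by (simp add: comp_def)
    \<comment> \<open>Agreement in the first \<open>e\<close> coordinates and equal totals give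
      agreement in the last one.\<close>
    then have "(\<forall>j<e. staircase ?d (\<sigma> j) - l j = 0) \<longleftrightarrow> (\<forall>j<?d. l j = staircase ?d (\<sigma> j))"
      by (auto simp: less_Suc_eq)
    then show "of_int (sign \<sigma>) * torus_mean e s (\<lambda>\<theta>. cis (pairing ?d (\<lambda>j. staircase ?d (\<sigma> j) - l j) \<theta>)) =
      of_int (if \<forall>j<?d. l j = staircase ?d (\<sigma> j) then sign \<sigma> else 0)"
      unfolding torus_mean_character[OF assms] by simp
  qed
  finally show "of_int (alternating_delta ?d l) = torus_mean e s (\<lambda>\<theta>. alternant ?d \<theta> * cis (- pairing ?d l \<theta>))" ..
qed

text \<open>Lowering coordinate \<open>j\<close> of the argument by 1 multiplies the tested
  character by \<open>cis (\<theta> j)\<close>; summed over \<open>j\<close>, this is the power sum.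
  The degree must go up by 1 for the hypothesis to apply at the lowered vector.\<close>

lemma represents_up:
  assumes "s > 0" "represents e s F \<Phi> k"
  shows "represents e s (\<lambda>\<theta>. F \<theta> * power_sum (Suc e) \<theta>) (up (Suc e) \<Phi>) (k + 1)"
  unfolding represents_def
proof (intro conjI allI impI)
  let ?d = "Suc e"
  have F: "tame e s F" using assms by (simp add: represents_def)
  then show "tame e s (\<lambda>\<theta>. F \<theta> * power_sum ?d \<theta>)" by (intro tame_mult tame_power_sum)
  fix l assume l: "(\<Sum>j<?d. l j) = k + 1"
  have "of_int (up ?d \<Phi> l) = (\<Sum>j<?d. torus_mean e s (\<lambda>\<theta>. F \<theta> * cis (- pairing ?d (l(j := l j - 1)) \<theta>)))"
    unfolding up_def of_int_sum
  proof (intro sum.cong refl)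
    fix j assume j: "j \<in> {..<?d}"
    have "(\<Sum>i<?d. (l(j := l j - 1)) i) = (\<Sum>i<?d. l i - (if i = j then 1 else 0))"
      by (intro sum.cong) auto
    also have "\<dots> = k" using j l by (simp add: sum_subtractf del: sum.lessThan_Suc)
    finally show "of_int (\<Phi> (l(j := l j - 1))) = torus_mean e s (\<lambda>\<theta>. F \<theta> * cis (- pairing ?d (l(j := l j - 1)) \<theta>))"
      using assms(2) unfolding represents_def by blast
  qed
  also have "\<dots> = torus_mean e s (\<lambda>\<theta>. \<Sum>j<?d. F \<theta> * cis (- pairing ?d (l(j := l j - 1)) \<theta>))"
    by (rule torus_mean_sum[symmetric]) (intro tame_mult tame_cis_minus_pairing F assms(1))+
  also have "(\<lambda>\<theta>. \<Sum>j<?d. F \<theta> * cis (- pairing ?d (l(j := l j - 1)) \<theta>)) =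
    (\<lambda>\<theta>. F \<theta> * power_sum ?d \<theta> * cis (- pairing ?d l \<theta>))"
  proof
    fix \<theta>
    have "cis (- pairing ?d (l(j := l j - 1)) \<theta>) = cis (\<theta> j) * cis (- pairing ?d l \<theta>)" if "j < ?d" for j
    proof -
      have "pairing ?d (l(j := l j - 1)) \<theta> = (\<Sum>i<?d. of_int (l i) * \<theta> i - (if i = j then \<theta> i else 0))"
        unfolding pairing_def by (intro sum.cong) (auto simp: algebra_simps)
      also have "\<dots> = pairing ?d l \<theta> - \<theta> j"
        using that by (simp add: sum_subtractf pairing_def del: sum.lessThan_Suc)
      finally show ?thesis by (simp add: cis_mult)
    qed
    then show "(\<Sum>j<?d. F \<theta> * cis (- pairing ?d (l(j := l j - 1)) \<theta>)) = F \<theta> * power_sum ?d \<theta> * cis (- pairing ?d l \<theta>)"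
      by (simp add: power_sum_def sum_distrib_left sum_distrib_right mult.assoc del: sum.lessThan_Suc)
  qed
  finally show "of_int (up ?d \<Phi> l) = torus_mean e s (\<lambda>\<theta>. F \<theta> * power_sum ?d \<theta> * cis (- pairing ?d l \<theta>))" .
qed

lemma represents_down:
  assumes "s > 0" "represents e s F \<Phi> k"
  shows "represents e s (\<lambda>\<theta>. F \<theta> * complete_sum (Suc e) r \<theta>) (down (Suc e) r \<Phi>) (k - int r)"
  unfolding represents_def
proof (intro conjI allI impI)
  let ?d = "Suc e"
  have F: "tame e s F" using assms by (simp add: represents_def)
  then show "tame e s (\<lambda>\<theta>. F \<theta> * complete_sum ?d r \<theta>)" by (intro tame_mult tame_complete_sum)
  fix l assume l: "(\<Sum>j<?d. l j) = k - int r"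
  have "of_int (down ?d r \<Phi> l) =
    (\<Sum>\<alpha>\<in>compositions ?d r. torus_mean e s (\<lambda>\<theta>. F \<theta> * cis (- pairing ?d (\<lambda>j. l j + int (\<alpha> j)) \<theta>)))"
    unfolding down_def of_int_sum
  proof (intro sum.cong refl)
    fix \<alpha> assume \<alpha>: "\<alpha> \<in> compositions ?d r"
    have "(\<Sum>i<?d. l i + int (\<alpha> i)) = k"
      using \<alpha> l by (simp add: sum.distrib compositions_def of_nat_sum[symmetric] del: sum.lessThan_Suc of_nat_sum)
    then show "of_int (\<Phi> (\<lambda>j. l j + int (\<alpha> j))) = torus_mean e s (\<lambda>\<theta>. F \<theta> * cis (- pairing ?d (\<lambda>j. l j + int (\<alpha> j)) \<theta>))"
      using assms(2) unfolding represents_def by blast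
  qed
  also have "\<dots> = torus_mean e s (\<lambda>\<theta>. \<Sum>\<alpha>\<in>compositions ?d r. F \<theta> * cis (- pairing ?d (\<lambda>j. l j + int (\<alpha> j)) \<theta>))"
    by (rule torus_mean_sum[symmetric]) (intro tame_mult tame_cis_minus_pairing F assms(1))+
  also have "(\<lambda>\<theta>. \<Sum>\<alpha>\<in>compositions ?d r. F \<theta> * cis (- pairing ?d (\<lambda>j. l j + int (\<alpha> j)) \<theta>)) =
    (\<lambda>\<theta>. F \<theta> * complete_sum ?d r \<theta> * cis (- pairing ?d l \<theta>))"
    by (simp add: fun_eq_iff complete_sum_def sum_distrib_left sum_distrib_right mult.assoc cis_mult pairing_def
        distrib_right sum.distrib add.commute del: sum.lessThan_Suc)
  finally show "of_int (down ?d r \<Phi> l) = torus_mean e s (\<lambda>\<theta>. F \<theta> * complete_sum ?d r \<theta> * cis (- pairing ?d l \<theta>))" .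
qed

text \<open>With \<open>m = r * n\<close> the degree returns to that of the staircase, the vector at
  which the count is the value of the coefficient function.\<close>

lemma represents_power:
  assumes "s > 0"
  shows "represents e s (\<lambda>\<theta>. alternant (Suc e) \<theta> * power_sum (Suc e) \<theta> ^ m * complete_sum (Suc e) r \<theta> ^ n)
    ((down (Suc e) r ^^ n) ((up (Suc e) ^^ m) (alternating_delta (Suc e))))
    ((\<Sum>j<Suc e. staircase (Suc e) j) + int m - int (r * n))"
proof (induction n)
  case 0
  show ?case
  proof (induction m)
    case 0
    then show ?case using represents_alternating_delta[OF assms, of e] by (simp del: sum.lessThan_Suc)
  next
    case (Suc m)
    from represents_up[OF assms this] show ?case by (simp add: mult_ac add_ac del: sum.lessThan_Suc)
  qed
next
  case (Suc n)
  from represents_down[OF assms this, of r] show ?case by (simp add: mult_ac algebra_simps del: sum.lessThan_Suc)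
qed

lemma cnj_alternant:
  "cnj (alternant d \<theta>) = (\<Sum>\<sigma> | \<sigma> permutes {..<d}. of_int (sign \<sigma>) * cis (- pairing d (staircase d \<circ> \<sigma>) \<theta>))"
  by (simp add: alternant_def cis_cnj)

text \<open>Substituting \<open>x j = cis (- \<theta> j)\<close> reverses the staircase exponents, at the cost of a unimodular factor.\<close>

lemma norm_alternant: "cmod (alternant d \<theta>) = cmod (vandermonde_prod d (\<lambda>j. cis (\<theta> j)))"
proof -
  have "alternant d \<theta> = (\<Prod>j<d. cis (of_int (int d - 1) * \<theta> j)) *
    (\<Sum>\<sigma> | \<sigma> permutes {..<d}. of_int (sign \<sigma>) * (\<Prod>j<d. cis (- \<theta> j) ^ \<sigma> j))"
    unfolding alternant_def sum_distrib_left
  proof (intro sum.cong refl)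
    fix \<sigma>
    have "cis (pairing d (staircase d \<circ> \<sigma>) \<theta>) = (\<Prod>j<d. cis (of_int (staircase d (\<sigma> j)) * \<theta> j))"
      by (simp add: pairing_def cis_conv_exp exp_sum sum_distrib_left)
    also have "\<dots> = (\<Prod>j<d. cis (of_int (int d - 1) * \<theta> j) * cis (- \<theta> j) ^ \<sigma> j)"
      unfolding Complex.DeMoivre cis_mult by (intro prod.cong refl) (simp add: staircase_def algebra_simps)
    finally show "of_int (sign \<sigma>) * cis (pairing d (staircase d \<circ> \<sigma>) \<theta>) =
      (\<Prod>j<d. cis (of_int (int d - 1) * \<theta> j)) * (of_int (sign \<sigma>) * (\<Prod>j<d. cis (- \<theta> j) ^ \<sigma> j))"
      by (simp add: prod.distrib)
  qed
  then have "cmod (alternant d \<theta>) = cmod (vandermonde_prod d (\<lambda>j. cis (- \<theta> j)))"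
    unfolding sum_permutations_power by (simp add: norm_mult prod_norm[symmetric])
  also have "vandermonde_prod d (\<lambda>j. cis (- \<theta> j)) = cnj (vandermonde_prod d (\<lambda>j. cis (\<theta> j)))"
    by (simp add: vandermonde_prod_def cis_cnj)
  finally show ?thesis by simp
qed

text \<open>All permuted staircases have the same degree, so the coefficients there are represented
  by the same function; their signed sum assembles the conjugate alternant.\<close>

theorem avoiding_count_eq_torus_mean:
  assumes "s > 0"
  shows "of_nat (fact (Suc e) * avoiding_count (Suc (Suc e)) r n) =
    torus_mean e s (\<lambda>\<theta>. of_real ((cmod (vandermonde_prod (Suc e) (\<lambda>j. cis (\<theta> j))))\<^sup>2) *
      (power_sum (Suc e) \<theta> ^ r * complete_sum (Suc e) r \<theta>) ^ n)"
proof -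
  let ?d = "Suc e"
  let ?\<Phi> = "(down ?d r ^^ n) ((up ?d ^^ (r * n)) (alternating_delta ?d))"
  let ?F = "\<lambda>\<theta>. alternant ?d \<theta> * power_sum ?d \<theta> ^ (r * n) * complete_sum ?d r \<theta> ^ n"
  let ?S = "{\<sigma>. \<sigma> permutes {..<?d}}"
  have alt: "alternating ?d ?\<Phi>" by (intro alternating_down_power alternating_up_power)
  have F: "tame e s ?F"
    by (intro tame_mult tame_alternant tame_power tame_power_sum tame_complete_sum)
  have "of_nat (fact ?d * avoiding_count (Suc ?d) r n) = (of_int (fact ?d * int (avoiding_count (Suc ?d) r n)) :: complex)"
    by (simp del: fact_Suc)
  also have "\<dots> = (\<Sum>\<sigma>\<in>?S. of_int (sign \<sigma>) * of_int (?\<Phi> (staircase ?d \<circ> \<sigma>)))"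
    unfolding avoiding_count_eq_down_up alternating_symmetrize[OF alt] by simp
  also have "\<dots> = (\<Sum>\<sigma>\<in>?S. torus_mean e s (\<lambda>\<theta>. of_int (sign \<sigma>) * (?F \<theta> * cis (- pairing ?d (staircase ?d \<circ> \<sigma>) \<theta>))))"
  proof (intro sum.cong refl)
    fix \<sigma> assume "\<sigma> \<in> ?S"
    then have "(\<Sum>j<?d. (staircase ?d \<circ> \<sigma>) j) = (\<Sum>j<?d. staircase ?d j)"
      using sum.permute[of \<sigma> "{..<?d}" "staircase ?d"] by simp
    then have "of_int (?\<Phi> (staircase ?d \<circ> \<sigma>)) = torus_mean e s (\<lambda>\<theta>. ?F \<theta> * cis (- pairing ?d (staircase ?d \<circ> \<sigma>) \<theta>))"
      using represents_power[OF assms, of e "r * n" r n] unfolding represents_def by simp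
    then show "of_int (sign \<sigma>) * of_int (?\<Phi> (staircase ?d \<circ> \<sigma>)) =
      torus_mean e s (\<lambda>\<theta>. of_int (sign \<sigma>) * (?F \<theta> * cis (- pairing ?d (staircase ?d \<circ> \<sigma>) \<theta>)))"
      by (simp only: torus_mean_cmult)
  qed
  also have "\<dots> = torus_mean e s (\<lambda>\<theta>. \<Sum>\<sigma>\<in>?S. of_int (sign \<sigma>) * (?F \<theta> * cis (- pairing ?d (staircase ?d \<circ> \<sigma>) \<theta>)))"
    by (rule torus_mean_sum[symmetric]) (intro tame_mult tame_const tame_cis_minus_pairing F assms)+
  also have "(\<lambda>\<theta>. \<Sum>\<sigma>\<in>?S. of_int (sign \<sigma>) * (?F \<theta> * cis (- pairing ?d (staircase ?d \<circ> \<sigma>) \<theta>))) =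
    (\<lambda>\<theta>. of_real ((cmod (vandermonde_prod ?d (\<lambda>j. cis (\<theta> j))))\<^sup>2) * (power_sum ?d \<theta> ^ r * complete_sum ?d r \<theta>) ^ n)"
  proof
    fix \<theta>
    have "(\<Sum>\<sigma>\<in>?S. of_int (sign \<sigma>) * (?F \<theta> * cis (- pairing ?d (staircase ?d \<circ> \<sigma>) \<theta>))) = ?F \<theta> * cnj (alternant ?d \<theta>)"
      unfolding cnj_alternant sum_distrib_left by (simp add: mult_ac)
    also have "\<dots> = (alternant ?d \<theta> * cnj (alternant ?d \<theta>)) * (power_sum ?d \<theta> ^ r * complete_sum ?d r \<theta>) ^ n"
      by (simp add: power_mult_distrib power_mult[symmetric] mult_ac)
    also have "alternant ?d \<theta> * cnj (alternant ?d \<theta>) = of_real ((cmod (vandermonde_prod ?d (\<lambda>j. cis (\<theta> j))))\<^sup>2)"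
      unfolding norm_alternant[symmetric] complex_norm_square ..
    finally show "(\<Sum>\<sigma>\<in>?S. of_int (sign \<sigma>) * (?F \<theta> * cis (- pairing ?d (staircase ?d \<circ> \<sigma>) \<theta>))) =
      of_real ((cmod (vandermonde_prod ?d (\<lambda>j. cis (\<theta> j))))\<^sup>2) * (power_sum ?d \<theta> ^ r * complete_sum ?d r \<theta>) ^ n" .
  qed
  finally show ?thesis .
qed

section \<open>Laplace's method\<close>

lemma cis_quadratic_approx: "cmod (cis x - (1 + \<i> * x - x\<^sup>2 / 2)) \<le> \<bar>x\<bar> ^ 3 / 6"
  using iexp_approx1[of x 2]
  by (simp add: cis_conv_exp atMost_nat_numeral atMost_Suc power_mult_distrib fact_numeral algebra_simps
      eval_nat_numeral)

lemma exp_minus_linear_approx: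
  assumes "u \<ge> (0::real)" shows "\<bar>exp (- u) - (1 - u)\<bar> \<le> u\<^sup>2"
proof -
  have "exp (- u) \<le> 1 / (1 + u)"
    using exp_ge_add_one_self[of u] assms by (simp add: exp_minus field_simps)
  also have "\<dots> \<le> 1 - u + u\<^sup>2"
  proof -
    have "(1 - u + u\<^sup>2) * (1 + u) = 1 + u ^ 3" by (simp add: algebra_simps power2_eq_square power3_eq_cube)
    also have "\<dots> \<ge> 1" using assms by simp
    finally show ?thesis using assms by (simp add: pos_divide_le_eq)
  qed
  finally show ?thesis using exp_ge_add_one_self[of "- u"] by linarith
qed

text \<open>The central limit theorem for the uniform distribution on a finite family with mean
  zero, in terms of characteristic functions. The mean \<open>z n\<close> differs from
  \<open>1 - u n\<close> by a term of order \<open>n\<close> to the power \<open>- 3 / 2\<close>.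
  Powers of numbers in the unit disc differ by at most \<open>n\<close> times the difference of the
  bases, so \<open>z n\<close> may be compared with \<open>exp (- u n)\<close>.\<close>

lemma mean_cis_power_tendsto:
  fixes a :: "'a \<Rightarrow> real"
  assumes A: "finite A" "A \<noteq> {}" and mean: "(\<Sum>i\<in>A. a i) = 0" and c: "c > 0"
  shows "(\<lambda>n. ((\<Sum>i\<in>A. cis (a i / sqrt (c * real n))) / of_nat (card A)) ^ n)
    \<longlonglongrightarrow> of_real (exp (- ((\<Sum>i\<in>A. (a i)\<^sup>2) / real (card A)) / (2 * c)))"
proof -
  define N where "N = real (card A)"
  have N: "N > 0" using A by (simp add: N_def card_gt_0_iff)
  define Q where "Q = (\<Sum>i\<in>A. (a i)\<^sup>2) / N"
  define B where "B = (\<Sum>i\<in>A. \<bar>a i\<bar> ^ 3 / 6) / N"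
  define s where "s n = sqrt (c * real n)" for n
  define z where "z n = (\<Sum>i\<in>A. cis (a i / s n)) / of_real N" for n
  define u where "u n = Q / (2 * c) / real n" for n
  have Q0: "Q \<ge> 0" using N by (auto simp: Q_def intro!: divide_nonneg_nonneg sum_nonneg)
  have u0: "u n \<ge> 0" for n using Q0 c by (simp add: u_def)
  have z1: "cmod (z n) \<le> 1" for n
  proof -
    have "cmod (\<Sum>i\<in>A. cis (a i / s n)) \<le> (\<Sum>i\<in>A. 1)" by (rule sum_norm_le) simp
    then show ?thesis using N by (simp add: z_def norm_divide N_def)
  qed
  have zu: "cmod (z n - (1 - u n)) \<le> B / s n ^ 3" if "n > 0" for n
  proof -
    have s: "s n > 0" "(s n)\<^sup>2 = c * real n" using that c by (auto simp: s_def)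
    have "(\<Sum>i\<in>A. 1 + \<i> * of_real (a i / s n) - of_real ((a i / s n)\<^sup>2 / 2)) =
      of_real (N - (\<Sum>i\<in>A. (a i)\<^sup>2) / (s n)\<^sup>2 / 2)"
    proof -
      have "(\<Sum>i\<in>A. \<i> * of_real (a i / s n)) = \<i> * of_real ((\<Sum>i\<in>A. a i) / s n)"
        by (simp only: of_real_sum sum_distrib_left sum_divide_distrib)
      then have "(\<Sum>i\<in>A. \<i> * of_real (a i / s n)) = 0" using mean by simp
      moreover have "(\<Sum>i\<in>A. (a i / s n)\<^sup>2 / 2) = (\<Sum>i\<in>A. (a i)\<^sup>2) / (s n)\<^sup>2 / 2"
        by (simp add: power_divide sum_divide_distrib)
      ultimately show ?thesis
        by (simp only: sum_subtractf sum.distrib of_real_sum[symmetric] of_real_diff) (simp add: N_def)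
    qed
    also have "\<dots> = of_real N * (1 - of_real (u n))"
      using N s by (simp add: u_def Q_def field_simps)
    finally have "z n - (1 - u n) =
      (\<Sum>i\<in>A. cis (a i / s n) - (1 + \<i> * of_real (a i / s n) - of_real ((a i / s n)\<^sup>2 / 2))) / of_real N"
      using N by (simp only: sum_subtractf z_def) (simp add: field_simps)
    also have "cmod \<dots> = cmod (\<Sum>i\<in>A. cis (a i / s n) - (1 + \<i> * of_real (a i / s n) - of_real ((a i / s n)\<^sup>2 / 2))) / N"
      using N by (simp add: norm_divide)
    also have "\<dots> \<le> (\<Sum>i\<in>A. \<bar>a i / s n\<bar> ^ 3 / 6) / N"
    proof (intro divide_right_mono sum_norm_le)
      show "cmod (cis (a i / s n) - (1 + \<i> * of_real (a i / s n) - of_real ((a i / s n)\<^sup>2 / 2))) \<le> \<bar>a i / s n\<bar> ^ 3 / 6" for i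
        using cis_quadratic_approx[of "a i / s n"] by simp
    qed (use N in auto)
    also have "\<dots> = B / s n ^ 3"
      using s by (simp add: B_def power_divide sum_divide_distrib mult_ac)
    finally show ?thesis .
  qed
  have diff: "cmod (z n ^ n - of_real (exp (- Q / (2 * c)))) \<le> B * (real n / s n ^ 3) + (Q / (2 * c))\<^sup>2 * (real n * (1 / real n)\<^sup>2)" if "n > 0" for n
  proof -
    have "exp (- u n) ^ n = exp (- Q / (2 * c))"
      using that by (simp add: exp_of_nat_mult[symmetric] u_def)
    then have w: "of_real (exp (- Q / (2 * c))) = (of_real (exp (- u n)) :: complex) ^ n"
      by (simp only: of_real_power[symmetric])
    have "cmod (z n ^ n - of_real (exp (- u n)) ^ n) \<le> real n * cmod (z n - of_real (exp (- u n)))"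
      by (rule norm_power_diff) (use z1 u0 in auto)
    also have "cmod (z n - of_real (exp (- u n))) \<le> cmod (z n - (1 - u n)) + cmod (of_real (exp (- u n) - (1 - u n)))"
      by (rule order_trans[OF _ norm_triangle_ineq4]) simp
    also have "\<dots> \<le> B / s n ^ 3 + (u n)\<^sup>2"
      using zu[OF that] exp_minus_linear_approx[OF u0[of n]] unfolding norm_of_real by (rule add_mono)
    finally show ?thesis unfolding w
      using that by (simp add: u_def algebra_simps power_divide)
  qed
  have "(\<lambda>n. real n / s n ^ 3) \<longlonglongrightarrow> 0" unfolding s_def using c by real_asymp
  moreover have "(\<lambda>n. real n * (1 / real n)\<^sup>2) \<longlonglongrightarrow> 0" by real_asymp
  ultimately have "(\<lambda>n. B * (real n / s n ^ 3) + (Q / (2 * c))\<^sup>2 * (real n * (1 / real n)\<^sup>2)) \<longlonglongrightarrow> B * 0 + (Q / (2 * c))\<^sup>2 * 0"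
    by (intro tendsto_intros)
  then have "(\<lambda>n. B * (real n / s n ^ 3) + (Q / (2 * c))\<^sup>2 * (real n * (1 / real n)\<^sup>2)) \<longlonglongrightarrow> 0" by simp
  then have "(\<lambda>n. z n ^ n - of_real (exp (- Q / (2 * c)))) \<longlonglongrightarrow> 0"
    by (rule tendsto_0_le[where K = 1])
      (use diff in \<open>auto intro!: eventually_sequentiallyI[of 1] order_trans[OF _ abs_ge_self]\<close>)
  then have "(\<lambda>n. z n ^ n) \<longlonglongrightarrow> of_real (exp (- Q / (2 * c)))"
    by (simp add: LIM_zero_iff)
  then show ?thesis by (simp add: z_def s_def Q_def N_def)
qed

text \<open>Moving one unit from part \<open>j\<close> to part \<open>i\<close> matches the nonzero terms of both sides. Expanded,
  the identity relates the second moment of a part to the mixed second moments.\<close>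

lemma compositions_shift:
  assumes ij: "i < d" "j < d" "i \<noteq> j"
  shows "(\<Sum>\<alpha>\<in>compositions d r. (real (\<alpha> i) + 1) * real (\<alpha> i) * real (\<alpha> j)) =
    (\<Sum>\<alpha>\<in>compositions d r. real (\<alpha> i) * (real (\<alpha> i) - 1) * (real (\<alpha> j) + 1))"
proof -
  have split: "(\<Sum>k<d. f k) = f i + (f j + (\<Sum>k\<in>{..<d} - {i} - {j}. f k))" for f :: "nat \<Rightarrow> nat"
    using ij by (simp add: sum.remove[of "{..<d}" i] sum.remove[of "{..<d} - {i}" j])
  have mem: "\<alpha>(k := Suc (\<alpha> k), l := \<alpha> l - 1) \<in> compositions d r"
    if "\<alpha> \<in> compositions d r" "\<alpha> l > 0" "(k = i \<and> l = j) \<or> (k = j \<and> l = i)" for \<alpha> k l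
  proof -
    have "(\<Sum>m\<in>{..<d} - {i} - {j}. (\<alpha>(k := Suc (\<alpha> k), l := \<alpha> l - 1)) m) = (\<Sum>m\<in>{..<d} - {i} - {j}. \<alpha> m)"
      using that by (intro sum.cong) auto
    then have "(\<Sum>m<d. (\<alpha>(k := Suc (\<alpha> k), l := \<alpha> l - 1)) m) = (\<Sum>m<d. \<alpha> m)"
      unfolding split using that ij by auto
    then show ?thesis using that ij by (auto simp: compositions_def)
  qed
  have "(\<Sum>\<alpha>\<in>compositions d r. (real (\<alpha> i) + 1) * real (\<alpha> i) * real (\<alpha> j)) =
    (\<Sum>\<alpha>\<in>{\<alpha> \<in> compositions d r. \<alpha> j > 0}. (real (\<alpha> i) + 1) * real (\<alpha> i) * real (\<alpha> j))"
    by (rule sum.mono_neutral_right) (auto simp: finite_compositions)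
  also have "\<dots> = (\<Sum>\<alpha>\<in>{\<alpha> \<in> compositions d r. \<alpha> i > 0}. real (\<alpha> i) * (real (\<alpha> i) - 1) * (real (\<alpha> j) + 1))"
    by (rule sum.reindex_bij_witness[where j = "\<lambda>\<alpha>. \<alpha>(i := Suc (\<alpha> i), j := \<alpha> j - 1)" and i = "\<lambda>\<alpha>. \<alpha>(j := Suc (\<alpha> j), i := \<alpha> i - 1)"])
      (use ij mem in \<open>auto simp: fun_upd_twist of_nat_diff\<close>)
  also have "\<dots> = (\<Sum>\<alpha>\<in>compositions d r. real (\<alpha> i) * (real (\<alpha> i) - 1) * (real (\<alpha> j) + 1))"
    by (rule sum.mono_neutral_left) (auto simp: finite_compositions)
  finally show ?thesis .
qed

text \<open>Symmetry gives the means. Expanding the shift identity yields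
  \<open>M i i - S i = 2 * M i j\<close>, which forces all mixed moments to be one number
  \<open>T\<close>; the square of the fixed total \<open>r\<close> then determines
  \<open>T\<close>.\<close>

lemma compositions_moments:
  fixes d r :: nat
  assumes d: "d \<ge> 2"
  defines "N \<equiv> real (card (compositions d r))"
  shows "i < d \<Longrightarrow> (\<Sum>\<alpha>\<in>compositions d r. real (\<alpha> i)) = N * r / d"
    and "i < d \<Longrightarrow> j < d \<Longrightarrow> i \<noteq> j \<Longrightarrow>
      (\<Sum>\<alpha>\<in>compositions d r. real (\<alpha> i) * real (\<alpha> j)) = N * r * (real r - 1) / (d * (d + 1))"
    and "i < d \<Longrightarrow>
      (\<Sum>\<alpha>\<in>compositions d r. (real (\<alpha> i))\<^sup>2) = 2 * (N * r * (real r - 1) / (d * (d + 1))) + N * r / d"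
proof -
  define S where "S i = (\<Sum>\<alpha>\<in>compositions d r. real (\<alpha> i))" for i
  define M where "M i j = (\<Sum>\<alpha>\<in>compositions d r. real (\<alpha> i) * real (\<alpha> j))" for i j
  have tot: "(\<Sum>i<d. real (\<alpha> i)) = real r" if "\<alpha> \<in> compositions d r" for \<alpha>
    using that by (simp add: compositions_def flip: of_nat_sum)
  have Seq: "S i = S 0" if "i < d" for i
    unfolding S_def
    by (rule sum.reindex_bij_witness[where i = "\<lambda>\<alpha>. \<alpha> \<circ> Transposition.transpose 0 i" and j = "\<lambda>\<alpha>. \<alpha> \<circ> Transposition.transpose 0 i"])
      (use that d in \<open>auto intro!: compositions_permute permutes_swap_id simp: comp_assoc\<close>)
  have "(\<Sum>i<d. S i) = (\<Sum>\<alpha>\<in>compositions d r. \<Sum>i<d. real (\<alpha> i))"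
    unfolding S_def by (rule sum.swap)
  also have "\<dots> = N * r" using tot by (simp add: N_def)
  finally have "(\<Sum>i<d. S i) = N * r" .
  moreover have "(\<Sum>i<d. S i) = (\<Sum>i<d. S 0)" by (intro sum.cong refl Seq) simp
  ultimately have "S 0 = N * r / d" using d by (simp add: field_simps)
  then have S: "S i = N * r / d" if "i < d" for i using Seq[OF that] by simp
  have Mii: "M i i - S i = 2 * M i j" if "i < d" "j < d" "i \<noteq> j" for i j
    using compositions_shift[OF that, of r]
    by (simp add: M_def S_def algebra_simps sum.distrib sum_subtractf power2_eq_square)
  have sym: "M i j = M j i" for i j by (simp add: M_def mult.commute)
  define T where "T = M 0 1"
  have M0: "M 0 j = T" if "j < d" "j \<noteq> 0" for j
    using Mii[of 0 1] Mii[of 0 j] that d by (simp add: T_def)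
  have MT: "M i j = T" if "i < d" "j < d" "i \<noteq> j" for i j
  proof (cases "i = 0")
    case False
    then have "2 * M i j = 2 * M i 0" using Mii[of i j] Mii[of i 0] that d by auto
    then show ?thesis using M0[of i] sym[of i 0] False that by simp
  qed (use M0 that in auto)
  have MD: "M i i = 2 * T + S i" if "i < d" for i
  proof -
    have "\<exists>j<d. j \<noteq> i" using d by (intro exI[of _ "if i = 0 then 1 else 0"]) auto
    then obtain j where "j < d" "j \<noteq> i" by blast
    then show ?thesis using Mii[of i j] MT[of i j] that by simp
  qed
  have "(\<Sum>i<d. \<Sum>j<d. M i j) = (\<Sum>\<alpha>\<in>compositions d r. (\<Sum>i<d. real (\<alpha> i)) * (\<Sum>j<d. real (\<alpha> j)))"
    unfolding M_def sum_product by (subst sum.swap, subst sum.swap[of _ "{..<d}" "compositions d r"]) (simp add: sum.swap[of _ "{..<d}" "compositions d r"])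
  also have "\<dots> = N * r\<^sup>2" using tot by (simp add: N_def power2_eq_square)
  also have "(\<Sum>i<d. \<Sum>j<d. M i j) = (\<Sum>i<d. (\<Sum>j<d. T) + (T + N * r / d))"
  proof (intro sum.cong refl)
    fix i assume i: "i \<in> {..<d}"
    have "(\<Sum>j<d. M i j) = (\<Sum>j<d. T + (if j = i then T + N * r / d else 0))"
      by (intro sum.cong) (use i MT MD S in auto)
    then show "(\<Sum>j<d. M i j) = (\<Sum>j<d. T) + (T + N * r / d)" using i by (simp add: sum.distrib)
  qed
  finally have "real d * (real d * T + (T + N * r / d)) = N * r\<^sup>2" by simp
  moreover have "real d * (real d * T + (T + N * r / d)) = T * (real d * (d + 1)) + N * r"
    using d by (simp add: algebra_simps)
  ultimately have e1: "T * (real d * (d + 1)) = N * r * (real r - 1)"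
    by (simp add: algebra_simps power2_eq_square)
  have e2: "real d * real (d + 1) \<noteq> 0" using d by simp
  have T: "T = N * r * (real r - 1) / (d * (d + 1))"
    using nonzero_eq_divide_eq[THEN iffD2, OF e2 e1] by (simp add: distrib_left)
  show "i < d \<Longrightarrow> (\<Sum>\<alpha>\<in>compositions d r. real (\<alpha> i)) = N * r / d" using S S_def by simp
  show "i < d \<Longrightarrow> j < d \<Longrightarrow> i \<noteq> j \<Longrightarrow>
      (\<Sum>\<alpha>\<in>compositions d r. real (\<alpha> i) * real (\<alpha> j)) = N * r * (real r - 1) / (d * (d + 1))"
    using MT[of i j] T by (simp add: M_def)
  show "i < d \<Longrightarrow>
      (\<Sum>\<alpha>\<in>compositions d r. (real (\<alpha> i))\<^sup>2) = 2 * (N * r * (real r - 1) / (d * (d + 1))) + N * r / d"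
    using MD[of i] S[of i] T by (simp add: M_def power2_eq_square)
qed

text \<open>The second moment matrix is \<open>T\<close> everywhere plus
  \<open>T + N * r / d\<close> on the diagonal. The constant part vanishes on vectors of sum zero,
  so the form is a multiple of the sum of squares.\<close>

lemma compositions_linear_form:
  fixes x :: "nat \<Rightarrow> real"
  assumes d: "d \<ge> 2" and x: "(\<Sum>j<d. x j) = 0"
  shows "(\<Sum>\<alpha>\<in>compositions d r. \<Sum>j<d. real (\<alpha> j) * x j) = 0"
    and "(\<Sum>\<alpha>\<in>compositions d r. (\<Sum>j<d. real (\<alpha> j) * x j)\<^sup>2) / real (card (compositions d r)) =
      real r * (real r + d) / (d * (d + 1)) * (\<Sum>j<d. (x j)\<^sup>2)"
proof -
  let ?C = "compositions d r"
  define N where "N = real (card ?C)"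
  have "N > 0" using d by (simp add: N_def card_compositions zero_less_binomial_iff)
  define T where "T = N * r * (real r - 1) / (d * (d + 1))"
  have "(\<Sum>\<alpha>\<in>?C. \<Sum>j<d. real (\<alpha> j) * x j) = (\<Sum>j<d. (\<Sum>\<alpha>\<in>?C. real (\<alpha> j)) * x j)"
    by (subst sum.swap) (simp add: sum_distrib_right)
  also have "\<dots> = (\<Sum>j<d. N * r / d * x j)"
    using compositions_moments(1)[OF d, of _ r] by (intro sum.cong) (auto simp: N_def)
  also have "\<dots> = N * r / d * (\<Sum>j<d. x j)" by (rule sum_distrib_left[symmetric])
  also have "\<dots> = 0" using x by simp
  finally show "(\<Sum>\<alpha>\<in>?C. \<Sum>j<d. real (\<alpha> j) * x j) = 0" .
  have "(\<Sum>\<alpha>\<in>?C. (\<Sum>j<d. real (\<alpha> j) * x j)\<^sup>2) =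
    (\<Sum>\<alpha>\<in>?C. \<Sum>i<d. \<Sum>j<d. (real (\<alpha> i) * real (\<alpha> j)) * (x i * x j))"
    by (simp add: power2_eq_square sum_product mult_ac)
  also have "\<dots> = (\<Sum>i<d. \<Sum>j<d. (\<Sum>\<alpha>\<in>?C. real (\<alpha> i) * real (\<alpha> j)) * (x i * x j))"
    unfolding sum_distrib_right by (subst sum.swap) (intro sum.cong refl sum.swap)
  also have "\<dots> = (\<Sum>i<d. \<Sum>j<d. T * (x i * x j) + (if j = i then (T + N * r / d) * (x i)\<^sup>2 else 0))"
  proof (intro sum.cong refl)
    fix i j assume ij: "i \<in> {..<d}" "j \<in> {..<d}"
    show "(\<Sum>\<alpha>\<in>?C. real (\<alpha> i) * real (\<alpha> j)) * (x i * x j) =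
      T * (x i * x j) + (if j = i then (T + N * r / d) * (x i)\<^sup>2 else 0)"
    proof (cases "j = i")
      case True
      have "(\<Sum>\<alpha>\<in>?C. real (\<alpha> i) * real (\<alpha> i)) = 2 * T + N * r / d"
        using compositions_moments(3)[OF d, of i r] ij by (simp add: power2_eq_square T_def N_def)
      then show ?thesis using True by (simp add: power2_eq_square distrib_right)
    next
      case False
      then have "(\<Sum>\<alpha>\<in>?C. real (\<alpha> i) * real (\<alpha> j)) = T"
        using compositions_moments(2)[OF d, of i j r] ij by (simp add: T_def N_def)
      then show ?thesis using False by simp
    qed
  qed
  also have "\<dots> = T * ((\<Sum>i<d. x i) * (\<Sum>j<d. x j)) + (T + N * r / d) * (\<Sum>i<d. (x i)\<^sup>2)"
  proof -
    have "(\<Sum>i<d. \<Sum>j<d. T * (x i * x j)) = T * ((\<Sum>i<d. x i) * (\<Sum>j<d. x j))"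
      unfolding sum_product by (simp only: sum_distrib_left)
    then show ?thesis by (simp add: sum.distrib sum_distrib_left[of "T + _"])
  qed
  also have "\<dots> = N * (real r * (real r + d) / (d * (d + 1))) * (\<Sum>i<d. (x i)\<^sup>2)"
  proof -
    have "T + N * r / d = N * (real r * (real r + d) / (d * (d + 1)))"
    proof -
      have "N * r / d = N * r * (real d + 1) / (real d * (real d + 1))"
        by (rule mult_divide_mult_cancel_right[symmetric]) simp
      then show ?thesis unfolding T_def by (simp add: add_divide_distrib[symmetric] algebra_simps)
    qed
    then show ?thesis using x by simp
  qed
  finally show "(\<Sum>\<alpha>\<in>?C. (\<Sum>j<d. real (\<alpha> j) * x j)\<^sup>2) / real (card ?C) =
      real r * (real r + d) / (d * (d + 1)) * (\<Sum>j<d. (x j)\<^sup>2)"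
    using \<open>N > 0\<close> by (simp add: N_def)
qed

text \<open>The central limit theorem is applied to the power sum, where it counts \<open>r\<close>
  times, and to the complete sum. The total variance is \<open>c\<close> times the sum of squares of
  the centred variables, and the scaling by \<open>sqrt (c * n)\<close> leaves exactly the weight of
  the reduced Mehta integral.\<close>

lemma generating_power_tendsto:
  fixes r e :: nat and y :: "nat \<Rightarrow> real" and c :: real
  defines "d \<equiv> Suc e"
  defines "c \<equiv> real r * (2 * d + r + 1) / (d * (d + 1))"
  assumes "e \<ge> 1" "r \<ge> 1"
  shows "(\<lambda>n. ((power_sum d (torus_angle e (sqrt (c * n)) y)) ^ r * complete_sum d r (torus_angle e (sqrt (c * n)) y)
      / of_nat (d ^ r * card (compositions d r))) ^ n)
    \<longlonglongrightarrow> of_real (exp (- gap_energy d (y(e := 0)) / (2 * d)))"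
proof -
  have d2: "d \<ge> 2" using assms by simp
  have c0: "c > 0" using assms unfolding c_def by simp
  define x where "x = y(e := 0)"
  define m where "m = (\<Sum>j<d. x j) / d"
  \<comment> \<open>Centring gives the mean zero that the limit lemma requires. By homogeneity it
    multiplies the \<open>r\<close>-th power of the power sum by a phase and the complete sum by the
    inverse phase.\<close>
  define b where "b j = x j - m" for j
  have b0: "(\<Sum>j<d. b j) = 0" using d2 by (simp add: b_def sum_subtractf m_def)
  let ?C = "compositions d r"
  have cardC: "card ?C > 0" using d2 by (simp add: card_compositions zero_less_binomial_iff)
  define P where "P n = (\<Sum>j<d. cis (b j / sqrt (c * real n))) / of_nat (card {..<d})" for n
  define H where "H n = (\<Sum>\<alpha>\<in>?C. cis (- (\<Sum>j<d. real (\<alpha> j) * b j) / sqrt (c * real n))) / of_nat (card ?C)" for n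
  have eq: "(power_sum d (torus_angle e (sqrt (c * n)) y)) ^ r * complete_sum d r (torus_angle e (sqrt (c * n)) y)
      / of_nat (d ^ r * card ?C) = P n ^ r * H n" for n
  proof -
    define s where "s = sqrt (c * n)"
    have th: "torus_angle e s y j = x j / s" for j by (simp add: torus_angle_def x_def)
    have "power_sum d (torus_angle e s y) = cis (m / s) * (\<Sum>j<d. cis (b j / s))"
      unfolding power_sum_def sum_distrib_left cis_mult th
      by (simp add: b_def diff_divide_distrib)
    moreover have "complete_sum d r (torus_angle e s y) = cis (- (real r * (m / s))) * (\<Sum>\<alpha>\<in>?C. cis (- (\<Sum>j<d. real (\<alpha> j) * b j) / s))"
      unfolding complete_sum_def sum_distrib_left cis_mult
    proof (intro sum.cong refl arg_cong[of _ _ cis])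
      fix \<alpha> assume "\<alpha> \<in> ?C"
      then have "(\<Sum>j<d. real (\<alpha> j)) = real r" by (simp add: compositions_def flip: of_nat_sum)
      then have "real r * (m / s) + (\<Sum>j<d. real (\<alpha> j) * b j) / s = (\<Sum>j<d. real (\<alpha> j) * x j) / s"
        by (simp add: b_def right_diff_distrib sum_subtractf diff_divide_distrib sum_distrib_right[symmetric])
      then show "- pairing d (\<lambda>j. int (\<alpha> j)) (torus_angle e s y) = - (real r * (m / s)) + - (\<Sum>j<d. real (\<alpha> j) * b j) / s"
        by (simp add: pairing_def th sum_divide_distrib)
    qed
    moreover have "cis (m / s) ^ r * cis (- (real r * (m / s))) = 1" by (simp add: Complex.DeMoivre cis_mult)
    ultimately show ?thesis
      unfolding s_def[symmetric] P_def H_def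
      by (simp add: power_mult_distrib power_divide mult_ac) 
  qed
  have "(\<lambda>n. P n ^ n) \<longlonglongrightarrow> of_real (exp (- ((\<Sum>j<d. (b j)\<^sup>2) / real (card {..<d})) / (2 * c)))"
    unfolding P_def by (rule mean_cis_power_tendsto) (use b0 c0 d2 in \<open>auto simp: lessThan_empty_iff\<close>)
  moreover have "(\<lambda>n. H n ^ n) \<longlonglongrightarrow> of_real (exp (- ((\<Sum>\<alpha>\<in>?C. (- (\<Sum>j<d. real (\<alpha> j) * b j))\<^sup>2) / real (card ?C)) / (2 * c)))"
    unfolding H_def
    by (rule mean_cis_power_tendsto) (use compositions_linear_form(1)[OF d2 b0, of r] c0 cardC in \<open>auto simp: finite_compositions sum_negf card_gt_0_iff\<close>)
  ultimately have "(\<lambda>n. (P n ^ n) ^ r * H n ^ n) \<longlonglongrightarrow>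
    of_real (exp (- ((\<Sum>j<d. (b j)\<^sup>2) / real (card {..<d})) / (2 * c))) ^ r *
    of_real (exp (- ((\<Sum>\<alpha>\<in>?C. (- (\<Sum>j<d. real (\<alpha> j) * b j))\<^sup>2) / real (card ?C)) / (2 * c)))"
    by (intro tendsto_intros)
  also have "(\<lambda>n. (P n ^ n) ^ r * H n ^ n) = (\<lambda>n. (P n ^ r * H n) ^ n)"
    by (simp add: power_mult_distrib power_mult[symmetric] mult.commute)
  also have "of_real (exp (- ((\<Sum>j<d. (b j)\<^sup>2) / real (card {..<d})) / (2 * c))) ^ r *
    of_real (exp (- ((\<Sum>\<alpha>\<in>?C. (- (\<Sum>j<d. real (\<alpha> j) * b j))\<^sup>2) / real (card ?C)) / (2 * c))) =
    (of_real (exp (- (\<Sum>j<d. (b j)\<^sup>2) / 2)) :: complex)"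
  proof -
    define q where "q = (\<Sum>j<d. (b j)\<^sup>2)"
    have qc: "(\<Sum>\<alpha>\<in>?C. (- (\<Sum>j<d. real (\<alpha> j) * b j))\<^sup>2) / real (card ?C) = real r * (real r + d) / (d * (d + 1)) * q"
      using compositions_linear_form(2)[OF d2 b0, of r] by (simp add: q_def)
    have "real r * (q / d) + real r * (real r + d) / (d * (d + 1)) * q = c * q"
    proof -
      define D where "D = real d * (real d + 1)"
      have "real r * (q / d) = real r * (real d + 1) * q / D" using d2 by (simp add: D_def)
      moreover have "real r * (real r + d) / (d * (d + 1)) = real r * (real r + d) / D" "c = real r * (2 * d + r + 1) / D"
        by (simp_all add: D_def c_def distrib_left)
      moreover have "real d + real d * real d = D" by (simp add: D_def distrib_left)
      ultimately show ?thesis by (simp add: add_divide_distrib[symmetric] algebra_simps)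
    qed
    moreover have "real r * (- (q / d) / (2 * c)) + - p / (2 * c) = - (real r * (q / d) + p) / (2 * c)" for p
      by (simp add: add_divide_distrib diff_divide_distrib)
    ultimately have "real r * (- (q / d) / (2 * c)) + - (real r * (real r + d) / (d * (d + 1)) * q) / (2 * c) = - (c * q) / (2 * c)"
      by (simp only:)
    also have "\<dots> = - q / 2" using c0 by simp
    finally have "real r * (- (q / d) / (2 * c)) + - (real r * (real r + d) / (d * (d + 1)) * q) / (2 * c) = - q / 2" .
    then have "exp (- (q / d) / (2 * c)) ^ r * exp (- (real r * (real r + d) / (d * (d + 1)) * q) / (2 * c)) = exp (- q / 2)"
      by (simp only: exp_of_nat_mult[symmetric] exp_add[symmetric])
    then show ?thesis unfolding qc q_def[symmetric] by (simp only: card_lessThan of_real_power[symmetric] of_real_mult[symmetric])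
  qed
  also have "- (\<Sum>j<d. (b j)\<^sup>2) / 2 = - gap_energy d (y(e := 0)) / (2 * d)"
  proof -
    have "real d * (\<Sum>j<d. (b j)\<^sup>2) = gap_energy d b" using gap_energy_identity[of d b] b0 by simp
    also have "gap_energy d b = gap_energy d (y(e := 0))" by (rule gap_energy_cong) (simp add: b_def x_def)
    finally show ?thesis using d2 by (simp add: field_simps)
  qed
  finally show ?thesis unfolding eq by (simp only: of_nat_mult of_nat_numeral)
qed

section \<open>Bounds for dominated convergence\<close>

lemma cmod_cis_diff_sq: "(cmod (cis a - cis b))\<^sup>2 = (2 * sin ((a - b) / 2))\<^sup>2"
proof -
  have "(cmod (cis a - cis b))\<^sup>2 = (cos a - cos b)\<^sup>2 + (sin a - sin b)\<^sup>2"
    by (simp add: cmod_power2)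
  also have "\<dots> = 2 - 2 * (cos a * cos b + sin a * sin b)"
    using sin_cos_squared_add[of a] sin_cos_squared_add[of b] by (simp add: power2_eq_square algebra_simps)
  also have "\<dots> = 2 - 2 * cos (a - b)" by (simp add: cos_diff)
  also have "a - b = 2 * ((a - b) / 2)" by simp
  also have "2 - 2 * cos (2 * ((a - b) / 2)) = (2 * sin ((a - b) / 2))\<^sup>2" unfolding cos_double_sin by (simp add: power_mult_distrib)
  finally show ?thesis .
qed

text \<open>A chord is at most as long as its arc. The Vandermonde factor is thereby bounded by its
  own limit, for every scale \<open>s\<close>.\<close>

lemma scaled_cis_diff_le:
  assumes "s > 0" shows "(s * cmod (cis (a / s) - cis (b / s)))\<^sup>2 \<le> (a - b)\<^sup>2"
proof -
  have "(s * cmod (cis (a / s) - cis (b / s)))\<^sup>2 = (2 * s * sin ((a - b) / (2 * s)))\<^sup>2"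
    unfolding power_mult_distrib cmod_cis_diff_sq by (simp add: power_mult_distrib diff_divide_distrib mult_ac)
  also have "\<dots> \<le> (a - b)\<^sup>2"
  proof (rule abs_le_square_iff[THEN iffD1])
    have "2 * s * \<bar>sin ((a - b) / (2 * s))\<bar> \<le> 2 * s * \<bar>(a - b) / (2 * s)\<bar>"
      using assms by (intro mult_left_mono abs_sin_x_le_abs_x) auto
    then show "\<bar>2 * s * sin ((a - b) / (2 * s))\<bar> \<le> \<bar>a - b\<bar>" using assms by (simp add: abs_mult)
  qed
  finally show ?thesis .
qed

lemma scaled_cis_diff_tendsto:
  assumes "c > (0::real)"
  shows "(\<lambda>n. (sqrt (c * real n) * cmod (cis (a / sqrt (c * real n)) - cis (b / sqrt (c * real n))))\<^sup>2) \<longlonglongrightarrow> (a - b)\<^sup>2"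
proof -
  define u where "u = a - b"
  have eq: "(sqrt (c * real n) * cmod (cis (a / sqrt (c * real n)) - cis (b / sqrt (c * real n))))\<^sup>2 =
    (2 * sqrt (c * real n) * sin (u / (2 * sqrt (c * real n))))\<^sup>2" for n
    unfolding power_mult_distrib cmod_cis_diff_sq u_def by (simp add: power_mult_distrib diff_divide_distrib mult_ac)
  have "(\<lambda>n. 2 * sqrt (c * real n) * sin (u / (2 * sqrt (c * real n)))) \<longlonglongrightarrow> u"
  proof (cases "u = 0")
    case False
    have "((\<lambda>x::real. sin x / x) \<longlongrightarrow> 1) (at 0)" by real_asymp
    moreover have "filterlim (\<lambda>n. u / (2 * sqrt (c * real n))) (at 0) sequentially"
      unfolding filterlim_at
    proof
      show "(\<lambda>n. u / (2 * sqrt (c * real n))) \<longlonglongrightarrow> 0" using assms by real_asymp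
      show "\<forall>\<^sub>F n in sequentially. u / (2 * sqrt (c * real n)) \<in> UNIV \<and> u / (2 * sqrt (c * real n)) \<noteq> 0"
        using False assms by (intro eventually_sequentiallyI[of 1]) auto
    qed
    ultimately have "(\<lambda>n. sin (u / (2 * sqrt (c * real n))) / (u / (2 * sqrt (c * real n)))) \<longlonglongrightarrow> 1"
      by (rule filterlim_compose)
    then have "(\<lambda>n. u * (sin (u / (2 * sqrt (c * real n))) / (u / (2 * sqrt (c * real n))))) \<longlonglongrightarrow> u * 1"
      by (intro tendsto_intros)
    then show ?thesis using False by (simp add: field_simps)
  qed simp
  then show ?thesis unfolding eq u_def[symmetric] by (intro tendsto_intros)
qed

text \<open>The left side is compared with \<open>4 (sin (t / 2))^2\<close> by means of
  \<open>sin x >= x / 2\<close> for \<open>x\<close> between 0 and \<open>pi / 2\<close>, which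
  follows from the cubic Taylor bound and \<open>x^2 <= 3\<close>. The quadratic bound has to hold
  on the whole period, not just near 0.\<close>

lemma one_minus_cos_ge:
  assumes "\<bar>t\<bar> \<le> pi" shows "t\<^sup>2 / 4 \<le> 2 - 2 * cos t"
proof -
  define x where "x = \<bar>t\<bar> / 2"
  have x: "0 \<le> x" "x \<le> pi / 2" using assms by (auto simp: x_def)
  have "\<bar>sin x - (\<Sum>m<3. sin_coeff m * x ^ m)\<bar> \<le> inverse (fact 3) * \<bar>x\<bar> ^ 3" by (rule Maclaurin_sin_bound)
  moreover have "(\<Sum>m<3. sin_coeff m * x ^ m) = x" by (simp add: sin_coeff_def eval_nat_numeral)
  ultimately have "6 * \<bar>sin x - x\<bar> \<le> x ^ 3" using x by (simp add: fact_numeral field_simps)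
  moreover have "x - sin x \<le> \<bar>sin x - x\<bar>" by simp
  ultimately have "6 * (x - sin x) \<le> x ^ 3" by (meson mult_left_mono order_trans zero_le_numeral)
  then have "sin x \<ge> x - x ^ 3 / 6" by (simp add: field_simps)
  moreover have "x ^ 3 / 6 \<le> x / 2"
  proof -
    have "pi / 2 \<le> 1.7" using pi_approx by simp
    then have "x * x \<le> 1.7 * 1.7" using x by (intro mult_mono) auto
    then have "x * (x * x) \<le> x * 3" using x by (intro mult_left_mono) auto
    then show ?thesis by (simp add: power3_eq_cube mult_ac)
  qed
  ultimately have "x / 2 \<le> sin x" by simp
  then have "(x / 2)\<^sup>2 \<le> (sin x)\<^sup>2" using x by (intro power_mono) auto
  moreover have "(sin x)\<^sup>2 = (sin (t / 2))\<^sup>2" by (cases "t \<ge> 0") (auto simp: x_def)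
  moreover have "2 - 2 * cos t = 4 * (sin (t / 2))\<^sup>2" using cos_double_sin[of "t / 2"] by simp
  ultimately show ?thesis by (simp add: x_def power_divide)
qed

text \<open>The gap identity for cosines and sines expresses the squared modulus as
  \<open>d^2\<close> minus the sum of the squared chords over all pairs. The pairs with the last
  angle, which is 0, already subtract a quarter of the sum of squared angles. Then
  \<open>1 - u <= exp (- u)\<close> applies, and the square root turns the 4 into 8.\<close>

lemma power_sum_bound:
  assumes "\<And>j. j < e \<Longrightarrow> \<bar>\<theta> j\<bar> \<le> pi" "\<theta> e = 0"
  shows "cmod (power_sum (Suc e) \<theta>) \<le> real (Suc e) * exp (- (\<Sum>j<e. (\<theta> j)\<^sup>2) / (8 * (real (Suc e))\<^sup>2))"
proof -
  let ?d = "Suc e"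
  let ?q = "\<Sum>j<e. (\<theta> j)\<^sup>2"
  have "?q / 4 \<le> (\<Sum>j<e. (cos (\<theta> e) - cos (\<theta> j))\<^sup>2 + (sin (\<theta> e) - sin (\<theta> j))\<^sup>2)"
    unfolding sum_divide_distrib
  proof (rule sum_mono)
    fix j assume "j \<in> {..<e}"
    then have "(\<theta> j)\<^sup>2 / 4 \<le> 2 - 2 * cos (\<theta> j)" using assms(1) by (intro one_minus_cos_ge) auto
    also have "\<dots> = (cos (\<theta> e) - cos (\<theta> j))\<^sup>2 + (sin (\<theta> e) - sin (\<theta> j))\<^sup>2"
      using sin_cos_squared_add[of "\<theta> j"] assms(2) by (simp add: power2_eq_square algebra_simps)
    finally show "(\<theta> j)\<^sup>2 / 4 \<le> (cos (\<theta> e) - cos (\<theta> j))\<^sup>2 + (sin (\<theta> e) - sin (\<theta> j))\<^sup>2" .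
  qed
  also have "\<dots> \<le> gap_energy ?d (\<lambda>j. cos (\<theta> j)) + gap_energy ?d (\<lambda>j. sin (\<theta> j))"
    by (simp add: gap_energy_def sum.distrib add_nonneg_nonneg sum_nonneg)
  finally have gap: "?q / 4 \<le> gap_energy ?d (\<lambda>j. cos (\<theta> j)) + gap_energy ?d (\<lambda>j. sin (\<theta> j))" .
  have "(cmod (power_sum ?d \<theta>))\<^sup>2 = (\<Sum>j<?d. cos (\<theta> j))\<^sup>2 + (\<Sum>j<?d. sin (\<theta> j))\<^sup>2"
    by (simp add: cmod_power2 power_sum_def del: sum.lessThan_Suc)
  also have "\<dots> = real ?d * (\<Sum>j<?d. (cos (\<theta> j))\<^sup>2 + (sin (\<theta> j))\<^sup>2) -
     (gap_energy ?d (\<lambda>j. cos (\<theta> j)) + gap_energy ?d (\<lambda>j. sin (\<theta> j)))"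
    using gap_energy_identity[of ?d "\<lambda>j. cos (\<theta> j)"] gap_energy_identity[of ?d "\<lambda>j. sin (\<theta> j)"]
    unfolding sum.distrib distrib_left by linarith
  also have "\<dots> \<le> (real ?d)\<^sup>2 - ?q / 4" using gap by (simp add: power2_eq_square del: sum.lessThan_Suc)
  also have "\<dots> = (real ?d)\<^sup>2 * (1 + - (?q / (4 * (real ?d)\<^sup>2)))" by (simp add: field_simps)
  also have "\<dots> \<le> (real ?d)\<^sup>2 * exp (- (?q / (4 * (real ?d)\<^sup>2)))"
    by (intro mult_left_mono exp_ge_add_one_self) auto
  also have "\<dots> = (real ?d * exp (- ?q / (8 * (real ?d)\<^sup>2)))\<^sup>2"
    by (simp add: power_mult_distrib exp_double[symmetric])
  finally show ?thesis by (rule power2_le_imp_le) simp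
qed

lemma integrable_poly_gaussian:
  assumes "b > (0::real)"
  shows "integrable lborel (\<lambda>t. (1 + t\<^sup>2) ^ D * exp (- b * t\<^sup>2))"
proof -
  \<comment> \<open>The coefficient \<open>1 / (2 * b)\<close> undoes the substitution by
    \<open>sqrt (2 * b) * t\<close>, which turns the standard Gaussian into the required
    one.\<close>
  define p where "p = [:1, 0, 1 / (2 * b):] ^ D"
  have "integrable lborel (\<lambda>t. std_normal_density (0 + sqrt (2 * b) * t) * poly p (0 + sqrt (2 * b) * t))"
    using integrable_gauss_poly[of p] assms by (intro lborel_integrable_real_affine) auto
  then have "integrable lborel (\<lambda>t. sqrt (2 * pi) * (std_normal_density (0 + sqrt (2 * b) * t) * poly p (0 + sqrt (2 * b) * t)))"
    by (rule integrable_mult_right)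
  moreover have "(\<lambda>t. sqrt (2 * pi) * (std_normal_density (0 + sqrt (2 * b) * t) * poly p (0 + sqrt (2 * b) * t))) =
    (\<lambda>t. (1 + t\<^sup>2) ^ D * exp (- b * t\<^sup>2))"
    using assms by (simp add: p_def poly_power std_normal_density_def power_mult_distrib power2_eq_square[symmetric] mult.assoc[symmetric])
      (simp add: mult.commute)
  ultimately show ?thesis by (simp only:)
qed

text \<open>The dominating function. Each squared difference is at most twice the product
  \<open>Q\<close> of all \<open>1 + (x j)^2\<close>, so the whole is bounded by a product of
  functions of one variable each.\<close>

lemma integrable_vandermonde_gaussian:
  assumes "b > (0::real)"
  shows "integrable (Pi\<^sub>M {..<e} (\<lambda>_. lborel))
    (\<lambda>y. (vandermonde_prod (Suc e) (y(e := 0)))\<^sup>2 * exp (- b * (\<Sum>j<e. (y j)\<^sup>2)))"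
proof -
  let ?d = "Suc e"
  define D where "D = (\<Sum>j<?d. \<Sum>i<j. 1 :: nat)"
  let ?f = "\<lambda>y :: nat \<Rightarrow> real. (2::real) ^ D * (\<Prod>j<e. (1 + (y j)\<^sup>2) ^ D * exp (- b * (y j)\<^sup>2))"
  have int: "integrable (Pi\<^sub>M {..<e} (\<lambda>_. lborel)) ?f"
    by (intro integrable_mult_right lborel_prod.product_integrable_prod integrable_poly_gaussian assms) auto
  have meas: "(\<lambda>y. (vandermonde_prod ?d (y(e := 0)))\<^sup>2 * exp (- b * (\<Sum>j<e. (y j)\<^sup>2))) \<in> borel_measurable (Pi\<^sub>M {..<e} (\<lambda>_. lborel))"
    by (intro borel_measurable_times borel_measurable_power measurable_vandermonde_prod measurable_upd_coordinate
        measurable_compose[OF _ borel_measurable_exp] borel_measurable_const borel_measurable_sum) auto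
  have bound: "(vandermonde_prod ?d (y(e := 0)))\<^sup>2 * exp (- b * (\<Sum>j<e. (y j)\<^sup>2)) \<le> ?f y" for y :: "nat \<Rightarrow> real"
  proof -
    define x where "x = y(e := 0)"
    define Q where "Q = (\<Prod>j<?d. 1 + (x j)\<^sup>2)"
    have Q1: "1 + (x j)\<^sup>2 \<le> (\<Prod>k\<in>A. 1 + (x k)\<^sup>2)" if "j \<in> A" "finite A" for j A
      using that prod_ge_1[of "A - {j}" "\<lambda>k. 1 + (x k)\<^sup>2"]
        mult_left_mono[of 1 "\<Prod>k\<in>A - {j}. 1 + (x k)\<^sup>2" "1 + (x j)\<^sup>2"]
      by (subst prod.remove[OF that(2,1)]) (auto simp: add_nonneg_nonneg)
    have pair: "(x j - x i)\<^sup>2 \<le> 2 * Q" if "j < ?d" "i < j" for i j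
    proof -
      have "(x j - x i)\<^sup>2 \<le> 2 * ((1 + (x j)\<^sup>2) * (1 + (x i)\<^sup>2))"
        using sum_squares_ge_zero[of "x j + x i" 0] zero_le_power2[of "x j * x i"]
        by (simp add: power2_eq_square algebra_simps)
      also have "(1 + (x j)\<^sup>2) * (1 + (x i)\<^sup>2) \<le> Q"
        unfolding Q_def using that
        by (subst prod.remove[of _ j]) (auto intro!: mult_left_mono Q1)
      finally show ?thesis by simp
    qed
    have "(vandermonde_prod ?d x)\<^sup>2 = (\<Prod>j<?d. \<Prod>i<j. (x j - x i)\<^sup>2)"
      by (simp add: vandermonde_prod_def prod_power_distrib del: prod.lessThan_Suc)
    also have "\<dots> \<le> (\<Prod>j<?d. \<Prod>i<j. 2 * Q)"
      by (intro prod_mono conjI prod_nonneg) (use pair in auto)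
    also have "\<dots> = (2 * Q) ^ D"
      by (simp add: D_def power_sum del: prod.lessThan_Suc sum.lessThan_Suc)
    also have "Q = (\<Prod>j<e. 1 + (y j)\<^sup>2)" by (simp add: Q_def x_def)
    finally have "(vandermonde_prod ?d x)\<^sup>2 \<le> 2 ^ D * (\<Prod>j<e. 1 + (y j)\<^sup>2) ^ D" by (simp add: power_mult_distrib)
    then have "(vandermonde_prod ?d x)\<^sup>2 * exp (- b * (\<Sum>j<e. (y j)\<^sup>2)) \<le> 2 ^ D * (\<Prod>j<e. 1 + (y j)\<^sup>2) ^ D * exp (- b * (\<Sum>j<e. (y j)\<^sup>2))"
      by (rule mult_right_mono) simp
    also have "\<dots> = ?f y"
      by (simp add: prod.distrib exp_sum[symmetric] sum_distrib_left prod_power_distrib sum_negf)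
    finally show ?thesis by (simp add: x_def)
  qed
  show ?thesis
  proof (rule Bochner_Integration.integrable_bound[OF int meas], intro AE_I2)
    fix y
    have "norm ((vandermonde_prod ?d (y(e := 0)))\<^sup>2 * exp (- b * (\<Sum>j<e. (y j)\<^sup>2))) =
      (vandermonde_prod ?d (y(e := 0)))\<^sup>2 * exp (- b * (\<Sum>j<e. (y j)\<^sup>2))"
      unfolding real_norm_def by (rule abs_of_nonneg) simp
    also have "\<dots> \<le> norm (?f y)" using bound[of y] unfolding real_norm_def by linarith
    finally show "norm ((vandermonde_prod ?d (y(e := 0)))\<^sup>2 * exp (- b * (\<Sum>j<e. (y j)\<^sup>2))) \<le> norm (?f y)" .
  qed
qed

section \<open>Passage to the limit and the final constant\<close>

text \<open>Dominated convergence in the rescaled angles: the box exhausts the space, and the limit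
  of the integrand is the integrand of \<open>reduced_mehta_integral\<close>.\<close>

lemma scaled_torus_integral_tendsto:
  fixes r e :: nat and c :: real
  defines "d \<equiv> Suc e"
  defines "c \<equiv> real r * (2 * d + r + 1) / (d * (d + 1))"
  defines "K \<equiv> real (d ^ r * card (compositions d r))"
  defines "D \<equiv> (\<Sum>j<d. j)"
  assumes er: "e \<ge> 1" "r \<ge> 1"
  shows "(\<lambda>n. fact d * real (avoiding_count (Suc d) r n) * (2 * pi * sqrt (c * real n)) ^ e * ((sqrt (c * real n))\<^sup>2) ^ D / K ^ n)
    \<longlonglongrightarrow> fact d * (\<Prod>k<d. fact k) * (2 * pi) powr (real d / 2) * sqrt (real d / (2 * pi))"
proof -
  let ?M = "Pi\<^sub>M {..<e} (\<lambda>_. lborel :: real measure)"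
  define L where "L = fact d * (\<Prod>k<d. fact k) * (2 * pi) powr (real d / 2) * sqrt (real d / (2 * pi))"
  define S where "S n = sqrt (c * real n)" for n
  define F where "F n \<theta> = of_real ((cmod (vandermonde_prod d (\<lambda>j. cis (\<theta> j))))\<^sup>2) *
      (power_sum d \<theta> ^ r * complete_sum d r \<theta>) ^ n" for n \<theta>
  \<comment> \<open>Here \<open>D\<close> is the number of differences in the Vandermonde product,
    so the power of \<open>S n\<close> supplies one factor \<open>S n\<close> to each chord, and
    \<open>K ^ n\<close> normalises the generating functions to 1 at equal angles.\<close>
  define h where "h n y = torus_box e (S n) y *\<^sub>R (of_real (((S n)\<^sup>2) ^ D / K ^ n) * F n (torus_angle e (S n) y))" for n y
  define g where "g y = (vandermonde_prod d (y(e := 0)))\<^sup>2 * exp (- gap_energy d (y(e := 0)) / (2 * real d))" for y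
  \<comment> \<open>The rate in \<open>power_sum_bound\<close> for angles \<open>y j / S n\<close>,
    after the \<open>n\<close>-th power: \<open>(S n)\<^sup>2 = c * n\<close> cancels the
    \<open>n\<close>.\<close>
  define b where "b = 1 / (8 * (real d)\<^sup>2 * c)"
  define w where "w y = (vandermonde_prod d (y(e := 0)))\<^sup>2 * exp (- b * (\<Sum>j<e. (y j)\<^sup>2))" for y
  have d0: "real d > 0" by (simp add: d_def)
  have c0: "c > 0" unfolding c_def by (intro divide_pos_pos mult_pos_pos) (use er d0 in \<open>auto intro: add_pos_nonneg\<close>)
  have cardC: "card (compositions d r) > 0" by (simp add: d_def card_compositions zero_less_binomial_iff)
  have K0: "K > 0" using cardC by (simp add: K_def d_def)
  have b0: "b > 0" using c0 d0 by (simp add: b_def)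
  have S0: "S n > 0" if "n > 0" for n using that c0 by (simp add: S_def)
  have gint: "has_bochner_integral ?M g L"
    unfolding g_def L_def d_def by (rule reduced_mehta_integral)
  have wint: "integrable ?M w"
    using integrable_vandermonde_gaussian[OF b0, of e] by (simp add: w_def[abs_def] d_def)
  have tameF: "tame e s (F n)" for n s
  proof -
    have "F n = (\<lambda>\<theta>. (alternant d \<theta> * cnj (alternant d \<theta>)) * (power_sum d \<theta> ^ r * complete_sum d r \<theta>) ^ n)"
      unfolding F_def norm_alternant[symmetric] complex_norm_square ..
    then show ?thesis
      unfolding d_def by (auto intro!: tame_mult tame_power tame_alternant tame_power_sum tame_complete_sum
        tame_sum tame_const tame_cis_minus_pairing simp: cnj_alternant)
  qed
  have hint: "(\<integral>y. h n y \<partial>?M) = of_real (fact d * real (avoiding_count (Suc d) r n) * (2 * pi * S n) ^ e * ((S n)\<^sup>2) ^ D / K ^ n)"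
    and hmeas: "h n \<in> borel_measurable ?M" if "n > 0" for n
  proof -
    have "h n = (\<lambda>y. torus_box e (S n) y *\<^sub>R (\<lambda>\<theta>. of_real (((S n)\<^sup>2) ^ D / K ^ n) * F n \<theta>) (torus_angle e (S n) y))"
      by (simp add: h_def fun_eq_iff)
    moreover have "tame e (S n) (\<lambda>\<theta>. of_real (((S n)\<^sup>2) ^ D / K ^ n) * F n \<theta>)"
      by (intro tame_mult tame_const tameF)
    ultimately show "h n \<in> borel_measurable ?M"
      using tame_integrable[OF _ S0[OF that]] by (simp add: borel_measurable_integrable)
    have T: "torus_mean e (S n) (F n) = of_nat (fact d * avoiding_count (Suc d) r n)"
      using avoiding_count_eq_torus_mean[OF S0[OF that], of e r n] by (simp add: F_def[abs_def] d_def)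
    have "(\<integral>y. h n y \<partial>?M) = torus_mean e (S n) (\<lambda>\<theta>. of_real (((S n)\<^sup>2) ^ D / K ^ n) * F n \<theta>) * of_real ((2 * pi * S n) ^ e)"
      using S0[OF that] by (simp add: torus_mean_def h_def)
    then show "(\<integral>y. h n y \<partial>?M) = of_real (fact d * real (avoiding_count (Suc d) r n) * (2 * pi * S n) ^ e * ((S n)\<^sup>2) ^ D / K ^ n)"
      unfolding torus_mean_cmult T by simp
  qed
  have hform: "h n y = torus_box e (S n) y *\<^sub>R (of_real (\<Prod>j<d. \<Prod>i<j. (S n * cmod (cis ((y(e := 0)) j / S n) - cis ((y(e := 0)) i / S n)))\<^sup>2) *
     ((power_sum d (torus_angle e (S n) y) ^ r * complete_sum d r (torus_angle e (S n) y)) / of_real K) ^ n)" for n y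
  proof -
    have "(cmod (vandermonde_prod d x))\<^sup>2 * ((S n)\<^sup>2) ^ D = (\<Prod>j<d. \<Prod>i<j. (S n * cmod (x j - x i))\<^sup>2)" for x
      by (simp add: vandermonde_prod_def prod_norm[symmetric] prod_power_distrib D_def power_sum power_mult_distrib prod.distrib)
    from this[of "\<lambda>j. cis (torus_angle e (S n) y j)"] have V: "(cmod (vandermonde_prod d (\<lambda>j. cis (torus_angle e (S n) y j))))\<^sup>2 * ((S n)\<^sup>2) ^ D =
      (\<Prod>j<d. \<Prod>i<j. (S n * cmod (cis ((y(e := 0)) j / S n) - cis ((y(e := 0)) i / S n)))\<^sup>2)"
      by (simp only: torus_angle_def)
    show ?thesis unfolding h_def F_def V[symmetric] by (simp add: power_divide)
  qed
  have lim: "(\<lambda>n. h n y) \<longlonglongrightarrow> of_real (g y)" for y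
  proof -
    have "(\<lambda>n. torus_box e (S n) y) \<longlonglongrightarrow> (\<Prod>j<e. 1)"
      unfolding torus_box_def
    proof (rule tendsto_prod)
      fix j
      have "filterlim (\<lambda>n. pi * S n) at_top sequentially" unfolding S_def using c0 by real_asymp
      then have "\<forall>\<^sub>F n in sequentially. \<bar>y j\<bar> \<le> pi * S n" by (simp add: filterlim_at_top)
      then have "\<forall>\<^sub>F n in sequentially. indicator {- pi * S n..pi * S n} (y j) = (1 :: real)"
        by eventually_elim (auto simp: indicator_def)
      then show "(\<lambda>n. indicator {- pi * S n..pi * S n} (y j)) \<longlonglongrightarrow> (1 :: real)"
        by (rule tendsto_eventually)
    qed
    moreover have "(\<lambda>n. \<Prod>j<d. \<Prod>i<j. (S n * cmod (cis ((y(e := 0)) j / S n) - cis ((y(e := 0)) i / S n)))\<^sup>2)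
      \<longlonglongrightarrow> (\<Prod>j<d. \<Prod>i<j. ((y(e := 0)) j - (y(e := 0)) i)\<^sup>2)"
      unfolding S_def by (intro tendsto_prod scaled_cis_diff_tendsto c0)
    moreover have "(\<lambda>n. ((power_sum d (torus_angle e (S n) y) ^ r * complete_sum d r (torus_angle e (S n) y)) / of_real K) ^ n)
      \<longlonglongrightarrow> of_real (exp (- gap_energy d (y(e := 0)) / (2 * d)))"
      using generating_power_tendsto[OF er, of y] unfolding S_def K_def c_def d_def of_real_of_nat_eq
      by (simp only: of_nat_mult of_nat_add of_nat_1 of_nat_numeral)
    ultimately have "(\<lambda>n. h n y) \<longlonglongrightarrow> (\<Prod>j<e. 1 :: real) *\<^sub>R (of_real (\<Prod>j<d. \<Prod>i<j. ((y(e := 0)) j - (y(e := 0)) i)\<^sup>2) *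
      of_real (exp (- gap_energy d (y(e := 0)) / (2 * d))))"
      unfolding hform by (intro tendsto_scaleR tendsto_mult tendsto_of_real)
    also have "(\<Prod>j<d. \<Prod>i<j. ((y(e := 0)) j - (y(e := 0)) i)\<^sup>2) = (vandermonde_prod d (y(e := 0)))\<^sup>2"
      by (simp only: vandermonde_prod_def prod_power_distrib)
    finally show ?thesis by (simp add: g_def del: fun_upd_apply)
  qed
  have bound: "norm (h n y) \<le> w y" if n: "n > 0" for n y
  proof (cases "\<forall>j<e. \<bar>y j\<bar> \<le> pi * S n")
    case False
    then obtain j where j: "j < e" "\<not> \<bar>y j\<bar> \<le> pi * S n" by blast
    have "torus_box e (S n) y = 0"
      unfolding torus_box_def
    proof (rule prod_zero)
      have "indicator {- pi * S n..pi * S n} (y j) = (0 :: real)" using j(2) by (auto simp: indicator_def)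
      then show "\<exists>j\<in>{..<e}. indicator {- pi * S n..pi * S n} (y j) = (0 :: real)" using j(1) by blast
    qed simp
    then show ?thesis by (simp add: h_def w_def)
  next
    case True
    define \<theta> where "\<theta> = torus_angle e (S n) y"
    have \<theta>: "\<theta> j = y j / S n" if "j < e" for j using that by (simp add: \<theta>_def torus_angle_def)
    have "cmod (power_sum d \<theta>) \<le> real d * exp (- (\<Sum>j<e. (\<theta> j)\<^sup>2) / (8 * (real d)\<^sup>2))"
      unfolding d_def
    proof (rule power_sum_bound)
      show "\<bar>\<theta> j\<bar> \<le> pi" if "j < e" for j using True that S0[OF n] by (simp add: \<theta> pos_divide_le_eq)
      show "\<theta> e = 0" by (simp add: \<theta>_def torus_angle_def)
    qed
    then have q: "cmod (power_sum d \<theta>) / real d \<le> exp (- (\<Sum>j<e. (\<theta> j)\<^sup>2) / (8 * (real d)\<^sup>2))"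
      using d0 by (simp add: pos_divide_le_eq mult.commute)
    have q1: "cmod (power_sum d \<theta>) / real d \<le> 1"
      by (rule order_trans[OF q]) (auto intro!: sum_nonneg divide_nonneg_nonneg)
    have hh: "cmod (complete_sum d r \<theta>) / real (card (compositions d r)) \<le> 1"
    proof -
      have "cmod (complete_sum d r \<theta>) \<le> (\<Sum>\<alpha>\<in>compositions d r. 1)"
        unfolding complete_sum_def by (rule sum_norm_le) simp
      then show ?thesis using cardC by simp
    qed
    have "cmod (power_sum d \<theta> ^ r * complete_sum d r \<theta> / of_real K) =
      (cmod (power_sum d \<theta>) / real d) ^ r * (cmod (complete_sum d r \<theta>) / real (card (compositions d r)))"
      by (simp add: K_def norm_mult norm_divide norm_power power_divide)
    \<comment> \<open>A single factor \<open>power_sum\<close> already provides Gaussian decay; the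
      hypothesis \<open>r \<ge> 1\<close> guarantees one, and everything else is bounded by
      1.\<close>
    also have "\<dots> \<le> (cmod (power_sum d \<theta>) / real d) ^ 1 * 1"
      by (intro mult_mono power_decreasing hh q1 er(2)) auto
    also have "\<dots> \<le> exp (- (\<Sum>j<e. (\<theta> j)\<^sup>2) / (8 * (real d)\<^sup>2))" using q by simp
    finally have "cmod (power_sum d \<theta> ^ r * complete_sum d r \<theta> / of_real K) ^ n \<le> exp (- (\<Sum>j<e. (\<theta> j)\<^sup>2) / (8 * (real d)\<^sup>2)) ^ n"
      by (rule power_mono) simp
    also have "\<dots> = exp (- b * (\<Sum>j<e. (y j)\<^sup>2))"
    proof -
      have sq: "(\<Sum>j<e. (\<theta> j)\<^sup>2) = (\<Sum>j<e. (y j)\<^sup>2) / (c * real n)"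
        unfolding sum_divide_distrib using c0 by (intro sum.cong) (auto simp: \<theta> power_divide S_def)
      have "real n * (- (\<Sum>j<e. (\<theta> j)\<^sup>2) / (8 * (real d)\<^sup>2)) = - b * (\<Sum>j<e. (y j)\<^sup>2)"
        unfolding sq using n c0 d0 by (simp add: b_def field_simps)
      then show ?thesis by (simp only: exp_of_nat_mult[symmetric])
    qed
    finally have E: "cmod (power_sum d \<theta> ^ r * complete_sum d r \<theta> / of_real K) ^ n \<le> exp (- b * (\<Sum>j<e. (y j)\<^sup>2))" .
    let ?P = "\<Prod>j<d. \<Prod>i<j. (S n * cmod (cis ((y(e := 0)) j / S n) - cis ((y(e := 0)) i / S n)))\<^sup>2"
    have P: "?P \<le> (vandermonde_prod d (y(e := 0)))\<^sup>2"
      unfolding vandermonde_prod_def prod_power_distrib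
      by (intro prod_mono conjI prod_nonneg zero_le_power2 scaled_cis_diff_le S0[OF n] ballI)
    have P0: "?P \<ge> 0" by (intro prod_nonneg ballI zero_le_power2)
    have B: "torus_box e (S n) y \<le> 1" "torus_box e (S n) y \<ge> 0"
      unfolding torus_box_def by (auto intro!: prod_le_1 prod_nonneg simp: indicator_def)
    have "norm (h n y) = torus_box e (S n) y * (?P * cmod (power_sum d \<theta> ^ r * complete_sum d r \<theta> / of_real K) ^ n)"
      unfolding hform \<theta>_def[symmetric] norm_scaleR norm_mult norm_power norm_of_real using P0 B by simp
    also have "\<dots> \<le> 1 * ((vandermonde_prod d (y(e := 0)))\<^sup>2 * exp (- b * (\<Sum>j<e. (y j)\<^sup>2)))"
      by (intro mult_mono B P E P0 mult_nonneg_nonneg zero_le_power2 zero_le_power norm_ge_zero zero_le_one exp_ge_zero)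
    finally show ?thesis by (simp add: w_def)
  qed
  \<comment> \<open>The index is shifted because the scale \<open>S 0\<close> is 0 and the bounds
    need a positive one.\<close>
  have "(\<lambda>n. \<integral>y. h (Suc n) y \<partial>?M) \<longlonglongrightarrow> (\<integral>y. of_real (g y) \<partial>?M)"
  proof (rule integral_dominated_convergence[where w = w])
    show "(\<lambda>y. complex_of_real (g y)) \<in> borel_measurable ?M"
      using gint by (auto simp: has_bochner_integral_iff)
    show "integrable ?M w" by (rule wint)
    show "h (Suc n) \<in> borel_measurable ?M" for n by (rule hmeas) simp
    show "AE y in ?M. (\<lambda>n. h (Suc n) y) \<longlonglongrightarrow> of_real (g y)"
      by (intro AE_I2 LIMSEQ_Suc lim)
    show "AE y in ?M. norm (h (Suc n) y) \<le> w y" for n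
      by (intro AE_I2 bound) simp
  qed
  also have "(\<integral>y. complex_of_real (g y) \<partial>?M) = of_real L"
    using gint by (simp add: has_bochner_integral_iff)
  finally have "(\<lambda>n. complex_of_real (fact d * real (avoiding_count (Suc d) r (Suc n)) * (2 * pi * S (Suc n)) ^ e * ((S (Suc n))\<^sup>2) ^ D / K ^ Suc n)) \<longlonglongrightarrow> of_real L"
    using hint by simp
  then have "(\<lambda>n. fact d * real (avoiding_count (Suc d) r (Suc n)) * (2 * pi * S (Suc n)) ^ e * ((S (Suc n))\<^sup>2) ^ D / K ^ Suc n) \<longlonglongrightarrow> L"
    by (simp only: tendsto_of_real_iff)
  then show ?thesis unfolding S_def L_def by (rule LIMSEQ_imp_Suc)
qed

theorem theorem1:
  fixes d r :: nat and C :: real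
  assumes "d \<ge> 2" and "r \<ge> 1"
  defines "C \<equiv>
    sqrt (real d) * (\<Prod>i=1..d-1. fact i) / (2 * pi) powr (real d / 2 - 1 / 2) *
    (real d * (real d + 1) / (real r * (2 * real d + real r + 1)))
      powr ((real d - 1) * (real d + 1) / 2)"
  shows "(\<lambda>n. real (avoiding_count (d + 1) r n)) \<sim>[at_top]
    (\<lambda>n. C * real n powr (- ((real d + 1) * (real d - 1) / 2)) *
         (real (d ^ r * ((r + d - 1) choose (d - 1)))) ^ n)"
proof -
  define e where "e = d - 1"
  have d: "d = Suc e" and e: "e \<ge> 1" using assms by (auto simp: e_def)
  define c where "c = real r * (2 * d + r + 1) / (d * (d + 1))"
  define K where "K = real (d ^ r * card (compositions d r))"
  define D where "D = (\<Sum>j<d. j)"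
  define E where "E = (real d - 1) * (real d + 1) / 2"
  define Q where "Q = (\<Prod>k<d. fact k :: real)"
  define L where "L = fact d * Q * (2 * pi) powr (real d / 2) * sqrt (real d / (2 * pi))"
  define W where "W n = fact d * real (avoiding_count (Suc d) r n) * (2 * pi * sqrt (c * real n)) ^ e * ((sqrt (c * real n))\<^sup>2) ^ D / K ^ n" for n
  have c0: "c > 0" unfolding c_def by (intro divide_pos_pos mult_pos_pos) (use assms(1,2) in \<open>auto intro: add_pos_nonneg\<close>)
  have K: "K = real (d ^ r * ((r + d - 1) choose (d - 1)))"
    using binomial_symmetric[of r "r + d - 1"] assms by (simp add: K_def card_compositions)
  have K0: "K > 0" using assms by (simp add: K zero_less_binomial_iff)
  have lim: "W \<longlonglongrightarrow> L"
    using scaled_torus_integral_tendsto[OF e assms(2)]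
    unfolding W_def L_def Q_def c_def K_def D_def d by simp
  have Q0: "Q > 0" by (simp add: Q_def prod_pos)
  have L0: "L > 0" using Q0 assms by (simp add: L_def)
  have D: "2 * D = d * e"
    unfolding D_def d by (induction e) (auto simp: algebra_simps)
  have Wn: "W n = (fact d * (2 * pi) ^ e * c powr E) * (real (avoiding_count (Suc d) r n) * real n powr E / K ^ n)" if "n > 0" for n
  proof -
    have cn: "c * real n > 0" using that c0 by simp
    have "sqrt (c * real n) ^ e * ((sqrt (c * real n))\<^sup>2) ^ D = sqrt (c * real n) ^ (e + 2 * D)"
      by (simp add: power_add power_mult)
    also have "\<dots> = sqrt (c * real n) powr real (e + 2 * D)"
      using cn by (simp only: powr_realpow real_sqrt_gt_0_iff)
    also have "\<dots> = (c * real n) powr (real (e + 2 * D) / 2)"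
      using cn by (simp add: powr_half_sqrt[symmetric] powr_powr)
    \<comment> \<open>Since \<open>2 * D = d * e\<close>, the exponent \<open>e + 2 * D\<close>
      equals \<open>e * (d + 1)\<close>.\<close>
    also have "real (e + 2 * D) / 2 = E"
      unfolding D E_def d by (simp add: algebra_simps)
    also have "(c * real n) powr E = c powr E * real n powr E"
      using c0 by (simp add: powr_mult)
    finally have "sqrt (c * real n) ^ e * ((sqrt (c * real n))\<^sup>2) ^ D = c powr E * real n powr E" .
    then show ?thesis by (simp add: W_def power_mult_distrib)
  qed
  \<comment> \<open>The factorial from the antisymmetrization equals the number of diagonal pairs of
    permutations in Mehta's integral, so none is left in \<open>C\<close>; the power of
    \<open>2 * pi\<close> on the left is the volume normalising the torus mean.\<close>
  have CL: "fact d * (2 * pi) ^ e * c powr E * C = L"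
  proof -
    have "(\<Prod>i=1..d-1. fact i :: real) = Q"
    proof -
      have "(\<Prod>i=1..m. fact i :: real) = (\<Prod>k<Suc m. fact k)" for m
        by (induction m) auto
      then show ?thesis by (simp add: Q_def d)
    qed
    moreover have "real d * (real d + 1) / (real r * (2 * real d + real r + 1)) = 1 / c"
      by (simp add: c_def algebra_simps)
    ultimately have C: "C = sqrt (real d) * Q / (2 * pi) powr (real d / 2 - 1 / 2) * (1 / c) powr E"
      by (simp add: C_def E_def)
    have "c powr E * (1 / c) powr E = 1" using c0 by (simp add: powr_divide)
    moreover have "(2 * pi) ^ e / (2 * pi) powr (real d / 2 - 1 / 2) = (2 * pi) powr (real d / 2) / sqrt (2 * pi)"
    proof -
      have "(2 * pi) ^ e = (2 * pi) powr (real d - 1)" by (simp add: d powr_realpow)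
      then have "(2 * pi) ^ e / (2 * pi) powr (real d / 2 - 1 / 2) = (2 * pi) powr ((real d - 1) - (real d / 2 - 1 / 2))"
        by (simp only: powr_diff)
      also have "(real d - 1) - (real d / 2 - 1 / 2) = real d / 2 - 1 / 2" by simp
      also have "(2 * pi) powr (real d / 2 - 1 / 2) = (2 * pi) powr (real d / 2) / sqrt (2 * pi)"
        by (simp add: powr_diff powr_half_sqrt)
      finally show ?thesis .
    qed
    moreover have "fact d * (2 * pi) ^ e * c powr E * C =
      fact d * Q * sqrt (real d) * ((2 * pi) ^ e / (2 * pi) powr (real d / 2 - 1 / 2)) * (c powr E * (1 / c) powr E)"
      unfolding C by simp
    ultimately show ?thesis by (simp add: L_def real_sqrt_divide)
  qed
  have C0: "C \<noteq> 0" using CL L0 by auto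
  have "(\<lambda>n. real (avoiding_count (d + 1) r n) / (C * real n powr (- E) * K ^ n)) \<longlonglongrightarrow> 1"
  proof -
    have "(\<lambda>n. W n / L) \<longlonglongrightarrow> L / L" using L0 by (intro tendsto_intros lim) simp
    moreover have "\<forall>\<^sub>F n in sequentially. W n / L = real (avoiding_count (d + 1) r n) / (C * real n powr (- E) * K ^ n)"
    proof (rule eventually_sequentiallyI[of 1])
      fix n :: nat assume "1 \<le> n"
      then have n: "n > 0" by simp
      have "fact d * (2 * pi) ^ e * c powr E \<noteq> 0" using CL L0 by auto
      then show "W n / L = real (avoiding_count (d + 1) r n) / (C * real n powr (- E) * K ^ n)"
        unfolding Wn[OF n] CL[symmetric] using C0 K0 n by (simp add: powr_minus field_simps)
    qed
    ultimately show ?thesis using L0 by (simp add: filterlim_cong[OF refl refl])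
  qed
  then have "(\<lambda>n. real (avoiding_count (d + 1) r n)) \<sim>[at_top] (\<lambda>n. C * real n powr (- E) * K ^ n)"
    by (rule asymp_equivI')
  then show ?thesis by (simp add: E_def K mult.commute[of "real d - 1"])
qed

end
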